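(* Let $f\colon\mathbb{R}^d\to\mathbb{R}$ be locally integrable, Lipschitz continuous, convex, and potentially non-smooth, with unique global minimizer $x^*$, and let $T_0>0$. Let $\Psi(t,x)$ be the solution to $$i\,\partial_t\Psi(t)=H_{\mathrm{C}}(t)\Psi(t),\qquad H_{\mathrm{C}}(t)=\frac{1}{t^3}\left(-\tfrac12\Delta\right)+t^3f(x),\qquad t\in[T_0,\infty),$$ subject to a smooth initial state $\Psi(T_0,x)=\Psi_0(x)$, and let $X_t$ be a random variable following the distribution with density $|\Psi(t,x)|^2$. Then $$\mathbb{E}[f(X_t)]-f(x^* )\le O\!\left(t^{-2}\right).$$
   Context: Locally integrable means $\int_{\mathbb{R}^d}|f\varphi|\,dx<\infty$ for every $\varphi\in C_c^\infty(\mathbb{R}^d)$. $\Delta=\sum_{j=1}^d\partial_{x_j}^2$ is the Laplacian on $\mathbb{R}^d$ and $f(x)$ acts as a multiplication operator. The initial state $\Psi_0$ is a complex-valued wave function with $\|\Psi_0\|_{L^2(\mathbb{R}^d)}=1$; the evolution preserves the $L^2$-norm, so $|\Psi(t,x)|^2$ is a probability density. Standing assumption: $f$ is finite on $\mathbb{R}^d$ and has a unique global minimum, attained at $x^*$. The $O(\cdot)$ is with respect to $t$; the implied constant does not depend on $t$. *)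

theory Defs
  imports "HOL-Probability.Probability"
begin

definition partial :: "'a::euclidean_space \<Rightarrow> ('a \<Rightarrow> 'b::real_normed_vector) \<Rightarrow> 'a \<Rightarrow> 'b" where
  "partial b u = (\<lambda>x. frechet_derivative u (at x) b)"

primrec iterated_partial ::
    "'a::euclidean_space list \<Rightarrow> ('a \<Rightarrow> 'b::real_normed_vector) \<Rightarrow> 'a \<Rightarrow> 'b" where
  "iterated_partial [] u = u"
| "iterated_partial (b # bs) u = partial b (iterated_partial bs u)"

text \<open>Class \<open>C\<^sup>\<infinity>\<close>: partial derivatives of every order exist and are differentiable,
  hence also continuous.\<close>

definition smooth :: "('a::euclidean_space \<Rightarrow> 'b::real_normed_vector) \<Rightarrow> bool" where
  "smooth u \<longleftrightarrow>
     (\<forall>bs. set bs \<subseteq> Basis \<longrightarrow> (\<forall>x. iterated_partial bs u differentiable (at x)))"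

definition test_function :: "('a::euclidean_space \<Rightarrow> real) \<Rightarrow> bool" where
  "test_function \<phi> \<longleftrightarrow> smooth \<phi> \<and> compact (closure {x. \<phi> x \<noteq> 0})"

definition locally_integrable :: "('a::euclidean_space \<Rightarrow> real) \<Rightarrow> bool" where
  "locally_integrable f \<longleftrightarrow>
     (\<forall>\<phi>. test_function \<phi> \<longrightarrow> integrable lborel (\<lambda>x. \<bar>f x * \<phi> x\<bar>))"

text \<open>Elements of \<open>L\<^sup>2\<close> are represented by Borel functions; equality of elements is
  equality almost everywhere.\<close>

definition L2 :: "('a::euclidean_space \<Rightarrow> complex) set" where
  "L2 = {u \<in> borel_measurable lborel. integrable lborel (\<lambda>x. (cmod (u x))\<^sup>2)}"

definition L2_norm :: "('a::euclidean_space \<Rightarrow> complex) \<Rightarrow> real" where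
  "L2_norm u = sqrt (LINT x|lborel. (cmod (u x))\<^sup>2)"

definition weak_partial ::
    "'a::euclidean_space \<Rightarrow> ('a \<Rightarrow> complex) \<Rightarrow> ('a \<Rightarrow> complex) \<Rightarrow> bool" where
  "weak_partial b u g \<longleftrightarrow>
     (\<forall>\<phi>. test_function \<phi> \<longrightarrow>
        (LINT x|lborel. partial b \<phi> x *\<^sub>R u x) = - (LINT x|lborel. \<phi> x *\<^sub>R g x))"

text \<open>The Laplacian as an operator on \<open>L\<^sup>2\<close> with domain the Sobolev space \<open>H\<^sup>2\<close>, given by its
  graph: \<open>u\<close> has all weak partial derivatives of order at most two in \<open>L\<^sup>2\<close>, and \<open>w\<close>
  represents the sum of the pure second ones.\<close>

definition laplacian :: "('a::euclidean_space \<Rightarrow> complex) \<Rightarrow> ('a \<Rightarrow> complex) \<Rightarrow> bool" where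
  "laplacian u w \<longleftrightarrow> u \<in> L2 \<and> w \<in> L2 \<and>
     (\<exists>p q. (\<forall>i\<in>Basis. p i \<in> L2 \<and> weak_partial i u (p i)) \<and>
            (\<forall>i\<in>Basis. \<forall>j\<in>Basis. q i j \<in> L2 \<and> weak_partial j (p i) (q i j)) \<and>
            (AE x in lborel. w x = (\<Sum>i\<in>Basis. q i i x)))"

text \<open>The graph of \<open>t\<^sup>-\<^sup>3 (- \<Delta> / 2) + t\<^sup>3 f\<close> on the natural domain of an operator sum, the
  intersection of the domain of the Laplacian with that of multiplication by \<open>f\<close>.\<close>

definition hamiltonian ::
    "('a::euclidean_space \<Rightarrow> real) \<Rightarrow> real \<Rightarrow> ('a \<Rightarrow> complex) \<Rightarrow> ('a \<Rightarrow> complex) \<Rightarrow> bool" where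
  "hamiltonian f t u v \<longleftrightarrow>
     (\<exists>w. laplacian u w \<and> (\<lambda>x. f x *\<^sub>R u x) \<in> L2 \<and>
        (AE x in lborel. v x = (1 / t ^ 3) *\<^sub>R (- (1 / 2) *\<^sub>R w x) + t ^ 3 *\<^sub>R (f x *\<^sub>R u x)))"

definition has_L2_derivative ::
    "(real \<Rightarrow> 'a::euclidean_space \<Rightarrow> complex) \<Rightarrow> ('a \<Rightarrow> complex) \<Rightarrow> real \<Rightarrow> real set \<Rightarrow> bool" where
  "has_L2_derivative \<Psi> D t S \<longleftrightarrow>
     ((\<lambda>s. L2_norm (\<lambda>x. (1 / (s - t)) *\<^sub>R (\<Psi> s x - \<Psi> t x) - D x)) \<longlongrightarrow> 0) (at t within S)"

definition L2_continuous_on ::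
    "real set \<Rightarrow> (real \<Rightarrow> 'a::euclidean_space \<Rightarrow> complex) \<Rightarrow> bool" where
  "L2_continuous_on S \<Psi> \<longleftrightarrow>
     (\<forall>t\<in>S. ((\<lambda>s. L2_norm (\<lambda>x. \<Psi> s x - \<Psi> t x)) \<longlongrightarrow> 0) (at t within S))"

text \<open>A solution of \<open>\<i> \<partial>\<^sub>t \<Psi> = H(t) \<Psi>\<close> on \<open>[T, \<infinity>)\<close> in the usual sense for evolution
  equations with unbounded generators: \<open>\<Psi>\<close> is continuously differentiable into \<open>L\<^sup>2\<close>
  (one-sided at \<open>T\<close>), \<open>\<Psi> t\<close> lies in the domain of \<open>H(t)\<close>, and the equation holds in
  \<open>L\<^sup>2\<close> at every time.\<close>

definition schroedinger_solution ::
    "('a::euclidean_space \<Rightarrow> real) \<Rightarrow> real \<Rightarrow> (real \<Rightarrow> 'a \<Rightarrow> complex) \<Rightarrow> bool" where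
  "schroedinger_solution f T \<Psi> \<longleftrightarrow>
     (\<exists>D. (\<forall>t\<ge>T. \<Psi> t \<in> L2 \<and> D t \<in> L2 \<and> has_L2_derivative \<Psi> (D t) t {T..}) \<and>
          L2_continuous_on {T..} D \<and>
          (\<forall>t\<ge>T. hamiltonian f t (\<Psi> t) (\<lambda>x. \<i> * D t x)))"

end

theory Submission
  imports Defs
begin

text \<open>
  Write \<open>y = x - x\<^sup>*\<close>, \<open>p = - \<i> \<nabla>\<close> and \<open>J = y + p / (2 t\<^sup>2)\<close>. The proof shows that
  \<open>E(t) = \<langle>|J|\<^sup>2 / 2 + t\<^sup>2 (f - f(x\<^sup>*)) / 4\<rangle>\<close> does not increase: formally, the Heisenberg equations give
  \<open>E' = t / 2 * \<langle>f - f(x\<^sup>*) - y \<bullet> \<nabla>f\<rangle>\<close>, which is nonpositive by convexity, and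
  \<open>t\<^sup>2 / 4 * \<langle>f - f(x\<^sup>*)\<rangle> \<le> E(t) \<le> E(T\<^sub>0)\<close> is the claim.

  Since \<open>|J|\<^sup>2\<close> expands to \<open>|y|\<^sup>2 + (y \<bullet> p + p \<bullet> y) / (2 t\<^sup>2) + |p|\<^sup>2 / (4 t\<^sup>4)\<close>, one has
  \<open>E = \<langle>|y|\<^sup>2\<rangle> / 2 + \<langle>y \<bullet> p + p \<bullet> y\<rangle> / (4 t\<^sup>2) + \<langle>H\<rangle> / (4 t) - t\<^sup>2 f(x\<^sup>*) / 4\<close>. The energy \<open>\<langle>H\<rangle>\<close> of a strong
  solution is differentiable without further ado. The other two terms need not be; there \<open>y\<^sub>j\<^sup>2 / 2\<close> is
  replaced by the bounded function \<open>R\<^sup>2 y\<^sub>j\<^sup>2 / (2 (R\<^sup>2 + y\<^sub>j\<^sup>2))\<close>, which costs only an error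
  of order \<open>1 / R\<close> in the derivative. The state lies in the domain of \<open>y\<close>, because a convex function with a
  unique minimiser grows at least linearly, and the bound needed on \<open>\<langle>|y|\<^sup>2\<rangle>\<close>
  follows from Gronwall's inequality.
\<close>

section \<open>The Hilbert space \<open>L\<^sup>2\<close>\<close>

text \<open>Three obstacles shape the proof. A strong solution has a continuous time derivative in
  the norm of L2, but nothing is assumed about how its spatial derivatives depend on time. The
  quantity mixing y and p is therefore differentiated through weak continuity: skew-symmetry moves
  the spatial derivative onto test functions, and the energy bounds the kinetic part locally in
  time. Next, the potential has only one-sided derivatives, so integration by parts is carried out
  on its difference quotients. Finally, the bounded weight replacing s^2 / 2 is chosen by a sign: in
  the derivative of the regularised function the kinetic terms combine to the expectation of the
  second derivative of the weight minus 1, which is nonpositive since that derivative is at most 1.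
  Its third derivative, which enters through the commutator with the Laplacian, and the defect in
  the virial term, where the bound on the second moment of y is used, are of order 1 / R. The limit
  R to infinity is taken at a fixed time, after integrating in time.\<close>

lemma L2_measurable: "u \<in> L2 \<Longrightarrow> u \<in> borel_measurable borel"
  by (simp add: L2_def)

lemma L2_square_integrable: "u \<in> L2 \<Longrightarrow> integrable lborel (\<lambda>x. (cmod (u x))\<^sup>2)"
  by (simp add: L2_def)

lemma integrable_of_le:
  fixes v g :: "'a \<Rightarrow> real"
  assumes "integrable M g" "v \<in> borel_measurable M" "\<And>x. \<bar>v x\<bar> \<le> g x"
  shows "integrable M v"
  using assms(1,2)
proof (rule Bochner_Integration.integrable_bound)
  show "AE x in M. norm (v x) \<le> norm (g x)"
    using assms(3) by (intro AE_I2) (auto intro: order_trans[OF _ abs_ge_self])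
qed

lemma L2_bound:
  assumes "u \<in> L2" "v \<in> borel_measurable borel" "\<And>x. cmod (v x) \<le> C * cmod (u x)"
  shows "v \<in> L2"
proof -
  have "integrable lborel (\<lambda>x. C\<^sup>2 * (cmod (u x))\<^sup>2)"
    using L2_square_integrable[OF assms(1)] by simp
  moreover have "\<bar>(cmod (v x))\<^sup>2\<bar> \<le> C\<^sup>2 * (cmod (u x))\<^sup>2" for x
    using power_mono[OF assms(3)[of x], of 2] by (simp add: power_mult_distrib)
  ultimately have "integrable lborel (\<lambda>x. (cmod (v x))\<^sup>2)"
    using integrable_of_le[of lborel "\<lambda>x. C\<^sup>2 * (cmod (u x))\<^sup>2" "\<lambda>x. (cmod (v x))\<^sup>2"] assms(2)
    by simp
  then show ?thesis
    using assms(2) by (simp add: L2_def)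
qed

lemma L2_zero: "(\<lambda>_. 0) \<in> L2"
  by (simp add: L2_def)

lemma L2_scaleR: "u \<in> L2 \<Longrightarrow> (\<lambda>x. c *\<^sub>R u x) \<in> L2"
  by (rule L2_bound[of u _ "\<bar>c\<bar>"]) (auto dest: L2_measurable)

lemma L2_cmult: "u \<in> L2 \<Longrightarrow> (\<lambda>x. c * u x) \<in> L2"
  by (rule L2_bound[of u _ "cmod c"]) (auto dest: L2_measurable simp: norm_mult)

lemma L2_uminus: "u \<in> L2 \<Longrightarrow> (\<lambda>x. - u x) \<in> L2"
  using L2_scaleR[of u "-1"] by simp

lemma L2_add:
  assumes "u \<in> L2" "v \<in> L2"
  shows "(\<lambda>x. u x + v x) \<in> L2"
proof -
  have *: "(cmod (u x + v x))\<^sup>2 \<le> 2 * (cmod (u x))\<^sup>2 + 2 * (cmod (v x))\<^sup>2" for x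
  proof -
    have "(cmod (u x + v x))\<^sup>2 \<le> (cmod (u x) + cmod (v x))\<^sup>2"
      by (intro power_mono norm_triangle_ineq) auto
    also have "\<dots> \<le> 2 * (cmod (u x))\<^sup>2 + 2 * (cmod (v x))\<^sup>2"
      using sum_squares_bound[of "cmod (u x)" "cmod (v x)"] by (simp add: power2_sum)
    finally show ?thesis .
  qed
  have "integrable lborel (\<lambda>x. 2 * (cmod (u x))\<^sup>2 + 2 * (cmod (v x))\<^sup>2)"
    using L2_square_integrable[OF assms(1)] L2_square_integrable[OF assms(2)] by simp
  then have "integrable lborel (\<lambda>x. (cmod (u x + v x))\<^sup>2)"
    by (rule integrable_of_le) (use * assms[THEN L2_measurable] in auto)
  then show ?thesis
    using assms[THEN L2_measurable] by (simp add: L2_def)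
qed

lemma L2_diff: "u \<in> L2 \<Longrightarrow> v \<in> L2 \<Longrightarrow> (\<lambda>x. u x - v x) \<in> L2"
  using L2_add[OF _ L2_uminus, of u v] by simp

lemma L2_integrable_inner:
  assumes "u \<in> L2" "v \<in> L2"
  shows "integrable lborel (\<lambda>x. u x \<bullet> v x)"
proof -
  have *: "\<bar>u x \<bullet> v x\<bar> \<le> (cmod (u x))\<^sup>2 + (cmod (v x))\<^sup>2" for x
    using Cauchy_Schwarz_ineq2[of "u x" "v x"] sum_squares_bound[of "cmod (u x)" "cmod (v x)"]
      mult_nonneg_nonneg[OF norm_ge_zero[of "u x"] norm_ge_zero[of "v x"]] by linarith
  have "integrable lborel (\<lambda>x. (cmod (u x))\<^sup>2 + (cmod (v x))\<^sup>2)"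
    using L2_square_integrable[OF assms(1)] L2_square_integrable[OF assms(2)] by simp
  then show ?thesis
  proof (rule integrable_of_le)
    show "(\<lambda>x. u x \<bullet> v x) \<in> borel_measurable lborel"
      using assms[THEN L2_measurable] by simp
  qed (rule *)
qed

\<comment> \<open>Identifying functions that agree almost everywhere turns the seminorm into a norm,
  so that limits, continuity and Cauchy-Schwarz come from the class \<open>real_inner\<close>. The
  relation is partial because only members of \<open>L2\<close> represent a class.\<close>
quotient_type (overloaded) 'a l2 = "'a::euclidean_space \<Rightarrow> complex" / partial:
  "\<lambda>u v. u \<in> L2 \<and> v \<in> L2 \<and> (AE x in lborel. u x = v x)"
proof (rule part_equivpI)
  show "\<exists>u::'a \<Rightarrow> complex. u \<in> L2 \<and> u \<in> L2 \<and> (AE x in lborel. u x = u x)"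
    using L2_zero by auto
  show "symp (\<lambda>u v::'a \<Rightarrow> complex. u \<in> L2 \<and> v \<in> L2 \<and> (AE x in lborel. u x = v x))"
    by (auto simp: symp_def elim!: eventually_mono)
  show "transp (\<lambda>u v::'a \<Rightarrow> complex. u \<in> L2 \<and> v \<in> L2 \<and> (AE x in lborel. u x = v x))"
    by (auto simp: transp_def elim!: eventually_elim2)
qed

lemma abs_l2_eq_iff:
  "u \<in> L2 \<Longrightarrow> v \<in> L2 \<Longrightarrow> abs_l2 u = abs_l2 v \<longleftrightarrow> (AE x in lborel. u x = v x)"
  using Quotient3_rel[OF Quotient3_l2, of u v] by auto

lemma l2_cases [cases type: l2]:
  obtains u where "u \<in> L2" "U = abs_l2 u"
  using l2.abs_induct[of "\<lambda>U. \<exists>u. u \<in> L2 \<and> U = abs_l2 u" U] by auto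

text \<open>The inner product is the real part of the usual one; for it, multiplication by \<open>\<i>\<close> is
  skew-symmetric and an expectation \<open>\<langle>\<psi>, A \<psi>\<rangle>\<close> of a symmetric operator keeps its value.\<close>

instantiation l2 :: (euclidean_space) real_inner
begin

lift_definition zero_l2 :: "'a l2" is "\<lambda>_. 0"
  by (simp add: L2_zero)

lift_definition plus_l2 :: "'a l2 \<Rightarrow> 'a l2 \<Rightarrow> 'a l2" is "\<lambda>u v x. u x + v x"
  by (auto intro: L2_add elim!: eventually_elim2)

lift_definition minus_l2 :: "'a l2 \<Rightarrow> 'a l2 \<Rightarrow> 'a l2" is "\<lambda>u v x. u x - v x"
  by (auto intro: L2_diff elim!: eventually_elim2)

lift_definition uminus_l2 :: "'a l2 \<Rightarrow> 'a l2" is "\<lambda>u x. - u x"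
  by (auto intro: L2_uminus elim!: eventually_mono)

lift_definition scaleR_l2 :: "real \<Rightarrow> 'a l2 \<Rightarrow> 'a l2" is "\<lambda>c u x. c *\<^sub>R u x"
  by (auto intro!: L2_scaleR elim!: eventually_mono)

lift_definition inner_l2 :: "'a l2 \<Rightarrow> 'a l2 \<Rightarrow> real" is "\<lambda>u v. LINT x|lborel. u x \<bullet> v x"
  by (intro integral_cong_AE) (auto dest!: L2_measurable elim!: eventually_elim2)

definition norm_l2 :: "'a l2 \<Rightarrow> real" where
  "norm_l2 U = sqrt (U \<bullet> U)"

definition dist_l2 :: "'a l2 \<Rightarrow> 'a l2 \<Rightarrow> real" where
  "dist_l2 U V = norm (U - V)"

definition sgn_l2 :: "'a l2 \<Rightarrow> 'a l2" where
  "sgn_l2 U = scaleR (inverse (norm U)) U"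

definition uniformity_l2 :: "('a l2 \<times> 'a l2) filter" where
  "uniformity_l2 = (INF e\<in>{0 <..}. principal {(x, y). dist x y < e})"

definition open_l2 :: "'a l2 set \<Rightarrow> bool" where
  "open_l2 S \<longleftrightarrow> (\<forall>x\<in>S. \<forall>\<^sub>F (x', y) in uniformity. x' = x \<longrightarrow> y \<in> S)"

instance
proof
  fix U V W :: "'a l2" and a b :: real
  show "U + V + W = U + (V + W)"
    by transfer (auto intro: L2_add simp: algebra_simps)
  show "U + V = V + U"
    by transfer (auto intro: L2_add simp: algebra_simps)
  show "0 + U = U"
    by transfer auto
  show "- U + U = 0"
    by transfer (auto simp: L2_zero)
  show "U - V = U + - V"
    by transfer (auto intro: L2_diff)
  show "a *\<^sub>R (U + V) = a *\<^sub>R U + a *\<^sub>R V"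
    by transfer (auto simp del: scaleR_conv_of_real intro: L2_scaleR L2_add simp: scaleR_add_right)
  show "(a + b) *\<^sub>R U = a *\<^sub>R U + b *\<^sub>R U"
    by transfer (auto simp del: scaleR_conv_of_real intro: L2_scaleR L2_add simp: scaleR_add_left)
  show "a *\<^sub>R b *\<^sub>R U = (a * b) *\<^sub>R U"
    by transfer (auto simp del: scaleR_conv_of_real intro: L2_scaleR)
  show "1 *\<^sub>R U = U"
    by transfer auto
  show "U \<bullet> V = V \<bullet> U"
    by transfer (simp add: inner_commute)
  show "(U + V) \<bullet> W = U \<bullet> W + V \<bullet> W"
    by transfer (simp add: inner_add_left L2_integrable_inner)
  show "a *\<^sub>R U \<bullet> V = a * (U \<bullet> V)"
    by transfer simp
  show "0 \<le> U \<bullet> U"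
    by transfer simp
  show "U \<bullet> U = 0 \<longleftrightarrow> U = 0"
  proof transfer
    fix u :: "'a \<Rightarrow> complex"
    assume "u \<in> L2 \<and> u \<in> L2 \<and> (AE x in lborel. u x = u x)"
    then show "(LINT x|lborel. u x \<bullet> u x) = 0 \<longleftrightarrow>
        u \<in> L2 \<and> (\<lambda>_. 0) \<in> L2 \<and> (AE x in lborel. u x = 0)"
      by (subst integral_nonneg_eq_0_iff_AE) (auto simp: L2_zero L2_integrable_inner)
  qed
qed (simp_all add: norm_l2_def dist_l2_def sgn_l2_def uniformity_l2_def open_l2_def)

end

lemma add_abs_l2: "u \<in> L2 \<Longrightarrow> v \<in> L2 \<Longrightarrow> abs_l2 u + abs_l2 v = abs_l2 (\<lambda>x. u x + v x)"
  by (rule plus_l2.abs_eq) auto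

lemma diff_abs_l2: "u \<in> L2 \<Longrightarrow> v \<in> L2 \<Longrightarrow> abs_l2 u - abs_l2 v = abs_l2 (\<lambda>x. u x - v x)"
  by (rule minus_l2.abs_eq) auto

lemma scaleR_abs_l2: "u \<in> L2 \<Longrightarrow> c *\<^sub>R abs_l2 u = abs_l2 (\<lambda>x. c *\<^sub>R u x)"
  by (rule scaleR_l2.abs_eq) auto

lemma inner_abs_l2: "u \<in> L2 \<Longrightarrow> v \<in> L2 \<Longrightarrow> abs_l2 u \<bullet> abs_l2 v = (LINT x|lborel. u x \<bullet> v x)"
  by (rule inner_l2.abs_eq) auto

lemma zero_abs_l2: "0 = abs_l2 (\<lambda>_. 0)"
  by (rule zero_l2.abs_eq)

lemma norm_abs_l2: "u \<in> L2 \<Longrightarrow> norm (abs_l2 u) = L2_norm u"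
  by (simp add: norm_l2_def inner_abs_l2 L2_norm_def power2_norm_eq_inner)

lemma norm_abs_l2_power2: "u \<in> L2 \<Longrightarrow> (norm (abs_l2 u))\<^sup>2 = (LINT x|lborel. (cmod (u x))\<^sup>2)"
  by (simp add: norm_abs_l2 L2_norm_def)

lemma abs_l2_cong_AE: "u \<in> L2 \<Longrightarrow> v \<in> L2 \<Longrightarrow> AE x in lborel. u x = v x \<Longrightarrow> abs_l2 u = abs_l2 v"
  by (simp add: abs_l2_eq_iff)

lemma L2_dominated:
  assumes "g \<in> L2" "v \<in> borel_measurable borel" "AE x in lborel. cmod (v x) \<le> cmod (g x)"
  shows "v \<in> L2"
proof -
  have "AE x in lborel. norm ((cmod (v x))\<^sup>2) \<le> norm ((cmod (g x))\<^sup>2)"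
    using assms(3) by eventually_elim (simp add: power_mono)
  then have "integrable lborel (\<lambda>x. (cmod (v x))\<^sup>2)"
    using Bochner_Integration.integrable_bound[OF L2_square_integrable[OF assms(1)],
        of "\<lambda>x. (cmod (v x))\<^sup>2"] assms(2) by simp
  then show ?thesis
    using assms(2) by (simp add: L2_def)
qed

lemma L2_dominated_convergence_seq:
  fixes s :: "nat \<Rightarrow> 'a::euclidean_space \<Rightarrow> complex"
  assumes "\<And>i. s i \<in> borel_measurable borel" "u \<in> borel_measurable borel" "g \<in> L2"
    and bd: "\<And>i. AE x in lborel. cmod (s i x) \<le> cmod (g x)"
    and lim: "AE x in lborel. (\<lambda>i. s i x) \<longlonglongrightarrow> u x"
  shows "u \<in> L2" "(\<lambda>i. abs_l2 (s i)) \<longlonglongrightarrow> abs_l2 u"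
proof -
  have sL2: "s i \<in> L2" for i
    using assms by (intro L2_dominated[OF assms(3)]) auto
  have "AE x in lborel. \<forall>i. cmod (s i x) \<le> cmod (g x)"
    using bd by (simp add: AE_all_countable)
  with lim have ub: "AE x in lborel. cmod (u x) \<le> cmod (g x)"
  proof eventually_elim
    case (elim x)
    then show ?case
      by (intro LIMSEQ_le_const2[OF tendsto_norm[OF elim(1)]]) auto
  qed
  show u: "u \<in> L2"
    using ub assms by (intro L2_dominated[OF assms(3)]) auto
  have "(\<lambda>i. LINT x|lborel. (cmod (s i x - u x))\<^sup>2) \<longlonglongrightarrow> (LINT x|(lborel::'a measure). 0)"
  proof (rule integral_dominated_convergence)
    show "integrable lborel (\<lambda>x. 4 * (cmod (g x))\<^sup>2)"
      using L2_square_integrable[OF assms(3)] by simp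
    show "AE x in lborel. (\<lambda>i. (cmod (s i x - u x))\<^sup>2) \<longlonglongrightarrow> 0"
      using lim by eventually_elim (auto simp: LIM_zero_iff intro!: tendsto_eq_intros tendsto_norm_zero)
    fix i
    show "AE x in lborel. norm ((cmod (s i x - u x))\<^sup>2) \<le> 4 * (cmod (g x))\<^sup>2"
      using bd[of i] ub
    proof eventually_elim
      case (elim x)
      then have "cmod (s i x - u x) \<le> 2 * cmod (g x)"
        using norm_triangle_ineq4[of "s i x" "u x"] by linarith
      then have "(cmod (s i x - u x))\<^sup>2 \<le> (2 * cmod (g x))\<^sup>2"
        by (intro power_mono) auto
      then show ?case
        by (simp add: power_mult_distrib)
    qed
  qed (use assms in auto)
  then have "(\<lambda>i. (norm (abs_l2 (s i) - abs_l2 u))\<^sup>2) \<longlonglongrightarrow> 0"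
    by (simp add: diff_abs_l2 sL2 u norm_abs_l2_power2 L2_diff)
  from tendsto_real_sqrt[OF this] show "(\<lambda>i. abs_l2 (s i)) \<longlonglongrightarrow> abs_l2 u"
    by (simp add: tendsto_norm_zero_iff LIM_zero_iff)
qed

text \<open>Meant for difference quotients of test functions, whose supports stay in one ball only
  for small increments; hence the domination is asked for only at distance less than 1 from
  \<open>a\<close>, and sequences are cut to a tail.\<close>

lemma L2_dominated_convergence_at:
  fixes s :: "real \<Rightarrow> 'a::euclidean_space \<Rightarrow> complex"
  assumes "\<And>i. s i \<in> borel_measurable borel" "u \<in> borel_measurable borel" "g \<in> L2"
    and "\<And>i. i \<noteq> a \<Longrightarrow> \<bar>i - a\<bar> < 1 \<Longrightarrow> AE x in lborel. cmod (s i x) \<le> cmod (g x)"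
    and "AE x in lborel. ((\<lambda>i. s i x) \<longlongrightarrow> u x) (at a)"
  shows "((\<lambda>i. abs_l2 (s i)) \<longlongrightarrow> abs_l2 u) (at a)"
  unfolding tendsto_at_iff_sequentially
proof (intro allI impI)
  fix X :: "nat \<Rightarrow> real"
  assume X: "\<forall>i. X i \<in> UNIV - {a}" "X \<longlonglongrightarrow> a"
  then obtain N where N: "\<And>n. n \<ge> N \<Longrightarrow> \<bar>X n - a\<bar> < 1"
    using LIMSEQ_D[OF X(2), of 1] by auto
  have lim: "AE x in lborel. (\<lambda>n. s (X (n + N)) x) \<longlonglongrightarrow> u x"
    using assms(5)
  proof eventually_elim
    case (elim x)
    have "((\<lambda>i. s i x) \<circ> X) \<longlonglongrightarrow> u x"
      using elim X unfolding tendsto_at_iff_sequentially by blast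
    then show ?case
      unfolding comp_def by (rule LIMSEQ_ignore_initial_segment)
  qed
  have "(\<lambda>n. abs_l2 (s (X (n + N)))) \<longlonglongrightarrow> abs_l2 u"
    by (rule L2_dominated_convergence_seq(2)[OF assms(1) assms(2) assms(3) _ lim])
      (use X N assms(4) in auto)
  then show "((\<lambda>i. abs_l2 (s i)) \<circ> X) \<longlonglongrightarrow> abs_l2 u"
    unfolding comp_def by (rule LIMSEQ_offset)
qed

section \<open>Multiplication by the imaginary unit, and translations\<close>

lift_definition imul :: "'a::euclidean_space l2 \<Rightarrow> 'a l2" is "\<lambda>u x. \<i> * u x"
  by (auto intro: L2_cmult elim!: eventually_mono)

lemma imul_abs_l2: "u \<in> L2 \<Longrightarrow> imul (abs_l2 u) = abs_l2 (\<lambda>x. \<i> * u x)"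
  by (rule imul.abs_eq) auto

lemma imul_add: "imul (U + V) = imul U + imul V"
  by transfer (auto intro: L2_add L2_cmult simp: algebra_simps)

lemma imul_scaleR: "imul (c *\<^sub>R U) = c *\<^sub>R imul U"
  by transfer (auto intro!: L2_scaleR L2_cmult)

lemma imul_inner_imul [simp]: "imul U \<bullet> imul V = U \<bullet> V"
  by transfer (simp add: inner_complex_def algebra_simps)

lemma imul_imul [simp]: "imul (imul U) = - U"
  by transfer (auto intro: L2_uminus L2_cmult)

lemma inner_imul_left: "imul U \<bullet> V = - (U \<bullet> imul V)"
  by transfer (simp add: inner_complex_def algebra_simps flip: Bochner_Integration.integral_minus)

lemma inner_imul_self [simp]: "imul U \<bullet> U = 0" "U \<bullet> imul U = 0"
  using inner_imul_left[of U U] by (auto simp: inner_commute)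

lemma bounded_linear_imul: "bounded_linear imul"
  by (rule bounded_linear_intro[where K=1])
    (auto simp: imul_add imul_scaleR norm_eq_sqrt_inner)

lemma AE_lborel_translate:
  fixes h :: "'a::euclidean_space"
  assumes "AE x in lborel. P x"
  shows "AE x in lborel. P (x + h)"
proof -
  from AE_E[OF assms] obtain N
    where N': "{x \<in> space lborel. \<not> P x} \<subseteq> N" "emeasure lborel N = 0" "N \<in> sets lborel"
    by blast
  then have N: "{x. \<not> P x} \<subseteq> N" "N \<in> sets lborel" "emeasure lborel N = 0"
    by simp_all
  have "AE x in distr lborel borel ((+) h). x \<notin> N"
    using N by (subst lborel_distr_plus, intro AE_not_in) (auto simp: null_sets_def)
  moreover have "{x \<in> space borel. x \<notin> N} \<in> sets borel"
    using N(2) by simp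
  ultimately have "AE x in lborel. h + x \<notin> N"
    using AE_distr_iff[of "(+) h" lborel borel "\<lambda>x. x \<notin> N"] by simp
  then show ?thesis
  proof eventually_elim
    case (elim x)
    then show ?case
      using N(1) by (auto simp: add.commute)
  qed
qed

lemma lborel_integral_translate:
  fixes u :: "'a::euclidean_space \<Rightarrow> 'b::{banach, second_countable_topology}"
  assumes "u \<in> borel_measurable borel"
  shows "(LINT x|lborel. u (x + h)) = (LINT x|lborel. u x)"
  using integral_distr[of "(+) h" lborel borel u] assms
  by (simp add: lborel_distr_plus add.commute)

lemma lborel_integrable_translate:
  fixes u :: "'a::euclidean_space \<Rightarrow> 'b::{banach, second_countable_topology}"
  assumes "integrable lborel u"
  shows "integrable lborel (\<lambda>x. u (x + h))"
  using integrable_distr_eq[of "(+) h" lborel borel u] assms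
  by (simp add: lborel_distr_plus add.commute)

lemma L2_translate: "u \<in> L2 \<Longrightarrow> (\<lambda>x. u (x + h)) \<in> L2"
  using lborel_integrable_translate[of "\<lambda>x. (cmod (u x))\<^sup>2" h] by (auto simp: L2_def)

lift_definition shift :: "'a::euclidean_space \<Rightarrow> 'a l2 \<Rightarrow> 'a l2" is "\<lambda>h u x. u (x + h)"
  subgoal for h u v
    using AE_lborel_translate[of "\<lambda>x. u x = v x" h] by (auto intro: L2_translate)
  done

lemma shift_abs_l2: "u \<in> L2 \<Longrightarrow> shift h (abs_l2 u) = abs_l2 (\<lambda>x. u (x + h))"
  by (rule shift.abs_eq) auto

lemma shift_add: "shift h (U + V) = shift h U + shift h V"
  by transfer (auto intro: L2_add L2_translate)

lemma shift_scaleR: "shift h (c *\<^sub>R U) = c *\<^sub>R shift h U"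
  by transfer (auto intro!: L2_scaleR L2_translate)

lemma shift_inner_shift [simp]: "shift h U \<bullet> shift h V = U \<bullet> V"
proof transfer
  fix h :: 'a and u v :: "'a \<Rightarrow> complex"
  assume "u \<in> L2 \<and> u \<in> L2 \<and> (AE x in lborel. u x = u x)" "v \<in> L2 \<and> v \<in> L2 \<and> (AE x in lborel. v x = v x)"
  then show "(LINT x|lborel. u (x + h) \<bullet> v (x + h)) = (LINT x|lborel. u x \<bullet> v x)"
    by (intro lborel_integral_translate[where u="\<lambda>x. u x \<bullet> v x"]) (auto dest!: L2_measurable)
qed

lemma norm_shift [simp]: "norm (shift h U) = norm U"
  by (simp add: norm_eq_sqrt_inner)

lemma bounded_linear_shift: "bounded_linear (shift h)"
  by (rule bounded_linear_intro[where K=1]) (auto simp: shift_add shift_scaleR)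

lemmas shift_diff = linear_diff[OF bounded_linear.linear[OF bounded_linear_shift]]
lemmas imul_diff = linear_diff[OF bounded_linear.linear[OF bounded_linear_imul]]

lemma shift_shift: "shift h (shift k U) = shift (h + k) U"
  by transfer (auto intro: L2_translate simp: add.assoc)

lemma shift_zero [simp]: "shift 0 U = U"
  by transfer auto

lemma shift_imul: "shift h (imul U) = imul (shift h U)"
  by transfer (auto intro!: L2_translate L2_cmult)

lemma inner_shift_left: "shift h U \<bullet> V = U \<bullet> shift (- h) V"
  using shift_inner_shift[of h U "shift (- h) V"] by (simp add: shift_shift)

text \<open>Measurability of \<open>m\<close> is part of the predicate to make it respect classes:
  for a non-measurable \<open>m\<close> the product could be Borel for one representative and fail
  to be so for another that differs on a null set.\<close>

lift_definition in_dom :: "('a::euclidean_space \<Rightarrow> real) \<Rightarrow> 'a l2 \<Rightarrow> bool" is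
  "\<lambda>m u. m \<in> borel_measurable borel \<and> (\<lambda>x. m x *\<^sub>R u x) \<in> L2"
proof -
  fix m :: "'a \<Rightarrow> real" and u v :: "'a \<Rightarrow> complex"
  assume *: "u \<in> L2 \<and> v \<in> L2 \<and> (AE x in lborel. u x = v x)"
  have "(\<lambda>x. m x *\<^sub>R v x) \<in> L2" if "m \<in> borel_measurable borel" "(\<lambda>x. m x *\<^sub>R u x) \<in> L2"
      "u \<in> L2" "v \<in> L2" "AE x in lborel. u x = v x" for u v
    using that(5) by (intro L2_dominated[OF that(2)])
      (use that in \<open>auto dest: L2_measurable elim!: eventually_mono\<close>)
  from this[of u v] this[of v u] *
  show "(m \<in> borel_measurable borel \<and> (\<lambda>x. m x *\<^sub>R u x) \<in> L2) \<longleftrightarrow>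
        (m \<in> borel_measurable borel \<and> (\<lambda>x. m x *\<^sub>R v x) \<in> L2)"
    by (auto simp: eq_commute)
qed

text \<open>Multiplication by a possibly unbounded function, with value \<open>0\<close> off its domain.\<close>

lift_definition mul :: "('a::euclidean_space \<Rightarrow> real) \<Rightarrow> 'a l2 \<Rightarrow> 'a l2" is
  "\<lambda>m u. if m \<in> borel_measurable borel \<and> (\<lambda>x. m x *\<^sub>R u x) \<in> L2 then (\<lambda>x. m x *\<^sub>R u x) else (\<lambda>_. 0)"
  subgoal for m u v
    using in_dom.abs_eq[of u m] in_dom.abs_eq[of v m] abs_l2_eq_iff[of u v]
    by (auto simp: L2_zero elim!: eventually_mono)
  done

lemma in_dom_abs_l2:
  "u \<in> L2 \<Longrightarrow> in_dom m (abs_l2 u) \<longleftrightarrow> m \<in> borel_measurable borel \<and> (\<lambda>x. m x *\<^sub>R u x) \<in> L2"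
  by (rule in_dom.abs_eq) auto

lemma mul_abs_l2: "u \<in> L2 \<Longrightarrow> in_dom m (abs_l2 u) \<Longrightarrow> mul m (abs_l2 u) = abs_l2 (\<lambda>x. m x *\<^sub>R u x)"
  by (subst mul.abs_eq) (auto simp: in_dom_abs_l2)

lemma in_dom_bounded:
  assumes "m \<in> borel_measurable borel" "\<And>x. \<bar>m x\<bar> \<le> B"
  shows "in_dom m U"
proof (cases U)
  case (1 u)
  then show ?thesis
    using assms by (auto simp: in_dom_abs_l2 intro!: L2_bound[of u _ B] mult_right_mono dest: L2_measurable)
qed

lemma norm_mul_le:
  assumes "m \<in> borel_measurable borel" "\<And>x. \<bar>m x\<bar> \<le> B"
  shows "norm (mul m U) \<le> B * norm U"
proof (cases U)
  case (1 u)
  have B: "B \<ge> 0"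
    using assms(2)[of 0] by linarith
  have d: "in_dom m (abs_l2 u)"
    using in_dom_bounded assms by blast
  then have m: "(\<lambda>x. m x *\<^sub>R u x) \<in> L2"
    using 1 by (simp add: in_dom_abs_l2)
  have "(norm (mul m U))\<^sup>2 = (LINT x|lborel. (cmod (m x *\<^sub>R u x))\<^sup>2)"
    using norm_abs_l2_power2[OF m] 1 d by (simp add: mul_abs_l2)
  also have "\<dots> \<le> (LINT x|lborel. B\<^sup>2 * (cmod (u x))\<^sup>2)"
  proof (intro integral_mono)
    show "integrable lborel (\<lambda>x. (cmod (m x *\<^sub>R u x))\<^sup>2)"
      using L2_square_integrable[OF m] .
    show "integrable lborel (\<lambda>x. B\<^sup>2 * (cmod (u x))\<^sup>2)"
      using L2_square_integrable[OF 1(1)] by simp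
    fix x
    have "cmod (m x *\<^sub>R u x) \<le> B * cmod (u x)"
      using assms(2)[of x] by (auto intro!: mult_right_mono)
    from power_mono[OF this, of 2]
    show "(cmod (m x *\<^sub>R u x))\<^sup>2 \<le> B\<^sup>2 * (cmod (u x))\<^sup>2"
      by (simp add: power_mult_distrib)
  qed
  also have "\<dots> = (B * norm U)\<^sup>2"
    using 1 by (simp add: norm_abs_l2_power2 power_mult_distrib)
  finally show ?thesis
    using B by (simp add: power2_le_iff_abs_le)
qed

lemma in_dom_add: "in_dom m U \<Longrightarrow> in_dom m V \<Longrightarrow> in_dom m (U + V)"
  by transfer (auto simp: scaleR_add_right intro: L2_add)

lemma in_dom_scaleR: "in_dom m U \<Longrightarrow> in_dom m (c *\<^sub>R U)"
  apply transfer
  subgoal for m u c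
    using L2_scaleR[of "\<lambda>x. m x *\<^sub>R u x" c] by (simp add: algebra_simps)
  done

lemma mul_add: "in_dom m U \<Longrightarrow> in_dom m V \<Longrightarrow> mul m (U + V) = mul m U + mul m V"
proof (cases U; cases V)
  fix u v assume *: "u \<in> L2" "U = abs_l2 u" "v \<in> L2" "V = abs_l2 v" and d: "in_dom m U" "in_dom m V"
  have "mul m (abs_l2 (\<lambda>x. u x + v x)) = abs_l2 (\<lambda>x. m x *\<^sub>R (u x + v x))"
    using in_dom_add[OF d] * by (intro mul_abs_l2) (auto simp: add_abs_l2 L2_add)
  then show ?thesis
    using * d by (simp add: add_abs_l2 mul_abs_l2 in_dom_abs_l2 scaleR_add_right)
qed

lemma mul_scaleR: "in_dom m U \<Longrightarrow> mul m (c *\<^sub>R U) = c *\<^sub>R mul m U"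
proof (cases U)
  fix u assume *: "u \<in> L2" "U = abs_l2 u" and d: "in_dom m U"
  have "mul m (abs_l2 (\<lambda>x. c *\<^sub>R u x)) = abs_l2 (\<lambda>x. m x *\<^sub>R (c *\<^sub>R u x))"
    using in_dom_scaleR[OF d] * by (intro mul_abs_l2) (auto simp: scaleR_abs_l2 L2_scaleR)
  then show ?thesis
    using * d by (simp add: scaleR_abs_l2 mul_abs_l2 in_dom_abs_l2 mult.commute)
qed

lemma bounded_linear_mul:
  assumes "m \<in> borel_measurable borel" "\<And>x. \<bar>m x\<bar> \<le> B"
  shows "bounded_linear (mul m)"
  using norm_mul_le[OF assms] in_dom_bounded[OF assms]
  by (intro bounded_linear_intro[where K=B]) (auto simp: mul_add mul_scaleR mult.commute)

lemma inner_mul_abs_l2: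
  "u \<in> L2 \<Longrightarrow> v \<in> L2 \<Longrightarrow> in_dom m (abs_l2 u) \<Longrightarrow>
    mul m (abs_l2 u) \<bullet> abs_l2 v = (LINT x|lborel. m x * (u x \<bullet> v x))"
  by (simp add: mul_abs_l2 in_dom_abs_l2 inner_abs_l2)

lemma inner_mul_commute: "in_dom m U \<Longrightarrow> in_dom m V \<Longrightarrow> mul m U \<bullet> V = U \<bullet> mul m V"
  by (cases U; cases V) (simp add: inner_mul_abs_l2 inner_commute[of "abs_l2 _" "mul _ _"]
      inner_commute[of "_ :: complex"])

lemma in_dom_imul: "in_dom m U \<Longrightarrow> in_dom m (imul U)"
  apply transfer
  subgoal for m u
    using L2_cmult[of "\<lambda>x. m x *\<^sub>R u x" \<i>] by (simp add: algebra_simps)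
  done

lemma mul_imul: "in_dom m U \<Longrightarrow> mul m (imul U) = imul (mul m U)"
proof (cases U)
  fix u assume *: "u \<in> L2" "U = abs_l2 u" and d: "in_dom m U"
  have "mul m (abs_l2 (\<lambda>x. \<i> * u x)) = abs_l2 (\<lambda>x. m x *\<^sub>R (\<i> * u x))"
    using in_dom_imul[OF d] * by (intro mul_abs_l2) (auto simp: imul_abs_l2 L2_cmult)
  then show ?thesis
    using * d by (simp add: imul_abs_l2 mul_abs_l2 in_dom_abs_l2 mult.left_commute)
qed

lemma integrable_weight:
  assumes "u \<in> L2" "in_dom m (abs_l2 u)"
  shows "integrable lborel (\<lambda>x. m x * (u x \<bullet> u x))"
  using L2_integrable_inner[of "\<lambda>x. m x *\<^sub>R u x" u] assms by (simp add: in_dom_abs_l2)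

lemma inner_mul_mul:
  assumes "u \<in> L2" "in_dom m (abs_l2 u)" "in_dom n (abs_l2 u)"
  shows "integrable lborel (\<lambda>x. m x * n x * (u x \<bullet> u x))"
    "mul m (abs_l2 u) \<bullet> mul n (abs_l2 u) = (LINT x|lborel. m x * n x * (u x \<bullet> u x))"
proof -
  have L: "(\<lambda>x. m x *\<^sub>R u x) \<in> L2" "(\<lambda>x. n x *\<^sub>R u x) \<in> L2"
    using assms by (auto simp: in_dom_abs_l2)
  have eq: "(m x *\<^sub>R u x) \<bullet> (n x *\<^sub>R u x) = m x * n x * (u x \<bullet> u x)" for x
    by simp
  show "integrable lborel (\<lambda>x. m x * n x * (u x \<bullet> u x))"
    using L2_integrable_inner[OF L] unfolding eq .
  show "mul m (abs_l2 u) \<bullet> mul n (abs_l2 u) = (LINT x|lborel. m x * n x * (u x \<bullet> u x))"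
    using inner_abs_l2[OF L] assms unfolding eq by (simp add: mul_abs_l2)
qed

section \<open>Density of test functions\<close>

text \<open>The derivative of p(1/x) exp(-1/x) is q(1/x) exp(-1/x) with q = X^2 (p - p'). Carrying
  the polynomial as a parameter closes the family under differentiation, at 0 as well.\<close>

definition bump :: "real poly \<Rightarrow> real \<Rightarrow> real" where
  "bump p x = (if x > 0 then poly p (1 / x) * exp (- (1 / x)) else 0)"

lemma poly_exp_minus_tendsto_0: "((\<lambda>y::real. poly q y * exp (- y)) \<longlongrightarrow> 0) at_top"
proof -
  have "((\<lambda>y::real. \<Sum>i\<le>degree q. coeff q i * (y ^ i / exp y)) \<longlongrightarrow> (\<Sum>i\<le>degree q. coeff q i * 0)) at_top"
    by (intro tendsto_intros tendsto_power_div_exp_0)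
  moreover have "(\<lambda>y::real. \<Sum>i\<le>degree q. coeff q i * (y ^ i / exp y)) = (\<lambda>y. poly q y * exp (- y))"
    by (simp add: poly_altdef exp_minus sum_distrib_right divide_inverse mult.assoc fun_eq_iff)
  ultimately show ?thesis
    by simp
qed

lemma bump_has_derivative:
  "(bump p has_real_derivative bump (monom 1 2 * (p - pderiv p)) x) (at x)"
proof (cases "x = 0")
  case False
  show ?thesis
  proof (cases "x > 0")
    case True
    have "((\<lambda>x. poly p (1 / x) * exp (- (1 / x))) has_real_derivative
        bump (monom 1 2 * (p - pderiv p)) x) (at x)"
      using True by (auto intro!: derivative_eq_intros simp: bump_def poly_monom field_simps power2_eq_square)
    then show ?thesis
      by (rule DERIV_cong_ev[THEN iffD1, OF refl _ refl, rotated])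
        (use eventually_nhds_in_open[of "{0<..}" x] True in \<open>auto simp: bump_def elim!: eventually_mono\<close>)
  next
    case neg: False
    have "((\<lambda>x. 0) has_real_derivative bump (monom 1 2 * (p - pderiv p)) x) (at x)"
      using neg by (simp add: bump_def)
    then show ?thesis
      by (rule DERIV_cong_ev[THEN iffD1, OF refl _ refl, rotated])
        (use eventually_nhds_in_open[of "{..<0}" x] False neg in \<open>auto simp: bump_def elim!: eventually_mono\<close>)
  qed
next
  case True
  \<comment> \<open>The substitution h = 1 / y turns the quotient into y p(y) exp(-y), hence
    \<open>pCons 0 p\<close>.\<close>
  have "((\<lambda>h. bump p h / h) \<longlongrightarrow> 0) (at_right 0)"
  proof -
    have "((\<lambda>y. poly (pCons 0 p) y * exp (- y)) \<longlongrightarrow> 0) at_top"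
      by (rule poly_exp_minus_tendsto_0)
    moreover have "eventually (\<lambda>y. poly (pCons 0 p) y * exp (- y) = bump p (inverse y) / inverse y) at_top"
      using eventually_gt_at_top[of 0]
      by eventually_elim (simp add: bump_def field_simps)
    ultimately have "((\<lambda>y. bump p (inverse y) / inverse y) \<longlongrightarrow> 0) at_top"
      by (rule Lim_transform_eventually)
    then show ?thesis
      by (simp add: filterlim_at_right_to_top)
  qed
  moreover have "((\<lambda>h. bump p h / h) \<longlongrightarrow> 0) (at_left 0)"
    by (rule Lim_transform_eventually[of "\<lambda>_. 0"])
      (auto simp: bump_def eventually_at_filter)
  ultimately have "((\<lambda>h. bump p h / h) \<longlongrightarrow> 0) (at 0)"
    by (simp add: filterlim_split_at)
  then show ?thesis
    using True by (simp add: DERIV_def bump_def)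
qed

lemma bump_one: "bump 1 x = (if x > 0 then exp (- (1 / x)) else 0)"
  by (simp add: bump_def)

text \<open>Stable under partial derivatives, so that all members are smooth by induction on the order.\<close>

inductive bump_alg :: "('a::euclidean_space \<Rightarrow> real) \<Rightarrow> bool" where
  const: "bump_alg (\<lambda>_. c)"
| bump: "bump_alg (\<lambda>x. bump p (a * (x \<bullet> b) + c))"
| add: "bump_alg u \<Longrightarrow> bump_alg v \<Longrightarrow> bump_alg (\<lambda>x. u x + v x)"
| mult: "bump_alg u \<Longrightarrow> bump_alg v \<Longrightarrow> bump_alg (\<lambda>x. u x * v x)"

lemma bump_alg_has_derivative:
  "bump_alg u \<Longrightarrow>
    \<exists>D. (\<forall>x. (u has_derivative (\<lambda>b. D b x)) (at x)) \<and> (\<forall>b. bump_alg (D b))"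
proof (induction rule: bump_alg.induct)
  case (const c)
  show ?case
    by (rule exI[of _ "\<lambda>_ _. 0"]) (auto intro: bump_alg.const)
next
  case (bump p a b c)
  let ?q = "monom 1 2 * (p - pderiv p)"
  have "((\<lambda>x. a * (x \<bullet> b) + c) has_derivative (\<lambda>d. a * (d \<bullet> b))) (at x)" for x :: 'a
    by (auto intro!: derivative_eq_intros)
  then have "((\<lambda>x. bump p (a * (x \<bullet> b) + c)) has_derivative
      (\<lambda>d. bump ?q (a * (x \<bullet> b) + c) * (a * (d \<bullet> b)))) (at x)" for x
    using has_derivative_compose[of "\<lambda>x. a * (x \<bullet> b) + c" "\<lambda>d. a * (d \<bullet> b)" x UNIV
        "bump p" "\<lambda>d. bump ?q (a * (x \<bullet> b) + c) * d"]
      bump_has_derivative[of p "a * (x \<bullet> b) + c", unfolded has_field_derivative_def]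
    by blast
  then show ?case
    by (intro exI[of _ "\<lambda>d x. bump ?q (a * (x \<bullet> b) + c) * (a * (d \<bullet> b))"])
      (auto intro: bump_alg.intros)
next
  case (add u v)
  then obtain Du Dv where "\<And>x. (u has_derivative (\<lambda>b. Du b x)) (at x)" "\<And>b. bump_alg (Du b)"
    "\<And>x. (v has_derivative (\<lambda>b. Dv b x)) (at x)" "\<And>b. bump_alg (Dv b)"
    by blast
  then show ?case
    by (intro exI[of _ "\<lambda>b x. Du b x + Dv b x"]) (auto intro: bump_alg.intros has_derivative_add)
next
  case (mult u v)
  then obtain Du Dv where *: "\<And>x. (u has_derivative (\<lambda>b. Du b x)) (at x)" "\<And>b. bump_alg (Du b)"
    "\<And>x. (v has_derivative (\<lambda>b. Dv b x)) (at x)" "\<And>b. bump_alg (Dv b)"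
    by blast
  have "bump_alg (\<lambda>x. u x * Dv b x + Du b x * v x)" for b
    by (intro bump_alg.add bump_alg.mult * mult)
  moreover have "((\<lambda>x. u x * v x) has_derivative (\<lambda>b. u x * Dv b x + Du b x * v x)) (at x)" for x
    by (intro has_derivative_mult *)
  ultimately show ?case
    by (intro exI[of _ "\<lambda>b x. u x * Dv b x + Du b x * v x"]) simp
qed

lemma bump_alg_partial:
  assumes "bump_alg u"
  shows "(u has_derivative (\<lambda>b. partial b u x)) (at x)" "bump_alg (partial b u)"
proof -
  obtain D where D: "\<And>x. (u has_derivative (\<lambda>b. D b x)) (at x)" "\<And>b. bump_alg (D b)"
    using bump_alg_has_derivative[OF assms] by blast
  then have eq: "partial b u = D b" for b
    by (simp add: partial_def frechet_derivative_at[OF D(1), symmetric])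
  show "(u has_derivative (\<lambda>b. partial b u x)) (at x)" "bump_alg (partial b u)"
    using D by (simp_all add: eq)
qed

lemma bump_alg_smooth:
  assumes "bump_alg u"
  shows "smooth u"
proof -
  have "bump_alg (iterated_partial bs u)" for bs
    using assms by (induction bs) (auto intro: bump_alg_partial)
  then show ?thesis
    unfolding smooth_def using bump_alg_partial(1) by (auto simp: differentiable_def)
qed

lemma bump_alg_shift: "bump_alg u \<Longrightarrow> bump_alg (\<lambda>x. u (x + h))"
proof (induction rule: bump_alg.induct)
  case (bump p a b c)
  have "(\<lambda>x. bump p (a * ((x + h) \<bullet> b) + c)) = (\<lambda>x. bump p (a * (x \<bullet> b) + (a * (h \<bullet> b) + c)))"
    by (simp add: inner_add_left algebra_simps)
  then show ?case
    by (simp add: bump_alg.bump)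
qed (auto intro: bump_alg.intros)

lemma bump_alg_continuous: "bump_alg u \<Longrightarrow> continuous_on UNIV u"
  by (intro has_derivative_continuous_on[of _ _ "\<lambda>x b. partial b u x"])
    (use bump_alg_partial(1) in auto)

lemma bump_alg_prod: "finite I \<Longrightarrow> (\<And>i. i \<in> I \<Longrightarrow> bump_alg (u i)) \<Longrightarrow> bump_alg (\<lambda>x. \<Prod>i\<in>I. u i x)"
  by (induction rule: finite_induct) (auto intro: bump_alg.intros)

text \<open>A class of test functions that is closed under translations and partial derivatives and
  still spans a dense subspace; weak derivatives are tested only against it.\<close>

definition bump_test :: "('a::euclidean_space \<Rightarrow> real) \<Rightarrow> bool" where
  "bump_test u \<longleftrightarrow> bump_alg u \<and> (\<exists>R. \<forall>x. norm x > R \<longrightarrow> u x = 0)"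

lemma bump_test_test_function:
  assumes "bump_test u"
  shows "test_function u"
proof -
  obtain R where "\<And>x. norm x > R \<Longrightarrow> u x = 0"
    using assms by (auto simp: bump_test_def)
  then have "{x. u x \<noteq> 0} \<subseteq> cball 0 R"
    by (force simp: not_less[symmetric])
  then have "bounded {x. u x \<noteq> 0}"
    using bounded_subset bounded_cball by blast
  then show ?thesis
    using assms bump_alg_smooth by (auto simp: test_function_def bump_test_def)
qed

lemma bump_test_shift:
  assumes "bump_test u"
  shows "bump_test (\<lambda>x. u (x + h))"
proof -
  obtain R where R: "\<And>x. norm x > R \<Longrightarrow> u x = 0"
    using assms by (auto simp: bump_test_def)
  have "u (x + h) = 0" if "norm x > R + norm h" for x
    using norm_triangle_ineq4[of "x + h" h] that by (intro R) simp
  then show ?thesis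
    using assms by (auto simp: bump_test_def intro: bump_alg_shift)
qed

lemma bump_test_partial:
  assumes "bump_test u"
  shows "bump_test (partial b u)"
proof -
  obtain R where R: "\<And>x. norm x > R \<Longrightarrow> u x = 0"
    using assms by (auto simp: bump_test_def)
  have "partial b u x = 0" if "norm x > R" for x
  proof -
    have "open {x::'a. norm x > R}"
      by (intro open_Collect_less continuous_intros)
    then have "((\<lambda>_. 0) has_derivative (\<lambda>b. partial b u x)) (at x)"
      using has_derivative_transform_within_open[OF bump_alg_partial(1)[of u x],
          of "{x. norm x > R}" "\<lambda>_. 0"] assms that R by (auto simp: bump_test_def)
    then show ?thesis
      using has_derivative_unique[of "\<lambda>_. 0::real" _ x "\<lambda>_. 0"] by (metis has_derivative_const)
  qed
  then show ?thesis
    using assms unfolding bump_test_def by (auto intro: bump_alg_partial)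
qed

lemma bump_test_bounded:
  assumes "bump_test u"
  obtains R B where "R > 0" "B \<ge> 0" "\<And>x. \<bar>u x\<bar> \<le> B * indicator (cball 0 R) x"
proof -
  obtain R where R: "\<And>x. norm x > R \<Longrightarrow> u x = 0"
    using assms by (auto simp: bump_test_def)
  define S where "S = max R 1"
  have "compact (u ` cball 0 S)"
    using bump_alg_continuous[of u] assms
    by (intro compact_continuous_image) (auto simp: bump_test_def intro: continuous_on_subset)
  then obtain B where B: "\<And>x. x \<in> cball 0 S \<Longrightarrow> \<bar>u x\<bar> \<le> B"
    using compact_imp_bounded[of "u ` cball 0 S"] unfolding bounded_iff by (metis imageI real_norm_def)
  moreover have "0 \<in> cball (0::'a) S"
    by (simp add: S_def)
  ultimately have "B \<ge> 0"
    using abs_ge_zero order_trans by blast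
  then show ?thesis
    using B R by (intro that[of S B]) (auto simp: S_def indicator_def)
qed

lemma L2_indicator_ball: "(\<lambda>x. complex_of_real (B * indicator (cball 0 R) x)) \<in> L2"
proof -
  have "integrable lborel (\<lambda>x::'a::euclidean_space. B\<^sup>2 * indicator (cball 0 R) x :: real)"
    by (intro integrable_mult_right integrable_real_indicator) (use emeasure_lborel_cball_finite[of 0 R] in auto)
  moreover have "(cmod (complex_of_real (B * indicator (cball 0 R) x)))\<^sup>2 = B\<^sup>2 * indicator (cball 0 R) x" for x :: 'a
    by (simp add: power_mult_distrib indicator_def norm_mult)
  moreover have "(\<lambda>x::'a. complex_of_real (B * indicator (cball 0 R) x)) \<in> borel_measurable borel"
    by (intro measurable_compose[OF _ borel_measurable_of_real] borel_measurable_times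
        borel_measurable_const borel_measurable_indicator) simp
  ultimately show ?thesis
    unfolding L2_def by (simp del: of_real_mult)
qed

lemma bump_test_measurable: "bump_test u \<Longrightarrow> u \<in> borel_measurable borel"
  by (auto simp: bump_test_def intro: borel_measurable_continuous_onI bump_alg_continuous)

lemma bump_test_L2:
  assumes "bump_test u"
  shows "(\<lambda>x. c * complex_of_real (u x)) \<in> L2"
proof -
  obtain R B where *: "R > 0" "B \<ge> 0" "\<And>x. \<bar>u x\<bar> \<le> B * indicator (cball 0 R) x"
    using bump_test_bounded[OF assms] by metis
  have "(\<lambda>x. complex_of_real (u x)) \<in> L2"
    by (rule L2_bound[OF L2_indicator_ball[of B R], of _ 1])
      (use * bump_test_measurable[OF assms] in \<open>auto simp: norm_mult\<close>)
  then show ?thesis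
    by (rule L2_cmult)
qed

text \<open>The coefficient \<open>c\<close> is complex because the inner product is a real part:
  multiples of real functions by real numbers alone would not see imaginary parts.\<close>

inductive_set test_l2 :: "'a::euclidean_space l2 set" where
  bump: "bump_test u \<Longrightarrow> abs_l2 (\<lambda>x. c * complex_of_real (u x)) \<in> test_l2"
| add: "U \<in> test_l2 \<Longrightarrow> V \<in> test_l2 \<Longrightarrow> U + V \<in> test_l2"

lemma bump_test_zero: "bump_test (\<lambda>_. 0)"
  by (auto simp: bump_test_def intro: bump_alg.intros)

lemma closure_test_l2_add:
  assumes "U \<in> closure test_l2" "V \<in> closure test_l2"
  shows "U + V \<in> closure test_l2"
proof -
  obtain X Y where "\<And>n. X n \<in> test_l2" "X \<longlonglongrightarrow> U" "\<And>n. Y n \<in> test_l2" "Y \<longlonglongrightarrow> V"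
    using assms unfolding closure_sequential by blast
  then show ?thesis
    unfolding closure_sequential
    by (intro exI[of _ "\<lambda>n. X n + Y n"]) (auto intro: test_l2.add tendsto_add)
qed

lemma closure_test_l2_sum:
  "finite I \<Longrightarrow> (\<And>i. i \<in> I \<Longrightarrow> U i \<in> closure test_l2) \<Longrightarrow> (\<Sum>i\<in>I. U i) \<in> closure test_l2"
proof (induction rule: finite_induct)
  case empty
  have "abs_l2 (\<lambda>x. 0 * complex_of_real 0) \<in> test_l2"
    by (rule test_l2.bump[OF bump_test_zero])
  then show ?case
    using closure_subset by (auto simp: zero_abs_l2)
qed (auto intro: closure_test_l2_add)

lemma closure_test_l2_limit:
  "(\<And>n. X n \<in> closure test_l2) \<Longrightarrow> X \<longlonglongrightarrow> U \<Longrightarrow> U \<in> closure test_l2"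
  using closed_sequentially[of "closure test_l2" X U] by simp

text \<open>Quantified over all \<open>c\<close> because the closure is only shown to be closed
  under sums; the coefficient -c then provides differences of indicators.\<close>

definition approx_set :: "'a::euclidean_space set \<Rightarrow> bool" where
  "approx_set A \<longleftrightarrow> (\<forall>c::complex. abs_l2 (\<lambda>x. c * indicator A x) \<in> closure test_l2)"

lemma abs_l2_sum:
  assumes "finite I" "\<And>i. i \<in> I \<Longrightarrow> u i \<in> L2"
  shows "(\<lambda>x. \<Sum>i\<in>I. u i x) \<in> L2" "abs_l2 (\<lambda>x. \<Sum>i\<in>I. u i x) = (\<Sum>i\<in>I. abs_l2 (u i))"
proof -
  have "(\<lambda>x. \<Sum>i\<in>I. u i x) \<in> L2 \<and> abs_l2 (\<lambda>x. \<Sum>i\<in>I. u i x) = (\<Sum>i\<in>I. abs_l2 (u i))"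
    using assms
  proof (induction rule: finite_induct)
    case (insert i I)
    then show ?case
      using add_abs_l2[of "u i" "\<lambda>x. \<Sum>i\<in>I. u i x"] L2_add[of "u i" "\<lambda>x. \<Sum>i\<in>I. u i x"] by simp
  qed (simp add: L2_zero zero_abs_l2)
  then show "(\<lambda>x. \<Sum>i\<in>I. u i x) \<in> L2" "abs_l2 (\<lambda>x. \<Sum>i\<in>I. u i x) = (\<Sum>i\<in>I. abs_l2 (u i))"
    by auto
qed

lemma L2_cmult_indicator:
  "A \<in> sets borel \<Longrightarrow> bounded A \<Longrightarrow> (\<lambda>x. c * indicator A x) \<in> L2"
proof -
  assume *: "A \<in> sets borel" "bounded A"
  then obtain R where "A \<subseteq> cball 0 R"
    using bounded_subset_ballD[of A 0] ball_subset_cball by blast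
  then have "norm (c * indicator A x) \<le> cmod c * cmod (complex_of_real (1 * indicator (cball 0 R) x))" for x
    by (auto simp: indicator_def norm_mult)
  then show ?thesis
    by (intro L2_bound[OF L2_indicator_ball[of 1 R]]) (use * in auto)
qed

text \<open>The products over i of exp(-1 / (k (x_i - a_i))) exp(-1 / (k (b_i - x_i))), extended by
  0, vanish off the box and tend to 1 on it as k grows. The indicator itself dominates them.\<close>

lemma approx_set_box: "approx_set (box a b :: 'a::euclidean_space set)"
  unfolding approx_set_def
proof
  fix c :: complex
  define g where "g k x = (\<Prod>i\<in>Basis. bump 1 (real (Suc k) * (x \<bullet> i) + - (real (Suc k) * (a \<bullet> i))) *
    bump 1 (- real (Suc k) * (x \<bullet> i) + real (Suc k) * (b \<bullet> i)))" for k and x :: 'a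
  have bump1: "0 \<le> bump 1 x" "bump 1 x \<le> 1" for x
    by (auto simp: bump_one)
  have g0: "g k x = 0" if x: "x \<notin> box a b" for k x
  proof -
    obtain i where i: "i \<in> Basis" "x \<bullet> i \<le> a \<bullet> i \<or> b \<bullet> i \<le> x \<bullet> i"
      using x by (auto simp: mem_box not_less)
    have "real (Suc k) * (x \<bullet> i) + - (real (Suc k) * (a \<bullet> i)) \<le> 0 \<or>
          - real (Suc k) * (x \<bullet> i) + real (Suc k) * (b \<bullet> i) \<le> 0"
      using i(2) mult_left_mono[of "x \<bullet> i" "a \<bullet> i" "real (Suc k)"]
        mult_left_mono[of "b \<bullet> i" "x \<bullet> i" "real (Suc k)"] by linarith
    then have "bump 1 (real (Suc k) * (x \<bullet> i) + - (real (Suc k) * (a \<bullet> i))) *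
        bump 1 (- real (Suc k) * (x \<bullet> i) + real (Suc k) * (b \<bullet> i)) = 0"
      by (auto simp: bump_one)
    then show ?thesis
      unfolding g_def using i(1) by (intro prod_zero) auto
  qed
  have gle: "\<bar>g k x\<bar> \<le> indicator (box a b) x" for k x
  proof (cases "x \<in> box a b")
    case True
    have "0 \<le> g k x" "g k x \<le> 1"
      unfolding g_def by (auto intro!: prod_nonneg prod_le_1 mult_le_one mult_nonneg_nonneg simp: bump1)
    then show ?thesis
      using True by simp
  qed (simp add: g0)
  have b: "bump_test (g k)" for k
  proof -
    have "bump_alg (g k)"
      unfolding g_def by (intro bump_alg_prod bump_alg.mult bump_alg.bump) auto
    moreover obtain R where "box a b \<subseteq> cball 0 R"
      using bounded_subset_ballD[OF bounded_box[of a b], of 0] ball_subset_cball by blast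
    then have "\<forall>x. norm x > R \<longrightarrow> g k x = 0"
      by (auto intro!: g0)
    ultimately show ?thesis
      by (auto simp: bump_test_def)
  qed
  have lim1: "(\<lambda>k. bump 1 (real (Suc k) * r)) \<longlonglongrightarrow> 1" if "r > 0" for r
  proof -
    have "(\<lambda>k. exp (- ((1 / r) * inverse (real (Suc k))))) \<longlonglongrightarrow> exp (- ((1 / r) * 0))"
      by (intro tendsto_intros LIMSEQ_inverse_real_of_nat)
    then show ?thesis
      using that by (simp add: bump_one divide_inverse mult.commute)
  qed
  have "(\<lambda>k. g k x) \<longlonglongrightarrow> indicator (box a b) x" for x
  proof (cases "x \<in> box a b")
    case True
    have "(\<lambda>k. \<Prod>i\<in>Basis. bump 1 (real (Suc k) * (x \<bullet> i - a \<bullet> i)) * bump 1 (real (Suc k) * (b \<bullet> i - x \<bullet> i)))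
        \<longlonglongrightarrow> (\<Prod>i\<in>(Basis::'a set). 1 * 1)"
      using True by (intro tendsto_intros lim1) (auto simp: mem_box)
    then show ?thesis
      using True by (simp add: g_def[abs_def] algebra_simps)
  qed (simp add: g0)
  moreover have of_real_ind: "complex_of_real (indicator (box a b) x) = indicator (box a b) x" for x
    by (simp add: indicator_def)
  ultimately have lim: "(\<lambda>k. c * complex_of_real (g k x)) \<longlonglongrightarrow> c * complex_of_real (indicator (box a b) x)" for x
    by (intro tendsto_intros)
  have "(\<lambda>k. abs_l2 (\<lambda>x. c * complex_of_real (g k x))) \<longlonglongrightarrow> abs_l2 (\<lambda>x. c * indicator (box a b) x)"
  proof (rule L2_dominated_convergence_seq(2)[where g="\<lambda>x. c * indicator (box a b) x"])
    show "(\<lambda>x. c * complex_of_real (g k x)) \<in> borel_measurable borel" for k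
      using bump_test_measurable[OF b] by auto
    show "(\<lambda>x. c * indicator (box a b) x) \<in> L2"
      by (intro L2_cmult_indicator) (auto simp: bounded_box)
    show "AE x in lborel. cmod (c * complex_of_real (g k x)) \<le> cmod (c * indicator (box a b) x)" for k
    proof (rule AE_I2)
      fix x
      show "cmod (c * complex_of_real (g k x)) \<le> cmod (c * indicator (box a b) x)"
        using gle[of k x] mult_left_mono[OF gle[of k x], of "cmod c"]
        by (cases "x \<in> box a b") (auto simp: norm_mult g0)
    qed
    show "AE x in lborel. (\<lambda>k. c * complex_of_real (g k x)) \<longlonglongrightarrow> c * indicator (box a b) x"
    proof (rule AE_I2)
      fix x
      show "(\<lambda>k. c * complex_of_real (g k x)) \<longlonglongrightarrow> c * indicator (box a b) x"
        using lim[of x] by (simp only: of_real_ind)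
    qed
  qed simp_all
  then show "abs_l2 (\<lambda>x. c * indicator (box a b) x) \<in> closure test_l2"
    by (rule closure_test_l2_limit[rotated]) (rule subsetD[OF closure_subset test_l2.bump[OF b]])
qed

text \<open>Dynkin's argument: boxes are stable under intersection and generate the Borel sets.
  Intersecting with one fixed box keeps complements and countable unions bounded, so that their
  indicators are in \<open>L2\<close>.\<close>

lemma approx_set_Int_box:
  fixes A :: "'a::euclidean_space set"
  assumes "A \<in> sets borel"
  shows "approx_set (A \<inter> box a b)"
proof -
  have A: "A \<in> sigma_sets UNIV (range (\<lambda>(a, b). box a b))"
    using assms by (subst (asm) borel_eq_box) simp
  have I: "Int_stable (range (\<lambda>(a, b). box a b :: 'a set))"
    by (auto simp: Int_stable_def box_Int_box)
  have meas: "B \<in> sets borel" if "B \<in> sigma_sets UNIV (range (\<lambda>(a, b). box a b :: 'a set))" for B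
    using that by (subst borel_eq_box) simp
  have S: "range (\<lambda>(a, b). box a b :: 'a set) \<subseteq> Pow UNIV"
    by simp
  from I S A show ?thesis
  proof (induction rule: sigma_sets_induct_disjoint)
    case (basic B)
    then show ?case
      by (auto simp: box_Int_box intro: approx_set_box)
  next
    case empty
    show ?case
      using approx_set_box[of 0 0] by simp
  next
    case (compl B)
    note mB = meas[OF compl(1)]
    show ?case
      unfolding approx_set_def
    proof
      fix c :: complex
      have "abs_l2 (\<lambda>x. c * indicator (box a b) x) + abs_l2 (\<lambda>x. (- c) * indicator (B \<inter> box a b) x) \<in> closure test_l2"
        using approx_set_box[of a b] compl(2) unfolding approx_set_def by (intro closure_test_l2_add) blast+
      also have "abs_l2 (\<lambda>x. c * indicator (box a b) x) + abs_l2 (\<lambda>x. (- c) * indicator (B \<inter> box a b) x) =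
          abs_l2 (\<lambda>x. c * indicator (box a b) x + (- c) * indicator (B \<inter> box a b) x)"
        using mB by (intro add_abs_l2 L2_cmult_indicator) (auto intro: bounded_subset[OF bounded_box])
      also have "(\<lambda>x. c * indicator (box a b) x + (- c) * indicator (B \<inter> box a b) x) =
          (\<lambda>x. c * indicator ((UNIV - B) \<inter> box a b) x)"
        by (auto simp: indicator_def fun_eq_iff)
      finally show "abs_l2 (\<lambda>x. c * indicator ((UNIV - B) \<inter> box a b) x) \<in> closure test_l2" .
    qed
  next
    case (union B)
    note mB = meas[OF subsetD[OF union(2)], OF rangeI]
    show ?case
      unfolding approx_set_def
    proof
      fix c :: complex
      have bdd: "bounded (C \<inter> box a b)" for C :: "'a set"
        by (rule bounded_subset[OF bounded_box]) auto
      have eq: "(\<Sum>i<n. c * indicator (B i \<inter> box a b) x) = c * indicator ((\<Union>i<n. B i) \<inter> box a b) x" for n x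
      proof -
        have "indicator (\<Union>i<n. B i) x = (\<Sum>i<n. indicator (B i) x :: complex)"
          using union(1) by (intro indicator_UN_disjoint) (auto simp: disjoint_family_on_def)
        then show ?thesis
          unfolding indicator_inter_arith by (simp only: sum_distrib_left sum_distrib_right mult.assoc)
      qed
      have "(\<lambda>n. abs_l2 (\<lambda>x. \<Sum>i<n. c * indicator (B i \<inter> box a b) x)) \<longlonglongrightarrow>
          abs_l2 (\<lambda>x. c * indicator ((\<Union>i. B i) \<inter> box a b) x)"
        unfolding eq
      proof (rule L2_dominated_convergence_seq(2)[where g="\<lambda>x. c * indicator (box a b) x"])
        show "(\<lambda>x. c * indicator (box a b) x) \<in> L2"
          by (intro L2_cmult_indicator) (auto simp: bounded_box)
        show "AE x in lborel. (\<lambda>n. c * indicator ((\<Union>i<n. B i) \<inter> box a b) x) \<longlonglongrightarrow>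
            c * indicator ((\<Union>i. B i) \<inter> box a b) x"
        proof (rule AE_I2)
          fix x
          have "eventually (\<lambda>n. c * indicator ((\<Union>i<n. B i) \<inter> box a b) x = 
              c * indicator ((\<Union>i. B i) \<inter> box a b) x) sequentially"
          proof (cases "x \<in> (\<Union>i. B i)")
            case True
            then obtain i where i: "x \<in> B i"
              by auto
            show ?thesis
              using eventually_gt_at_top[of i]
              by eventually_elim (use i in \<open>auto simp: indicator_def\<close>)
          next
            case False
            then show ?thesis
              by (auto simp: indicator_def)
          qed
          then show "(\<lambda>n. c * indicator ((\<Union>i<n. B i) \<inter> box a b) x) \<longlonglongrightarrow>
              c * indicator ((\<Union>i. B i) \<inter> box a b) x"
            by (rule tendsto_eventually)
        qed
      qed (use mB in \<open>auto simp: indicator_def norm_mult\<close>)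
      moreover have "abs_l2 (\<lambda>x. \<Sum>i<n. c * indicator (B i \<inter> box a b) x) =
          (\<Sum>i<n. abs_l2 (\<lambda>x. c * indicator (B i \<inter> box a b) x))" for n
        using mB bdd by (intro abs_l2_sum(2) L2_cmult_indicator) auto
      moreover have in_closure: "(\<Sum>i<n. abs_l2 (\<lambda>x. c * indicator (B i \<inter> box a b) x)) \<in> closure test_l2" for n
        using union(3) unfolding approx_set_def by (intro closure_test_l2_sum) blast+
      ultimately show "abs_l2 (\<lambda>x. c * indicator ((\<Union>i. B i) \<inter> box a b) x) \<in> closure test_l2"
        using closure_test_l2_limit[of "\<lambda>n. abs_l2 (\<lambda>x. \<Sum>i<n. c * indicator (B i \<inter> box a b) x)"] in_closure
        by simp
    qed
qed
qed

text \<open>Simple functions approximate \<open>u\<close> below twice its modulus. Cutting the i-th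
  one to the box \<open>B i\<close> makes it a finite combination of indicators of bounded sets, and
  keeps the limit because each point lies in all but finitely many of the boxes.\<close>

lemma test_l2_dense: "U \<in> closure test_l2"
proof (cases U)
  case (1 u)
  obtain F where F: "\<And>i. simple_function borel (F i)" "\<And>x. (\<lambda>i. F i x) \<longlonglongrightarrow> u x"
    "\<And>i x. cmod (F i x) \<le> 2 * cmod (u x)"
    using borel_measurable_implies_sequence_metric[OF L2_measurable[OF 1(1)], of 0] by auto
  define B where "B n = box (- (real n *\<^sub>R One)) (real n *\<^sub>R One :: 'a)" for n
  have Fm: "F i \<in> borel_measurable borel" for i
    using F(1) by (rule borel_measurable_simple_function)
  define s where "s i x = F i x * indicator (B i) x" for i and x :: 'a
  have s_eq: "s i x = (\<Sum>y\<in>range (F i). y * indicator (F i -` {y} \<inter> B i) x)" for i and x :: 'a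
  proof -
    have fin: "finite (range (F i))"
      using F(1)[of i] by (simp add: simple_function_def)
    have "(\<Sum>y\<in>range (F i). y * indicator (F i -` {y} \<inter> B i) x) =
        (\<Sum>y\<in>range (F i). if y = F i x then y * indicator (B i) x else 0)"
      by (intro sum.cong) (auto simp: indicator_def)
    also have "\<dots> = s i x"
      using fin by (simp add: s_def)
    finally show ?thesis ..
  qed
  have "(\<lambda>i. abs_l2 (s i)) \<longlonglongrightarrow> abs_l2 u"
  proof (rule L2_dominated_convergence_seq(2)[where g="\<lambda>x. 2 * u x"])
    show "(\<lambda>x. 2 * u x) \<in> L2"
      using 1(1) by (rule L2_cmult)
    show "AE x in lborel. cmod (s i x) \<le> cmod (2 * u x)" for i
      using F(3)[of i] by (intro AE_I2) (auto simp: s_def indicator_def norm_mult)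
    show "AE x in lborel. (\<lambda>i. s i x) \<longlonglongrightarrow> u x"
    proof (rule AE_I2)
      fix x :: 'a
      obtain N where "norm x < real N"
        using reals_Archimedean2 by blast
      then have N: "\<And>i. i \<in> Basis \<Longrightarrow> \<bar>x \<bullet> i\<bar> < real N"
        using Basis_le_norm order.strict_trans1 by blast
      have "eventually (\<lambda>i. F i x = s i x) sequentially"
        using eventually_ge_at_top[of N]
      proof eventually_elim
        case (elim n)
        have "x \<in> B n"
          unfolding B_def mem_box
        proof
          fix i :: 'a assume i: "i \<in> Basis"
          then have "\<bar>x \<bullet> i\<bar> < real n"
            using N[OF i] elim by linarith
          then show "- (real n *\<^sub>R One) \<bullet> i < x \<bullet> i \<and> x \<bullet> i < (real n *\<^sub>R One) \<bullet> i"
            using i by (simp add: abs_less_iff)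
        qed
        then show ?case
          by (simp add: s_def)
      qed
      with F(2)[of x] show "(\<lambda>i. s i x) \<longlonglongrightarrow> u x"
        by (rule Lim_transform_eventually)
    qed
    have [measurable]: "B i \<in> sets borel" for i
      by (simp add: B_def)
    show "s i \<in> borel_measurable borel" for i
      unfolding s_def[abs_def] using Fm by measurable
  qed (use 1 in \<open>auto dest: L2_measurable\<close>)
  moreover have "abs_l2 (s i) \<in> closure test_l2" for i
  proof -
    have L2: "(\<lambda>x. y * indicator (F i -` {y} \<inter> B i) x) \<in> L2" for y
      using measurable_sets[OF Fm, of "{y}" i]
      by (intro L2_cmult_indicator) (auto simp: B_def intro: bounded_subset[OF bounded_box])
    have fin: "finite (range (F i))"
      using F(1)[of i] by (simp add: simple_function_def)
    have "abs_l2 (s i) = (\<Sum>y\<in>range (F i). abs_l2 (\<lambda>x. y * indicator (F i -` {y} \<inter> B i) x))"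
      unfolding s_eq[abs_def] by (intro abs_l2_sum(2) fin L2)
    also have "\<dots> \<in> closure test_l2"
    proof (rule closure_test_l2_sum[OF fin])
      fix y
      have "approx_set (F i -` {y} \<inter> B i)"
        using measurable_sets[OF Fm, of "{y}" i] unfolding B_def by (intro approx_set_Int_box) simp
      then show "abs_l2 (\<lambda>x. y * indicator (F i -` {y} \<inter> B i) x) \<in> closure test_l2"
        by (simp add: approx_set_def)
    qed
    finally show ?thesis .
  qed
  ultimately show ?thesis
    using closure_test_l2_limit[of "\<lambda>i. abs_l2 (s i)" U] 1 by simp
qed

section \<open>Strong partial derivatives\<close>

text \<open>The generator of the translations along \<open>b\<close>, as a limit in norm. Since only
  isometries and limits occur, product rules and integration by parts become limits of algebraic
  identities.\<close>

definition has_partial :: "'a::euclidean_space \<Rightarrow> 'a l2 \<Rightarrow> 'a l2 \<Rightarrow> bool" where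
  "has_partial b U P \<longleftrightarrow> ((\<lambda>h. (shift (h *\<^sub>R b) U - U) /\<^sub>R h) \<longlongrightarrow> P) (at 0)"

lemma has_partial_unique: "has_partial b U P \<Longrightarrow> has_partial b U Q \<Longrightarrow> P = Q"
  unfolding has_partial_def by (rule tendsto_unique[OF trivial_limit_at])

lemma has_partial_add:
  assumes "has_partial b U P" "has_partial b V Q"
  shows "has_partial b (U + V) (P + Q)"
proof -
  have "((\<lambda>h. (shift (h *\<^sub>R b) U - U) /\<^sub>R h + (shift (h *\<^sub>R b) V - V) /\<^sub>R h) \<longlongrightarrow> P + Q) (at 0)"
    using assms unfolding has_partial_def by (rule tendsto_add)
  then show ?thesis
    unfolding has_partial_def by (simp add: shift_add algebra_simps)
qed

lemma has_partial_scaleR: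
  assumes "has_partial b U P"
  shows "has_partial b (c *\<^sub>R U) (c *\<^sub>R P)"
proof -
  have "((\<lambda>h. c *\<^sub>R ((shift (h *\<^sub>R b) U - U) /\<^sub>R h)) \<longlongrightarrow> c *\<^sub>R P) (at 0)"
    using assms unfolding has_partial_def by (intro tendsto_intros)
  then show ?thesis
    unfolding has_partial_def by (simp add: shift_scaleR algebra_simps)
qed

lemma has_partial_uminus:
  assumes "has_partial b U P"
  shows "((\<lambda>h. (shift (- (h *\<^sub>R b)) U - U) /\<^sub>R h) \<longlongrightarrow> - P) (at 0)"
proof -
  have "((\<lambda>h. - ((shift (- h *\<^sub>R b) U - U) /\<^sub>R (- h))) \<longlongrightarrow> - P) (at 0)"
  proof (rule tendsto_minus)
    have "filterlim (\<lambda>h::real. - h) (at 0) (at 0)"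
      by (auto simp: filterlim_at eventually_at_filter intro!: tendsto_eq_intros)
    from filterlim_compose[OF assms[unfolded has_partial_def] this]
    show "((\<lambda>h. (shift (- h *\<^sub>R b) U - U) /\<^sub>R (- h)) \<longlongrightarrow> P) (at 0)" .
  qed
  then show ?thesis
    by simp
qed

text \<open>Integration by parts: the adjoint of \<open>shift h\<close> is
  \<open>shift (- h)\<close>, so a difference quotient passes to the other factor with the opposite
  increment.\<close>

lemma has_partial_inner:
  assumes "has_partial b U P" "has_partial b V Q"
  shows "P \<bullet> V = - (U \<bullet> Q)"
proof -
  have 1: "((\<lambda>h. ((shift (h *\<^sub>R b) U - U) /\<^sub>R h) \<bullet> V) \<longlongrightarrow> P \<bullet> V) (at 0)"
    using assms(1) unfolding has_partial_def by (intro tendsto_intros)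
  have 2: "((\<lambda>h. U \<bullet> ((shift (- (h *\<^sub>R b)) V - V) /\<^sub>R h)) \<longlongrightarrow> U \<bullet> (- Q)) (at 0)"
    by (intro tendsto_intros has_partial_uminus assms)
  have 3: "((shift (h *\<^sub>R b) U - U) /\<^sub>R h) \<bullet> V = U \<bullet> ((shift (- (h *\<^sub>R b)) V - V) /\<^sub>R h)" for h
    by (simp add: inner_diff_left inner_diff_right inner_shift_left)
  have "P \<bullet> V = U \<bullet> (- Q)"
    by (rule tendsto_unique[OF _ 1[unfolded 3] 2]) simp
  then show ?thesis
    by simp
qed

lemma has_partial_shift:
  assumes "has_partial b U P"
  shows "has_partial b (shift k U) (shift k P)"
proof -
  have "((\<lambda>h. shift k ((shift (h *\<^sub>R b) U - U) /\<^sub>R h)) \<longlongrightarrow> shift k P) (at 0)"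
    using assms unfolding has_partial_def by (rule bounded_linear.tendsto[OF bounded_linear_shift])
  then show ?thesis
    unfolding has_partial_def by (simp add: shift_diff shift_scaleR shift_shift add.commute)
qed

lemma has_partial_imul:
  assumes "has_partial b U P"
  shows "has_partial b (imul U) (imul P)"
proof -
  have "((\<lambda>h. imul ((shift (h *\<^sub>R b) U - U) /\<^sub>R h)) \<longlongrightarrow> imul P) (at 0)"
    using assms unfolding has_partial_def by (rule bounded_linear.tendsto[OF bounded_linear_imul])
  then show ?thesis
    unfolding has_partial_def by (simp add: imul_diff imul_scaleR shift_imul)
qed

lemma difference_quotient_bound:
  fixes u :: "'a::euclidean_space \<Rightarrow> real"
  assumes "\<And>x. ((\<lambda>h. u (x + h *\<^sub>R b)) has_real_derivative u' x) (at 0)" "\<And>x. \<bar>u' x\<bar> \<le> B"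
  shows "\<bar>u (x + h *\<^sub>R b) - u x\<bar> \<le> B * \<bar>h\<bar>"
proof -
  have "((\<lambda>t. u (x + t *\<^sub>R b)) has_real_derivative u' (x + t *\<^sub>R b)) (at t)" for t
    using assms(1)[of "x + t *\<^sub>R b"] by (simp add: DERIV_def scaleR_add_left add.assoc)
  then show ?thesis
    using field_differentiable_bound[of UNIV "\<lambda>t. u (x + t *\<^sub>R b)" "\<lambda>t. u' (x + t *\<^sub>R b)" B 0 h] assms(2)
    by simp
qed

lemma bump_alg_directional:
  assumes "bump_alg u"
  shows "((\<lambda>h. u (x + h *\<^sub>R b)) has_real_derivative partial b u x) (at 0)"
proof -
  have "((\<lambda>h. x + h *\<^sub>R b) has_derivative (\<lambda>h. h *\<^sub>R b)) (at 0)"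
    by (auto intro!: derivative_eq_intros)
  then have "((\<lambda>h. u (x + h *\<^sub>R b)) has_derivative (\<lambda>h. partial (h *\<^sub>R b) u x)) (at 0)"
    using has_derivative_compose[of "\<lambda>h. x + h *\<^sub>R b" "\<lambda>h. h *\<^sub>R b" 0 UNIV u "\<lambda>b. partial b u x"]
      bump_alg_partial(1)[OF assms] by simp
  moreover have "partial (h *\<^sub>R b) u x = h * partial b u x" for h
    using linear_scale[OF has_derivative_linear[OF bump_alg_partial(1)[OF assms]]] by simp
  ultimately show ?thesis
    by (simp add: has_field_derivative_def mult_commute_abs)
qed

lemma has_partial_bump_test:
  fixes u :: "'a::euclidean_space \<Rightarrow> real"
  assumes u: "bump_test u"
  shows "has_partial b (abs_l2 (\<lambda>x. c * complex_of_real (u x)))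
    (abs_l2 (\<lambda>x. c * complex_of_real (partial b u x)))"
proof -
  have ba: "bump_alg u"
    using u by (simp add: bump_test_def)
  obtain R B where RB: "R > 0" "B \<ge> 0" "\<And>x. \<bar>u x\<bar> \<le> B * indicator (cball 0 R) x"
    using bump_test_bounded[OF u] by metis
  obtain R' B' where RB': "R' > 0" "B' \<ge> 0" "\<And>x. \<bar>partial b u x\<bar> \<le> B' * indicator (cball 0 R') x"
    using bump_test_bounded[OF bump_test_partial[OF u]] by metis
  have lip: "\<bar>u (x + h *\<^sub>R b) - u x\<bar> \<le> B' * \<bar>h\<bar>" for x h
  proof (rule difference_quotient_bound[OF bump_alg_directional[OF ba]])
    show "\<bar>partial b u x\<bar> \<le> B'" for x
      using RB'(3)[of x] RB'(2) by (cases "x \<in> cball 0 R'") auto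
  qed
  \<comment> \<open>For increments of modulus below 1 the translated support of \<open>u\<close>
    stays in the ball of radius \<open>S\<close>; there \<open>B'\<close> bounds the
    quotient.\<close>
  define S where "S = R + norm b"
  define g where "g x = c * complex_of_real (B' * indicator (cball 0 S) x)" for x :: 'a
  define s where "s h x = c * complex_of_real ((u (x + h *\<^sub>R b) - u x) / h)" for h x
  have m[measurable]: "u \<in> borel_measurable borel"
    using u by (rule bump_test_measurable)
  have m'[measurable]: "partial b u \<in> borel_measurable borel"
    using bump_test_partial[OF u] by (rule bump_test_measurable)
  have "((\<lambda>h. abs_l2 (s h)) \<longlongrightarrow> abs_l2 (\<lambda>x. c * complex_of_real (partial b u x))) (at 0)"
  proof (rule L2_dominated_convergence_at[where g = g])
    show "s h \<in> borel_measurable borel" for h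
      unfolding s_def[abs_def] by measurable
    show "(\<lambda>x. c * complex_of_real (partial b u x)) \<in> borel_measurable borel"
      by measurable
    show "g \<in> L2"
      unfolding g_def[abs_def] by (intro L2_cmult L2_indicator_ball)
    show "AE x in lborel. cmod (s h x) \<le> cmod (g x)" if h: "h \<noteq> 0" "\<bar>h - 0\<bar> < 1" for h
    proof (rule AE_I2)
      fix x
      have "\<bar>(u (x + h *\<^sub>R b) - u x) / h\<bar> \<le> B' * indicator (cball 0 S) x"
      proof (cases "x \<in> cball 0 S")
        case True
        then show ?thesis
          using lip[of x h] h by (simp add: field_simps)
      next
        case False
        have "norm (h *\<^sub>R b) \<le> norm b"
          using h by (simp add: mult_left_le_one_le)
        then have "R < norm (x + h *\<^sub>R b)"
          using False norm_triangle_ineq4[of "x + h *\<^sub>R b" "h *\<^sub>R b"] by (simp add: S_def)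
        moreover have "R < norm x"
          using False norm_ge_zero[of b] unfolding S_def mem_cball_0 by linarith
        ultimately have "u (x + h *\<^sub>R b) = 0" "u x = 0"
          using RB(3)[of x] RB(3)[of "x + h *\<^sub>R b"] by (simp_all add: indicator_def)
        then show ?thesis
          using False by simp
      qed
      then have "\<bar>(u (x + h *\<^sub>R b) - u x) / h\<bar> \<le> \<bar>B' * indicator (cball 0 S) x\<bar>"
        by linarith
      then show "cmod (s h x) \<le> cmod (g x)"
        unfolding s_def g_def norm_mult norm_of_real by (intro mult_left_mono) auto
    qed
    show "AE x in lborel. ((\<lambda>h. s h x) \<longlongrightarrow> c * complex_of_real (partial b u x)) (at 0)"
    proof (rule AE_I2)
      fix x
      have "((\<lambda>h. (u (x + h *\<^sub>R b) - u x) / h) \<longlongrightarrow> partial b u x) (at 0)"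
        using bump_alg_directional[OF ba, of x b] by (simp add: DERIV_def)
      then show "((\<lambda>h. s h x) \<longlongrightarrow> c * complex_of_real (partial b u x)) (at 0)"
        unfolding s_def by (intro tendsto_intros)
    qed
  qed
  moreover have "abs_l2 (s h) =
      (shift (h *\<^sub>R b) (abs_l2 (\<lambda>x. c * complex_of_real (u x))) - abs_l2 (\<lambda>x. c * complex_of_real (u x))) /\<^sub>R h" for h
  proof -
    have L: "(\<lambda>x. c * complex_of_real (u x)) \<in> L2" "(\<lambda>x. c * complex_of_real (u (x + h *\<^sub>R b))) \<in> L2"
      using bump_test_L2[OF u] bump_test_L2[OF bump_test_shift[OF u]] by blast+
    have "s h = (\<lambda>x. inverse h *\<^sub>R (c * complex_of_real (u (x + h *\<^sub>R b)) - c * complex_of_real (u x)))"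
      by (auto simp: s_def fun_eq_iff scaleR_conv_of_real divide_inverse algebra_simps)
    then show ?thesis
      using L by (simp add: shift_abs_l2 diff_abs_l2 L2_diff scaleR_abs_l2)
  qed
  ultimately show ?thesis
    by (simp add: has_partial_def)
qed

lemma test_l2_has_partial: "V \<in> test_l2 \<Longrightarrow> \<exists>Q. has_partial b V Q"
  by (induction rule: test_l2.induct) (blast intro: has_partial_add has_partial_bump_test)+

text \<open>For a norm-bounded family, weak convergence can be tested on a dense set. Used for
  spatial difference quotients and for the continuity in time of \<open>gen\<close>.\<close>

lemma tendsto_inner_dense:
  fixes q :: "'b \<Rightarrow> 'a::euclidean_space l2"
  assumes bd: "eventually (\<lambda>h. norm (q h) \<le> B) F"
    and lim: "\<And>V. V \<in> test_l2 \<Longrightarrow> ((\<lambda>h. V \<bullet> q h) \<longlongrightarrow> V \<bullet> P) F"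
  shows "((\<lambda>h. U \<bullet> q h) \<longlongrightarrow> U \<bullet> P) F"
proof (rule tendstoI)
  fix e :: real assume e: "e > 0"
  \<comment> \<open>Dominates \<open>norm (q h - P)\<close>; the summand 1 makes it positive, so
    that e / (2 C) is a legitimate distance.\<close>
  define C where "C = max B 0 + norm P + 1"
  have C: "C > 0"
    by (simp add: C_def add_nonneg_pos)
  obtain V where V: "V \<in> test_l2" "dist V U < e / (2 * C)"
    using test_l2_dense[of U] e C unfolding closure_approachable by (meson divide_pos_pos mult_pos_pos zero_less_numeral)
  have "eventually (\<lambda>h. \<bar>V \<bullet> q h - V \<bullet> P\<bar> < e / 2) F"
    using tendstoD[OF lim[OF V(1)], of "e / 2"] e by (simp add: dist_real_def)
  with bd show "eventually (\<lambda>h. dist (U \<bullet> q h) (U \<bullet> P) < e) F"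
  proof eventually_elim
    case (elim h)
    have "\<bar>(U - V) \<bullet> (q h - P)\<bar> \<le> norm (U - V) * norm (q h - P)"
      by (rule Cauchy_Schwarz_ineq2)
    also have "\<dots> \<le> norm (U - V) * C"
      using norm_triangle_ineq4[of "q h" P] elim(1)
      by (intro mult_left_mono) (auto simp: C_def)
    also have "\<dots> \<le> e / (2 * C) * C"
      using V(2) C by (intro mult_right_mono) (auto simp: dist_norm norm_minus_commute)
    also have "\<dots> = e / 2"
      using C by simp
    finally have "\<bar>(U - V) \<bullet> (q h - P)\<bar> \<le> e / 2" .
    moreover have "U \<bullet> q h - U \<bullet> P = (U - V) \<bullet> (q h - P) + (V \<bullet> q h - V \<bullet> P)"
      by (simp add: inner_diff_left inner_diff_right)
    ultimately show ?case
      using elim(2) unfolding dist_real_def by linarith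
  qed
qed

text \<open>The hypothesis is a closed condition on \<open>V\<close>, so density extends it to
  \<open>V = W\<close>.\<close>

lemma norm_le_dense:
  assumes "\<And>V. V \<in> test_l2 \<Longrightarrow> V \<bullet> W \<le> C * norm V" "C \<ge> 0"
  shows "norm W \<le> C"
proof (cases "W = 0")
  case False
  have "closed {V. V \<bullet> W \<le> C * norm V}"
    by (intro closed_Collect_le continuous_intros)
  then have *: "V \<bullet> W \<le> C * norm V" for V
    using closure_minimal[of test_l2 "{V. V \<bullet> W \<le> C * norm V}"] assms test_l2_dense by blast
  show ?thesis
    using *[of W] False by (simp add: dot_square_norm power2_eq_square)
qed (use assms in simp)

lemma weak_partial_inner_bump:
  assumes u: "u \<in> L2" and p: "p \<in> L2" and w: "weak_partial b u p" and phi: "bump_test \<phi>"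
  shows "abs_l2 (\<lambda>x. c * complex_of_real (partial b \<phi> x)) \<bullet> abs_l2 u =
    - (abs_l2 (\<lambda>x. c * complex_of_real (\<phi> x)) \<bullet> abs_l2 p)"
proof -
  have int: "integrable lborel (\<lambda>x. \<psi> x *\<^sub>R v x)" if "bump_test \<psi>" "v \<in> L2" for \<psi> v
  proof -
    have L: "(\<lambda>x. 1 * complex_of_real (\<psi> x)) \<in> L2" "(\<lambda>x. \<i> * complex_of_real (\<psi> x)) \<in> L2"
      using bump_test_L2[OF that(1)] by blast+
    \<comment> \<open>The real inner products of v with psi and i psi are the real and the imaginary
      part of psi v, so integrability reduces to two real integrands.\<close>
    have eq: "\<psi> x *\<^sub>R v x = complex_of_real ((1 * complex_of_real (\<psi> x)) \<bullet> v x) +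
        \<i> * complex_of_real ((\<i> * complex_of_real (\<psi> x)) \<bullet> v x)" for x
      by (simp add: complex_eq_iff inner_complex_def)
    show ?thesis
      unfolding eq
      by (intro Bochner_Integration.integrable_add integrable_mult_right integrable_of_real
          L2_integrable_inner L that)
  qed
  have lin: "(LINT x|lborel. (c * complex_of_real (\<psi> x)) \<bullet> v x) = c \<bullet> (LINT x|lborel. \<psi> x *\<^sub>R v x)"
    if "bump_test \<psi>" "v \<in> L2" for \<psi> v
  proof -
    have "(LINT x|lborel. c \<bullet> (\<psi> x *\<^sub>R v x)) = c \<bullet> (LINT x|lborel. \<psi> x *\<^sub>R v x)"
      by (rule integral_inner_right) (use int[OF that] in auto)
    then show ?thesis
      by (simp add: inner_complex_def algebra_simps)
  qed
  have "(LINT x|lborel. partial b \<phi> x *\<^sub>R u x) = - (LINT x|lborel. \<phi> x *\<^sub>R p x)"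
    using w bump_test_test_function[OF phi] by (simp add: weak_partial_def)
  then show ?thesis
    using lin[OF bump_test_partial[OF phi] u] lin[OF phi p] u p
      bump_test_L2[OF phi] bump_test_L2[OF bump_test_partial[OF phi]]
    by (simp add: inner_abs_l2)
qed

lemma weak_partial_inner_test:
  assumes "u \<in> L2" "p \<in> L2" "weak_partial b u p" "V \<in> test_l2" "has_partial b V Q"
  shows "Q \<bullet> abs_l2 u = - (V \<bullet> abs_l2 p)"
  using assms(4,5)
proof (induction arbitrary: Q rule: test_l2.induct)
  case (bump v c)
  show ?case
    using has_partial_unique[OF bump(2) has_partial_bump_test[OF bump(1)]]
      weak_partial_inner_bump[OF assms(1-3) bump(1)] by simp
next
  case (add U V)
  obtain U' V' where *: "has_partial b U U'" "has_partial b V V'"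
    using test_l2_has_partial add.hyps by blast
  then show ?case
    using has_partial_unique[OF add.prems has_partial_add[OF *]] add.IH by (simp add: inner_add_left)
qed

lemma test_l2_shift: "V \<in> test_l2 \<Longrightarrow> shift k V \<in> test_l2"
proof (induction rule: test_l2.induct)
  case (bump v c)
  show ?case
    unfolding shift_abs_l2[OF bump_test_L2[OF bump]] by (rule test_l2.bump[OF bump_test_shift[OF bump]])
qed (simp add: shift_add test_l2.add)

text \<open>Weak convergence of the difference quotients together with the bound of their norms
  by the norm of the limit gives strong convergence.\<close>

lemma weak_partial_has_partial:
  fixes u :: "'a::euclidean_space \<Rightarrow> complex"
  assumes u: "u \<in> L2" and p: "p \<in> L2" and w: "weak_partial b u p"
  shows "has_partial b (abs_l2 u) (abs_l2 p)"
proof -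
  define U P where "U = abs_l2 u" and "P = abs_l2 p"
  define q where "q h = (shift (h *\<^sub>R b) U - U) /\<^sub>R h" for h
  \<comment> \<open>Tested against \<open>V\<close>, the orbit of \<open>U\<close> under translation
    is differentiable at every \<open>s\<close>: the translation moves to \<open>V\<close>, which
    has a strong partial derivative, and the weak derivative of \<open>u\<close> is then used
    once.\<close>
  have deriv: "((\<lambda>s. V \<bullet> shift (s *\<^sub>R b) U) has_real_derivative V \<bullet> shift (s *\<^sub>R b) P) (at s)"
    if V: "V \<in> test_l2" for V s
  proof -
    obtain Q where Q: "has_partial b (shift (- (s *\<^sub>R b)) V) Q"
      using test_l2_has_partial[OF test_l2_shift[OF V]] by blast
    have "((\<lambda>h. ((shift (- (h *\<^sub>R b)) (shift (- (s *\<^sub>R b)) V) - shift (- (s *\<^sub>R b)) V) /\<^sub>R h) \<bullet> U)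
        \<longlongrightarrow> - Q \<bullet> U) (at 0)"
      by (intro tendsto_intros has_partial_uminus Q)
    moreover have "((shift (- (h *\<^sub>R b)) (shift (- (s *\<^sub>R b)) V) - shift (- (s *\<^sub>R b)) V) /\<^sub>R h) \<bullet> U =
        (V \<bullet> shift ((s + h) *\<^sub>R b) U - V \<bullet> shift (s *\<^sub>R b) U) / h" for h
      by (simp add: shift_shift inner_diff_left inner_shift_left algebra_simps divide_inverse)
    moreover have "- Q \<bullet> U = V \<bullet> shift (s *\<^sub>R b) P"
      using weak_partial_inner_test[OF u p w test_l2_shift[OF V] Q]
      by (simp add: U_def P_def inner_shift_left)
    ultimately show ?thesis
      by (simp add: DERIV_def)
  qed
  \<comment> \<open>The mean value theorem along the orbit; translations are isometries, so its
    derivative against \<open>V\<close> is at most \<open>norm V * norm P\<close>.\<close>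
  have le: "norm (q h) \<le> norm P" if "h \<noteq> 0" for h
  proof (rule norm_le_dense)
    fix V :: "'a l2" assume V: "V \<in> test_l2"
    have "\<bar>V \<bullet> shift (s *\<^sub>R b) P\<bar> \<le> norm V * norm P" for s
      using Cauchy_Schwarz_ineq2[of V "shift (s *\<^sub>R b) P"] by simp
    then have "\<bar>V \<bullet> shift (h *\<^sub>R b) U - V \<bullet> shift (0 *\<^sub>R b) U\<bar> \<le> (norm V * norm P) * \<bar>h\<bar>"
      using field_differentiable_bound[of UNIV "\<lambda>s. V \<bullet> shift (s *\<^sub>R b) U"
          "\<lambda>s. V \<bullet> shift (s *\<^sub>R b) P" "norm V * norm P" 0 h] deriv[OF V]
      by simp
    then have "\<bar>V \<bullet> q h\<bar> \<le> norm V * norm P"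
      using that by (simp add: q_def inner_diff_right abs_mult field_simps)
    then show "V \<bullet> q h \<le> norm P * norm V"
      by (simp add: mult.commute)
  qed simp
  have "((\<lambda>h. P \<bullet> q h) \<longlongrightarrow> P \<bullet> P) (at 0)"
  proof (rule tendsto_inner_dense)
    show "eventually (\<lambda>h. norm (q h) \<le> norm P) (at 0)"
      using le by (auto simp: eventually_at_filter)
    fix V :: "'a l2" assume "V \<in> test_l2"
    from deriv[OF this, of 0] show "((\<lambda>h. V \<bullet> q h) \<longlongrightarrow> V \<bullet> P) (at 0)"
      by (simp add: DERIV_def q_def inner_diff_right divide_inverse mult.commute)
  qed
  \<comment> \<open>Expanding the square of \<open>norm (q h - P)\<close> and inserting
    \<open>norm (q h) \<le> norm P\<close> leaves this upper bound, which tends to 0 by weak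
    convergence.\<close>
  then have lim: "((\<lambda>h. 2 * (P \<bullet> P) - 2 * (P \<bullet> q h)) \<longlongrightarrow> 2 * (P \<bullet> P) - 2 * (P \<bullet> P)) (at 0)"
    by (intro tendsto_diff tendsto_mult tendsto_const)
  have "((\<lambda>h. (norm (q h - P))\<^sup>2) \<longlongrightarrow> 0) (at 0)"
  proof (rule tendsto_sandwich[of "\<lambda>_. 0" _ _ "\<lambda>h. 2 * (P \<bullet> P) - 2 * (P \<bullet> q h)"])
    show "eventually (\<lambda>h. (norm (q h - P))\<^sup>2 \<le> 2 * (P \<bullet> P) - 2 * (P \<bullet> q h)) (at 0)"
    proof -
      have "(norm (q h - P))\<^sup>2 \<le> 2 * (P \<bullet> P) - 2 * (P \<bullet> q h)" if "h \<noteq> 0" for h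
        using power_mono[OF le[OF that], of 2]
        by (simp add: power2_norm_eq_inner inner_diff_left inner_diff_right inner_commute)
      then show ?thesis
        by (auto simp: eventually_at_filter)
    qed
    show "((\<lambda>h. 2 * (P \<bullet> P) - 2 * (P \<bullet> q h)) \<longlongrightarrow> 0) (at 0)"
      using lim by simp
  qed simp_all
  from tendsto_real_sqrt[OF this] have "((\<lambda>h. norm (q h - P)) \<longlongrightarrow> 0) (at 0)"
    by simp
  then show ?thesis
    unfolding has_partial_def q_def U_def P_def by (simp add: tendsto_norm_zero_iff LIM_zero_iff)
qed

lemma tendsto_shift_partial:
  assumes "has_partial b U P"
  shows "((\<lambda>h. shift (h *\<^sub>R b) U) \<longlongrightarrow> U) (at 0)"
proof -
  have "((\<lambda>h. h *\<^sub>R ((shift (h *\<^sub>R b) U - U) /\<^sub>R h) + U) \<longlongrightarrow> 0 *\<^sub>R P + U) (at 0)"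
    using assms unfolding has_partial_def by (intro tendsto_intros)
  then have "((\<lambda>h. h *\<^sub>R ((shift (h *\<^sub>R b) U - U) /\<^sub>R h) + U) \<longlongrightarrow> U) (at 0)"
    by simp
  then show ?thesis
    by (rule Lim_transform_eventually) (simp add: eventually_at_filter)
qed

text \<open>Immediate for elements with a partial derivative; density and isometry carry it over to
  all.\<close>

lemma tendsto_shift: "((\<lambda>h. shift (h *\<^sub>R b) U) \<longlongrightarrow> U) (at 0)"
proof (rule tendstoI)
  fix e :: real assume "e > 0"
  then obtain V where V: "V \<in> test_l2" "dist V U < e / 3"
    using test_l2_dense[of U] unfolding closure_approachable by (meson divide_pos_pos zero_less_numeral)
  obtain Q where "has_partial b V Q"
    using test_l2_has_partial[OF V(1)] by blast
  from tendstoD[OF tendsto_shift_partial[OF this], of "e / 3"] \<open>e > 0\<close>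
  have "eventually (\<lambda>h. dist (shift (h *\<^sub>R b) V) V < e / 3) (at 0)"
    by simp
  then show "eventually (\<lambda>h. dist (shift (h *\<^sub>R b) U) U < e) (at 0)"
  proof eventually_elim
    case (elim h)
    have "dist (shift (h *\<^sub>R b) U) (shift (h *\<^sub>R b) V) = dist U V"
      by (simp add: dist_norm flip: shift_diff)
    then show ?case
      using elim V(2) dist_triangle_third[of "shift (h *\<^sub>R b) U" "shift (h *\<^sub>R b) V" e V U]
      by (simp add: dist_commute)
  qed
qed

lemma inner_test_l2_eqI:
  assumes "\<And>V. V \<in> test_l2 \<Longrightarrow> V \<bullet> W = V \<bullet> W'"
  shows "W = W'"
proof -
  have "norm (W - W') \<le> 0"
    by (rule norm_le_dense) (use assms in \<open>auto simp: inner_diff_right\<close>)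
  then show ?thesis
    by simp
qed

text \<open>Difference quotients along \<open>k\<close> commute with the derivative along
  \<open>j\<close>. Against a test element \<open>V\<close> with derivative \<open>Vj\<close> along
  \<open>j\<close>, both \<open>V \<bullet> Q\<close> and \<open>V \<bullet> Q'\<close> equal
  \<open>- (Vj \<bullet> P')\<close>.\<close>

lemma has_partial_commute:
  assumes U: "has_partial j U P" "has_partial k U P'" "has_partial k P Q" "has_partial j P' Q'"
  shows "Q = Q'"
proof (rule inner_test_l2_eqI)
  fix V :: "'a l2" assume "V \<in> test_l2"
  then obtain Vj where Vj: "has_partial j V Vj"
    using test_l2_has_partial by blast
  define q where "q s W = (shift (s *\<^sub>R k) W - W) /\<^sub>R s" for s and W :: "'a l2"
  have q: "has_partial j (q s U) (q s P)" for s
  proof -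
    have "has_partial j (shift (s *\<^sub>R k) U + (- 1) *\<^sub>R U) (shift (s *\<^sub>R k) P + (- 1) *\<^sub>R P)"
      by (intro has_partial_add has_partial_shift has_partial_scaleR U)
    from has_partial_scaleR[OF this, of "inverse s"] show ?thesis
      by (simp add: q_def)
  qed
  have 1: "((\<lambda>s. V \<bullet> q s P) \<longlongrightarrow> V \<bullet> Q) (at 0)"
    using U(3) unfolding has_partial_def q_def by (intro tendsto_intros)
  have 2: "((\<lambda>s. - (Vj \<bullet> q s U)) \<longlongrightarrow> - (Vj \<bullet> P')) (at 0)"
    using U(2) unfolding has_partial_def q_def by (intro tendsto_intros)
  have 3: "V \<bullet> q s P = - (Vj \<bullet> q s U)" for s
    using has_partial_inner[OF Vj q[of s]] by simp
  have "V \<bullet> Q = - (Vj \<bullet> P')"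
    by (rule tendsto_unique[OF trivial_limit_at 1[unfolded 3] 2])
  then show "V \<bullet> Q = V \<bullet> Q'"
    using has_partial_inner[OF Vj U(4)] by simp
qed

section \<open>Multiplication operators\<close>

lemma in_dom_shift_mul:
  assumes "in_dom m U"
  shows "in_dom (\<lambda>x. m (x + k)) (shift k U)" "mul (\<lambda>x. m (x + k)) (shift k U) = shift k (mul m U)"
proof -
  obtain u where u: "u \<in> L2" "U = abs_l2 u"
    by (cases U)
  have m: "m \<in> borel_measurable borel" "(\<lambda>x. m x *\<^sub>R u x) \<in> L2"
    using assms u by (auto simp: in_dom_abs_l2)
  then show d: "in_dom (\<lambda>x. m (x + k)) (shift k U)"
    using u L2_translate[OF m(2), of k] by (simp add: shift_abs_l2 in_dom_abs_l2 L2_translate)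
  show "mul (\<lambda>x. m (x + k)) (shift k U) = shift k (mul m U)"
    using u m d assms by (simp add: shift_abs_l2 mul_abs_l2 L2_translate)
qed

lemma in_dom_shift:
  assumes "in_dom (\<lambda>x. m (x - k)) U"
  shows "in_dom m (shift k U)" "mul m (shift k U) = shift k (mul (\<lambda>x. m (x - k)) U)"
  using in_dom_shift_mul[OF assms, of k] by simp_all

lemma mul_add_fun:
  assumes "in_dom m U" "in_dom n U"
  shows "in_dom (\<lambda>x. m x + n x) U" "mul (\<lambda>x. m x + n x) U = mul m U + mul n U"
proof -
  obtain u where u: "u \<in> L2" "U = abs_l2 u"
    by (cases U)
  have m: "m \<in> borel_measurable borel" "(\<lambda>x. m x *\<^sub>R u x) \<in> L2" "n \<in> borel_measurable borel" "(\<lambda>x. n x *\<^sub>R u x) \<in> L2"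
    using assms u by (auto simp: in_dom_abs_l2)
  have *: "(\<lambda>x. (m x + n x) *\<^sub>R u x) \<in> L2"
    using L2_add[OF m(2,4)] by (simp add: scaleR_add_left)
  then show d: "in_dom (\<lambda>x. m x + n x) U"
    using m u by (simp add: in_dom_abs_l2)
  show "mul (\<lambda>x. m x + n x) U = mul m U + mul n U"
    using u d assms by (simp add: mul_abs_l2 add_abs_l2 m scaleR_add_left del: scaleR_conv_of_real)
qed

lemma mul_scale_fun:
  assumes "in_dom m U"
  shows "in_dom (\<lambda>x. c * m x) U" "mul (\<lambda>x. c * m x) U = c *\<^sub>R mul m U"
proof -
  obtain u where u: "u \<in> L2" "U = abs_l2 u"
    by (cases U)
  have m: "m \<in> borel_measurable borel" "(\<lambda>x. m x *\<^sub>R u x) \<in> L2"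
    using assms u by (auto simp: in_dom_abs_l2)
  show d: "in_dom (\<lambda>x. c * m x) U"
    using m u L2_scaleR[OF m(2), of c] by (simp add: in_dom_abs_l2)
  show "mul (\<lambda>x. c * m x) U = c *\<^sub>R mul m U"
    using u d assms by (simp add: mul_abs_l2 scaleR_abs_l2 m)
qed

lemma mul_mul:
  assumes "in_dom n U" "in_dom m (mul n U)"
  shows "in_dom (\<lambda>x. m x * n x) U" "mul (\<lambda>x. m x * n x) U = mul m (mul n U)"
proof -
  obtain u where u: "u \<in> L2" "U = abs_l2 u"
    by (cases U)
  have n: "n \<in> borel_measurable borel" "(\<lambda>x. n x *\<^sub>R u x) \<in> L2"
    using assms u by (auto simp: in_dom_abs_l2)
  have m: "m \<in> borel_measurable borel" "(\<lambda>x. m x *\<^sub>R (n x *\<^sub>R u x)) \<in> L2"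
    using assms u n by (auto simp: in_dom_abs_l2 mul_abs_l2)
  show d: "in_dom (\<lambda>x. m x * n x) U"
    using m n u by (simp add: in_dom_abs_l2)
  show "mul (\<lambda>x. m x * n x) U = mul m (mul n U)"
    using u d assms by (simp add: mul_abs_l2 n m)
qed

lemma in_dom_mul_bounded:
  assumes "in_dom m U" "n \<in> borel_measurable borel" "\<And>x. \<bar>n x\<bar> \<le> B"
  shows "in_dom m (mul n U)" "mul m (mul n U) = mul n (mul m U)"
proof -
  obtain u where u: "u \<in> L2" "U = abs_l2 u"
    by (cases U)
  have d: "in_dom n V" for V
    using assms by (intro in_dom_bounded)
  have m: "m \<in> borel_measurable borel" "(\<lambda>x. m x *\<^sub>R u x) \<in> L2" "(\<lambda>x. n x *\<^sub>R u x) \<in> L2"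
    using assms(1) d[of U] u by (auto simp: in_dom_abs_l2)
  have "(\<lambda>x. n x *\<^sub>R (m x *\<^sub>R u x)) \<in> L2"
    using d[of "mul m U"] u assms(1) m by (simp add: mul_abs_l2 in_dom_abs_l2)
  then have "(\<lambda>x. m x *\<^sub>R (n x *\<^sub>R u x)) \<in> L2"
    by (simp add: mult.commute)
  then show *: "in_dom m (mul n U)"
    using u d m by (simp add: mul_abs_l2 in_dom_abs_l2)
  show "mul m (mul n U) = mul n (mul m U)"
    using mul_mul(2)[OF d *] mul_mul(2)[OF assms(1) d] by (simp add: mult.commute)
qed

lemma in_dom_mono:
  assumes "in_dom n U" "m \<in> borel_measurable borel" "\<And>x. \<bar>m x\<bar> \<le> \<bar>n x\<bar>"
  shows "in_dom m U"
proof -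
  obtain u where u: "u \<in> L2" "U = abs_l2 u"
    by (cases U)
  then have "(\<lambda>x. n x *\<^sub>R u x) \<in> L2"
    using assms by (simp add: in_dom_abs_l2)
  then have "(\<lambda>x. m x *\<^sub>R u x) \<in> L2"
    by (rule L2_bound[where C=1])
      (use assms u in \<open>auto intro!: mult_right_mono dest: L2_measurable\<close>)
  then show ?thesis
    using u assms by (simp add: in_dom_abs_l2)
qed

text \<open>The dominating \<open>n\<close> may be unbounded as long as \<open>U\<close> lies in its
  domain; this lets regularised weights converge to the coordinates.\<close>

lemma tendsto_mul_seq:
  assumes "in_dom n U" "\<And>i. m i \<in> borel_measurable borel" "\<And>i x. \<bar>m i x\<bar> \<le> \<bar>n x\<bar>"
    and "m' \<in> borel_measurable borel" "\<And>x. (\<lambda>i::nat. m i x) \<longlonglongrightarrow> m' x"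
  shows "(\<lambda>i. mul (m i) U) \<longlonglongrightarrow> mul m' U"
proof -
  obtain u where u: "u \<in> L2" "U = abs_l2 u"
    by (cases U)
  have "\<bar>m' x\<bar> \<le> \<bar>n x\<bar>" for x
    by (rule LIMSEQ_le_const2[OF tendsto_rabs[OF assms(5)[of x]]]) (use assms(3) in auto)
  then have d: "in_dom (m i) U" "in_dom m' U" for i
    using in_dom_mono[OF assms(1)] assms by auto
  have "(\<lambda>i. abs_l2 (\<lambda>x. m i x *\<^sub>R u x)) \<longlonglongrightarrow> abs_l2 (\<lambda>x. m' x *\<^sub>R u x)"
  proof (rule L2_dominated_convergence_seq(2))
    show "(\<lambda>x. n x *\<^sub>R u x) \<in> L2"
      using assms(1) u by (simp add: in_dom_abs_l2)
    show "AE x in lborel. cmod (m i x *\<^sub>R u x) \<le> cmod (n x *\<^sub>R u x)" for i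
      using assms(3) by (auto intro!: mult_right_mono)
    show "AE x in lborel. (\<lambda>i. m i x *\<^sub>R u x) \<longlonglongrightarrow> m' x *\<^sub>R u x"
      by (intro AE_I2 tendsto_scaleR assms tendsto_const)
  qed (use assms u in \<open>auto dest: L2_measurable\<close>)
  then show ?thesis
    using u d by (simp add: mul_abs_l2)
qed

lemma tendsto_mul_at:
  assumes "\<And>i. m i \<in> borel_measurable borel" "\<And>i x. \<bar>m i x\<bar> \<le> B"
    and "m' \<in> borel_measurable borel" "\<And>x. ((\<lambda>i::real. m i x) \<longlongrightarrow> m' x) (at a)"
  shows "((\<lambda>i. mul (m i) U) \<longlongrightarrow> mul m' U) (at a)"
  unfolding tendsto_at_iff_sequentially comp_def
proof (intro allI impI)
  fix X :: "nat \<Rightarrow> real" assume X: "\<forall>i. X i \<in> UNIV - {a}" "X \<longlonglongrightarrow> a"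
  show "(\<lambda>i. mul (m (X i)) U) \<longlonglongrightarrow> mul m' U"
  proof (rule tendsto_mul_seq)
    show "in_dom (\<lambda>_. B) U"
      by (rule in_dom_bounded[where B="\<bar>B\<bar>"]) auto
    show "\<bar>m (X i) x\<bar> \<le> \<bar>B\<bar>" for i x
      using assms(2)[of "X i" x] by linarith
    show "(\<lambda>i. m (X i) x) \<longlonglongrightarrow> m' x" for x
      using assms(4)[of x] X unfolding tendsto_at_iff_sequentially comp_def by blast
  qed (use assms in auto)
qed

text \<open>Conditions under which multiplication by \<open>m\<close> preserves the domain of the
  strong derivative along \<open>b\<close>, with commutator \<open>mul m'\<close>. The bound on
  \<open>m'\<close> makes the difference quotients of \<open>m\<close> uniformly bounded.\<close>

definition multiplier :: "'a::euclidean_space \<Rightarrow> ('a \<Rightarrow> real) \<Rightarrow> ('a \<Rightarrow> real) \<Rightarrow> bool" where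
  "multiplier b m m' \<longleftrightarrow> m \<in> borel_measurable borel \<and> m' \<in> borel_measurable borel \<and>
     (\<exists>B. \<forall>x. \<bar>m x\<bar> \<le> B) \<and> (\<exists>B. \<forall>x. \<bar>m' x\<bar> \<le> B) \<and>
     (\<forall>x. ((\<lambda>h. m (x + h *\<^sub>R b)) has_real_derivative m' x) (at 0))"

lemma multiplierE:
  assumes "multiplier b m m'"
  obtains B where "m \<in> borel_measurable borel" "m' \<in> borel_measurable borel"
    "\<And>x. \<bar>m x\<bar> \<le> B" "\<And>x. \<bar>m' x\<bar> \<le> B"
    "\<And>x. ((\<lambda>h. m (x + h *\<^sub>R b)) has_real_derivative m' x) (at 0)"
proof -
  obtain B B' where "\<And>x. \<bar>m x\<bar> \<le> B" "\<And>x. \<bar>m' x\<bar> \<le> B'"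
    using assms by (auto simp: multiplier_def)
  then show ?thesis
    using assms by (intro that[of "max B B'"]) (auto simp: multiplier_def le_max_iff_disj)
qed

lemma multiplier_in_dom:
  assumes "multiplier b m m'"
  shows "in_dom m U" "in_dom m' U"
  using multiplierE[OF assms] in_dom_bounded by metis+

lemma multiplier_bounded_linear:
  assumes "multiplier b m m'"
  shows "bounded_linear (mul m)" "bounded_linear (mul m')"
  using multiplierE[OF assms] bounded_linear_mul by metis+

lemma has_partial_mul:
  assumes m: "multiplier b m m'" and U: "has_partial b U P"
  shows "has_partial b (mul m U) (mul m P + mul m' U)"
proof -
  obtain B where B: "m \<in> borel_measurable borel" "m' \<in> borel_measurable borel"
    "\<And>x. \<bar>m x\<bar> \<le> B" "\<And>x. \<bar>m' x\<bar> \<le> B"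
    and D: "\<And>x. ((\<lambda>h. m (x + h *\<^sub>R b)) has_real_derivative m' x) (at 0)"
    using multiplierE[OF m] by metis
  note [measurable] = B(1,2)
  define q where "q h = (shift (h *\<^sub>R b) U - U) /\<^sub>R h" for h
  define d where "d h x = (m (x + h *\<^sub>R b) - m x) / h" for h x
  have q: "(q \<longlongrightarrow> P) (at 0)"
    using U unfolding has_partial_def q_def .
  have lip: "\<bar>m (x + h *\<^sub>R b) - m x\<bar> \<le> B * \<bar>h\<bar>" for x h
    by (rule difference_quotient_bound[OF D B(4)])
  have B0: "B \<ge> 0"
    using B(3)[of 0] by linarith
  have dB: "\<bar>d h x\<bar> \<le> B" for h x
    using lip[of x h] B0 by (cases "h = 0") (auto simp: d_def field_simps)
  have dm: "d h \<in> borel_measurable borel" for h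
    unfolding d_def[abs_def] by measurable
  have mh: "(\<lambda>x. m (x + k)) \<in> borel_measurable borel" for k
    by measurable
  have dom: "in_dom m V" "in_dom (\<lambda>x. m (x + k)) V" "in_dom (d h) V" for V k h
    using in_dom_bounded B dB dm mh by blast+
  have lin: "bounded_linear (mul (\<lambda>x. m (x + k)))" for k
    by (rule bounded_linear_mul[OF mh B(3)])
  \<comment> \<open>The discrete product rule puts the translated weight on the quotient of
    \<open>U\<close>. Splitting off \<open>P\<close> leaves uniformly bounded operators on a family
    tending to 0, plus two terms that converge by domination.\<close>
  have eq: "(shift (h *\<^sub>R b) (mul m U) - mul m U) /\<^sub>R h =
      mul (\<lambda>x. m (x + h *\<^sub>R b)) (q h - P) + mul (\<lambda>x. m (x + h *\<^sub>R b)) P + mul (d h) U" if "h \<noteq> 0" for h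
  proof -
    have "mul (\<lambda>x. m (x + h *\<^sub>R b)) U = mul (\<lambda>x. m x + h * d h x) U"
      using that by (simp add: d_def)
    also have "\<dots> = mul m U + h *\<^sub>R mul (d h) U"
      by (simp add: mul_add_fun mul_scale_fun dom)
    finally have 1: "mul (d h) U = (mul (\<lambda>x. m (x + h *\<^sub>R b)) U - mul m U) /\<^sub>R h"
      using that by simp
    have 2: "mul (\<lambda>x. m (x + h *\<^sub>R b)) (q h - P) + mul (\<lambda>x. m (x + h *\<^sub>R b)) P =
        mul (\<lambda>x. m (x + h *\<^sub>R b)) (q h)"
      by (simp flip: linear_add[OF bounded_linear.linear[OF lin]])
    have 3: "mul (\<lambda>x. m (x + h *\<^sub>R b)) (q h) =
        (mul (\<lambda>x. m (x + h *\<^sub>R b)) (shift (h *\<^sub>R b) U) - mul (\<lambda>x. m (x + h *\<^sub>R b)) U) /\<^sub>R h"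
      unfolding q_def
      by (simp add: linear_scale[OF bounded_linear.linear[OF lin]] linear_diff[OF bounded_linear.linear[OF lin]])
    show ?thesis
      unfolding 1 2 3 in_dom_shift_mul(2)[OF dom(1)] by (simp flip: scaleR_add_right)
  qed
  have "((\<lambda>h. mul (\<lambda>x. m (x + h *\<^sub>R b)) (q h - P) + mul (\<lambda>x. m (x + h *\<^sub>R b)) P + mul (d h) U)
      \<longlongrightarrow> 0 + mul m P + mul m' U) (at 0)"
  proof (intro tendsto_add)
    have "((\<lambda>h. norm (q h - P)) \<longlongrightarrow> 0) (at 0)"
      using q by (simp add: tendsto_norm_zero_iff LIM_zero_iff)
    then have "((\<lambda>h. B * norm (q h - P)) \<longlongrightarrow> 0) (at 0)"
      by (rule tendsto_mult_right_zero)
    then show "((\<lambda>h. mul (\<lambda>x. m (x + h *\<^sub>R b)) (q h - P)) \<longlongrightarrow> 0) (at 0)"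
      by (rule Lim_null_comparison[rotated]) (use norm_mul_le[OF mh B(3)] in auto)
    show "((\<lambda>h. mul (\<lambda>x. m (x + h *\<^sub>R b)) P) \<longlongrightarrow> mul m P) (at 0)"
    proof (rule tendsto_mul_at[OF mh B(3) B(1)])
      fix x
      show "((\<lambda>h. m (x + h *\<^sub>R b)) \<longlongrightarrow> m x) (at 0)"
        using DERIV_isCont[OF D[of x]] by (simp add: isCont_def)
    qed
    show "((\<lambda>h. mul (d h) U) \<longlongrightarrow> mul m' U) (at 0)"
      by (rule tendsto_mul_at[OF dm dB B(2)]) (use D in \<open>simp add: DERIV_def d_def\<close>)
  qed
  then have "((\<lambda>h. mul (\<lambda>x. m (x + h *\<^sub>R b)) (q h - P) + mul (\<lambda>x. m (x + h *\<^sub>R b)) P + mul (d h) U)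
      \<longlongrightarrow> mul m P + mul m' U) (at 0)"
    by simp
  then show ?thesis
    unfolding has_partial_def
    by (rule Lim_transform_eventually) (simp add: eventually_at_filter eq)
qed

text \<open>Twice the real part of conj(u) m du is m times the derivative of |u|^2, which is
  integrated by parts.\<close>

lemma inner_mul_partial_self:
  assumes m: "multiplier b m m'" and U: "has_partial b U P"
  shows "2 * (U \<bullet> mul m P) = - (U \<bullet> mul m' U)"
  using has_partial_inner[OF U has_partial_mul[OF m U]] inner_mul_commute[of m U P]
  by (simp add: multiplier_in_dom(1)[OF m] inner_add_right inner_commute)

text \<open>Formally the integral of (df) m |u|^2 equals minus the integral of f d(m |u|^2). No
  derivative of \<open>f\<close> is at hand, so the translation inside its quotient is moved onto
  the two states, both of which have strong partial derivatives.\<close>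

lemma inner_mul_difference_quotient:
  fixes f :: "'a::euclidean_space \<Rightarrow> real"
  assumes lip: "\<And>x y. \<bar>f x - f y\<bar> \<le> L * norm (x - y)" and f: "in_dom f U"
    and m: "multiplier b m m'" and U: "has_partial b U P"
  shows "((\<lambda>h. mul (\<lambda>x. (f (x + h *\<^sub>R b) - f x) / h) (mul m U) \<bullet> U) \<longlongrightarrow>
    - (2 * (mul f U \<bullet> mul m P) + mul f U \<bullet> mul m' U)) (at 0)"
proof -
  obtain B where B: "m \<in> borel_measurable borel" "m' \<in> borel_measurable borel"
    "\<And>x. \<bar>m x\<bar> \<le> B" "\<And>x. \<bar>m' x\<bar> \<le> B"
    using multiplierE[OF m] by metis
  have fm[measurable]: "f \<in> borel_measurable borel"
    using f by transfer auto
  have dm: "(\<lambda>x. f (x - k) - f x) \<in> borel_measurable borel" "(\<lambda>x. f (x + k) - f x) \<in> borel_measurable borel" for k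
    by measurable
  have dB: "\<bar>f (x - k) - f x\<bar> \<le> L * norm k" "\<bar>f (x + k) - f x\<bar> \<le> L * norm k" for x k
    using lip[of "x - k" x] lip[of "x + k" x] by auto
  have ddom: "in_dom (\<lambda>x. f (x - k) - f x) V" "in_dom (\<lambda>x. f (x + k) - f x) V" for k V
    using in_dom_bounded[OF dm(1) dB(1)] in_dom_bounded[OF dm(2) dB(2)] by blast+
  have dom: "in_dom f V \<Longrightarrow> in_dom (\<lambda>x. f (x - k)) V" "in_dom f V \<Longrightarrow> in_dom (\<lambda>x. f (x + k)) V" for k V
    using mul_add_fun(1)[of f V "\<lambda>x. f (x - k) - f x"] mul_add_fun(1)[of f V "\<lambda>x. f (x + k) - f x"] ddom
    by auto
  note fshift = in_dom_shift[OF dom(1)]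
  define V where "V = mul m U"
  have fV: "in_dom f V" "mul f V = mul m (mul f U)"
    unfolding V_def using in_dom_mul_bounded[OF f B(1,3)] .
  have V: "has_partial b V (mul m P + mul m' U)"
    unfolding V_def by (rule has_partial_mul[OF m U])
  \<comment> \<open>More than continuity of translations, as \<open>mul f\<close> may be unbounded:
    commuting \<open>f\<close> with the translation leaves f(x + h b) - f(x), which is of order h by
    the Lipschitz condition.\<close>
  have f_cont: "((\<lambda>h. mul f (shift (- (h *\<^sub>R b)) U)) \<longlongrightarrow> mul f U) (at 0)"
  proof -
    have eq: "mul f (shift (- (h *\<^sub>R b)) U) =
        shift (h *\<^sub>R - b) (mul f U) + shift (h *\<^sub>R - b) (mul (\<lambda>x. f (x + h *\<^sub>R b) - f x) U)" for h
      using fshift(2)[OF f, of "- (h *\<^sub>R b)"] mul_add_fun(2)[OF f ddom(2), of "h *\<^sub>R b"]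
      by (simp add: shift_add)
    have "((\<lambda>h. shift (h *\<^sub>R - b) (mul (\<lambda>x. f (x + h *\<^sub>R b) - f x) U)) \<longlongrightarrow> 0) (at 0)"
    proof (rule Lim_null_comparison)
      show "((\<lambda>h. L * norm (h *\<^sub>R b) * norm U) \<longlongrightarrow> 0) (at 0)"
        by (auto intro!: tendsto_eq_intros)
      show "eventually (\<lambda>h. norm (shift (h *\<^sub>R - b) (mul (\<lambda>x. f (x + h *\<^sub>R b) - f x) U)) \<le>
          L * norm (h *\<^sub>R b) * norm U) (at 0)"
        unfolding norm_shift by (intro always_eventually allI norm_mul_le dm dB)
    qed
    from tendsto_add[OF tendsto_shift[of "- b" "mul f U"] this] show ?thesis
      by (simp add: eq)
  qed
  \<comment> \<open>First \<open>V\<close> is differenced against the translated \<open>U\<close>,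
    then \<open>U\<close> against \<open>V\<close>; the mixed terms cancel because multiplication by
    \<open>f\<close> is symmetric.\<close>
  have "((\<lambda>h. ((shift (- (h *\<^sub>R b)) V - V) /\<^sub>R h) \<bullet> mul f (shift (- (h *\<^sub>R b)) U) +
      mul f V \<bullet> ((shift (- (h *\<^sub>R b)) U - U) /\<^sub>R h)) \<longlongrightarrow>
      (- (mul m P + mul m' U)) \<bullet> mul f U + mul f V \<bullet> (- P)) (at 0)"
    by (intro tendsto_add tendsto_inner has_partial_uminus V U f_cont tendsto_const)
  moreover have "(- (mul m P + mul m' U)) \<bullet> mul f U + mul f V \<bullet> (- P) =
      - (2 * (mul f U \<bullet> mul m P) + mul f U \<bullet> mul m' U)"
    using inner_mul_commute[of m "mul f U" P]
    by (simp add: multiplier_in_dom(1)[OF m] fV inner_diff_right inner_add_left inner_commute[of _ "mul f U"])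
  moreover have "((shift (- (h *\<^sub>R b)) V - V) /\<^sub>R h) \<bullet> mul f (shift (- (h *\<^sub>R b)) U) +
      mul f V \<bullet> ((shift (- (h *\<^sub>R b)) U - U) /\<^sub>R h) =
      mul (\<lambda>x. (f (x + h *\<^sub>R b) - f x) / h) (mul m U) \<bullet> U" for h
  proof -
    let ?k = "- (h *\<^sub>R b)"
    have 1: "shift ?k V \<bullet> mul f (shift ?k U) = mul (\<lambda>x. f (x + h *\<^sub>R b)) V \<bullet> U"
      using fshift(2)[OF f, of ?k] inner_mul_commute[OF dom(2)[OF fV(1)] dom(2)[OF f], of "h *\<^sub>R b"] by simp
    have 2: "V \<bullet> mul f (shift ?k U) = mul f V \<bullet> shift ?k U"
      using inner_mul_commute[OF fV(1) fshift(1)[OF f]] by simp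
    have 3: "mul (\<lambda>x. f (x + h *\<^sub>R b)) V - mul f V = mul (\<lambda>x. f (x + h *\<^sub>R b) - f x) V"
      using mul_add_fun(2)[OF fV(1) ddom(2), of "h *\<^sub>R b"] by simp
    have 4: "mul (\<lambda>x. (f (x + h *\<^sub>R b) - f x) / h) V = mul (\<lambda>x. f (x + h *\<^sub>R b) - f x) V /\<^sub>R h"
      using mul_scale_fun(2)[OF ddom(2), of "inverse h" "h *\<^sub>R b" V] by (simp add: divide_inverse mult.commute)
    show ?thesis
      unfolding V_def[symmetric] 4 3[symmetric]
      by (simp add: inner_diff_left inner_diff_right 1 2 flip: distrib_left)
  qed
  ultimately show ?thesis
    by simp
qed

section \<open>Regularised quadratic weights\<close>

text \<open>\<open>wt0 R\<close> regularises \<open>s\<^sup>2 / 2\<close>; \<open>wt1\<close>, \<open>wt2\<close>, \<open>wt3\<close> are its successive derivatives.\<close>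

definition cut :: "real \<Rightarrow> real \<Rightarrow> real" where
  "cut R s = R\<^sup>2 / (R\<^sup>2 + s\<^sup>2)"

definition wt0 :: "real \<Rightarrow> real \<Rightarrow> real" where
  "wt0 R s = s\<^sup>2 * cut R s / 2"

definition wt1 :: "real \<Rightarrow> real \<Rightarrow> real" where
  "wt1 R s = s * (cut R s)\<^sup>2"

definition wt2 :: "real \<Rightarrow> real \<Rightarrow> real" where
  "wt2 R s = (cut R s)\<^sup>2 * (4 * cut R s - 3)"

definition wt3 :: "real \<Rightarrow> real \<Rightarrow> real" where
  "wt3 R s = 12 * (cut R s)\<^sup>2 * (1 - 2 * cut R s) * (s / (R\<^sup>2 + s\<^sup>2))"

text \<open>The factor s / (R^2 + s^2) is the source of all errors of order 1 / R; its bound is the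
  inequality 2 |s| R <= R^2 + s^2. The third identity trades it for \<open>cut\<close> when it is
  multiplied by \<open>s\<close>.\<close>

lemma cut_bounds:
  assumes "R > 0"
  shows "0 < cut R s" "cut R s \<le> 1" "1 - cut R s = s * (s / (R\<^sup>2 + s\<^sup>2))" "\<bar>s / (R\<^sup>2 + s\<^sup>2)\<bar> \<le> 1 / (2 * R)"
proof -
  have p: "R\<^sup>2 + s\<^sup>2 > 0"
    using assms by (simp add: add_pos_nonneg)
  show "0 < cut R s" "cut R s \<le> 1" "1 - cut R s = s * (s / (R\<^sup>2 + s\<^sup>2))"
    using assms p by (simp_all add: cut_def field_simps power2_eq_square)
  have "2 * \<bar>s\<bar> * R \<le> R\<^sup>2 + s\<^sup>2"
    using zero_le_power2[of "\<bar>s\<bar> - R"] by (simp add: power2_eq_square algebra_simps)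
  then show "\<bar>s / (R\<^sup>2 + s\<^sup>2)\<bar> \<le> 1 / (2 * R)"
    using p assms by (simp add: field_simps)
qed

lemma cut_derivative:
  assumes "R > 0"
  shows "(cut R has_real_derivative - 2 * cut R s * (s / (R\<^sup>2 + s\<^sup>2))) (at s)"
proof -
  have p: "R\<^sup>2 + s\<^sup>2 \<noteq> 0"
    using assms by (metis add_pos_nonneg less_irrefl zero_le_power2 zero_less_power)
  show ?thesis
    unfolding cut_def[abs_def] using p
    by (auto intro!: derivative_eq_intros simp: divide_simps power2_eq_square)
qed

lemma wt0_derivative:
  assumes "R > 0"
  shows "(wt0 R has_real_derivative wt1 R s) (at s)"
proof -
  define k where "k = s / (R\<^sup>2 + s\<^sup>2)"
  have "(cut R has_real_derivative - 2 * cut R s * k) (at s)"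
    unfolding k_def by (rule cut_derivative[OF assms])
  then have "(wt0 R has_real_derivative (2 * s * cut R s + s\<^sup>2 * (- 2 * cut R s * k)) / 2) (at s)"
    unfolding wt0_def[abs_def] by (auto intro!: derivative_eq_intros)
  moreover have "(2 * s * cut R s + s\<^sup>2 * (- 2 * cut R s * k)) / 2 = s * cut R s * (1 - s * k)"
    by (simp add: field_simps power2_eq_square)
  moreover have "1 - s * k = cut R s"
    using cut_bounds(3)[OF assms, of s] by (simp add: k_def)
  ultimately show ?thesis
    by (simp add: wt1_def power2_eq_square mult.assoc)
qed

lemma wt1_derivative:
  assumes "R > 0"
  shows "(wt1 R has_real_derivative wt2 R s) (at s)"
proof -
  define k where "k = s / (R\<^sup>2 + s\<^sup>2)"
  have "(cut R has_real_derivative - 2 * cut R s * k) (at s)"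
    unfolding k_def by (rule cut_derivative[OF assms])
  then have "(wt1 R has_real_derivative (cut R s)\<^sup>2 + s * (2 * cut R s * (- 2 * cut R s * k))) (at s)"
    unfolding wt1_def[abs_def] by (auto intro!: derivative_eq_intros)
  moreover have "(cut R s)\<^sup>2 + s * (2 * cut R s * (- 2 * cut R s * k)) = (cut R s)\<^sup>2 * (1 - 4 * (s * k))"
    by (simp add: algebra_simps power2_eq_square)
  moreover have "s * k = 1 - cut R s"
    using cut_bounds(3)[OF assms, of s] by (simp add: k_def)
  ultimately show ?thesis
    by (simp add: wt2_def)
qed

lemma wt2_derivative:
  assumes "R > 0"
  shows "(wt2 R has_real_derivative wt3 R s) (at s)"
proof -
  define k where "k = s / (R\<^sup>2 + s\<^sup>2)"
  have "(cut R has_real_derivative - 2 * cut R s * k) (at s)"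
    unfolding k_def by (rule cut_derivative[OF assms])
  then have "(wt2 R has_real_derivative
      (2 * cut R s * (- 2 * cut R s * k)) * (4 * cut R s - 3) + (cut R s)\<^sup>2 * (4 * (- 2 * cut R s * k))) (at s)"
    unfolding wt2_def[abs_def] by (auto intro!: derivative_eq_intros)
  moreover have "(2 * cut R s * (- 2 * cut R s * k)) * (4 * cut R s - 3) + (cut R s)\<^sup>2 * (4 * (- 2 * cut R s * k)) =
      wt3 R s"
    unfolding wt3_def k_def[symmetric] by (simp add: algebra_simps power2_eq_square)
  ultimately show ?thesis
    by simp
qed

text \<open>The bound \<open>wt2 R s \<le> 1\<close> gives the kinetic terms their sign, and the
  bound of the square of \<open>wt1\<close> by \<open>2 * wt0\<close> lets Gronwall's inequality
  close on the regularised second moment itself. The last two bounds, on \<open>wt3\<close> and on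
  \<open>s - wt1 R s\<close>, are the errors that vanish with R to infinity.\<close>

lemma wt_bounds:
  assumes "R > 0"
  shows "0 \<le> wt0 R s" "wt0 R s \<le> s\<^sup>2 / 2" "wt0 R s \<le> R\<^sup>2" "\<bar>wt1 R s\<bar> \<le> R" "\<bar>wt1 R s\<bar> \<le> \<bar>s\<bar>"
    "(wt1 R s)\<^sup>2 \<le> 2 * wt0 R s" "wt2 R s \<le> 1" "\<bar>wt2 R s\<bar> \<le> 3" "\<bar>wt3 R s\<bar> \<le> 6 / R"
    "\<bar>s - wt1 R s\<bar> \<le> s\<^sup>2 / R"
proof -
  define w k where "w = cut R s" and "k = s / (R\<^sup>2 + s\<^sup>2)"
  have w: "0 < w" "w \<le> 1" "1 - w = s * k" and k: "\<bar>k\<bar> \<le> 1 / (2 * R)"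
    using cut_bounds[OF assms] by (auto simp: w_def k_def)
  have w2: "w\<^sup>2 \<le> w" "w\<^sup>2 \<le> 1"
    using w by (auto simp: power2_eq_square mult_le_one mult_left_le)
  have p: "R\<^sup>2 + s\<^sup>2 > 0"
    using assms by (simp add: add_pos_nonneg)
  show "0 \<le> wt0 R s"
    using w by (simp add: wt0_def w_def)
  show "wt0 R s \<le> s\<^sup>2 / 2"
    using w by (simp add: wt0_def w_def[symmetric] mult_left_le)
  have "s\<^sup>2 * w \<le> R\<^sup>2"
    using p by (simp add: w_def cut_def field_simps)
  then show "wt0 R s \<le> R\<^sup>2"
    using zero_le_power2[of R] unfolding wt0_def w_def[symmetric] by linarith
  have "\<bar>s\<bar> * w\<^sup>2 \<le> \<bar>s\<bar> * w"
    using w2 by (intro mult_left_mono) auto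
  also have "\<bar>s\<bar> * w = R\<^sup>2 * \<bar>k\<bar>"
    using p by (simp add: w_def cut_def k_def)
  also have "\<dots> \<le> R\<^sup>2 * (1 / (2 * R))"
    using k by (intro mult_left_mono) auto
  also have "\<dots> \<le> R"
    using assms by (simp add: power2_eq_square)
  finally show "\<bar>wt1 R s\<bar> \<le> R"
    by (simp add: wt1_def abs_mult w_def[symmetric])
  show "\<bar>wt1 R s\<bar> \<le> \<bar>s\<bar>"
    using w2 by (simp add: wt1_def abs_mult w_def[symmetric] mult_left_le)
  have "w ^ 4 \<le> w"
    using w power_le_one[of w 3] mult_left_le[of "w ^ 3" w] by (simp add: eval_nat_numeral)
  then show "(wt1 R s)\<^sup>2 \<le> 2 * wt0 R s"
    using mult_left_mono[of "w ^ 4" w "s\<^sup>2"]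
    by (simp add: wt1_def wt0_def w_def[symmetric] power_mult_distrib flip: power_mult)
  have "w\<^sup>2 * (4 * w - 3) \<le> w\<^sup>2 * 1"
    using w by (intro mult_left_mono) auto
  then show 1: "wt2 R s \<le> 1"
    using w2 unfolding wt2_def w_def[symmetric] by linarith
  have "w\<^sup>2 * (4 * w - 3) \<ge> w\<^sup>2 * (- 3)"
    using w by (intro mult_left_mono) auto
  then show "\<bar>wt2 R s\<bar> \<le> 3"
    using w2 1 unfolding wt2_def w_def[symmetric] by linarith
  have "\<bar>w\<^sup>2 * (1 - 2 * w)\<bar> \<le> 1 * 1"
    unfolding abs_mult using w w2 by (intro mult_mono) auto
  then have "\<bar>12 * (w\<^sup>2 * (1 - 2 * w))\<bar> * \<bar>k\<bar> \<le> 12 * (1 / (2 * R))"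
    using k by (intro mult_mono) auto
  moreover have "wt3 R s = 12 * (w\<^sup>2 * (1 - 2 * w)) * k"
    by (simp add: wt3_def w_def k_def)
  ultimately show "\<bar>wt3 R s\<bar> \<le> 6 / R"
    by (simp add: abs_mult)
  have "s - wt1 R s = s * ((1 - w) * (1 + w))"
    by (simp add: wt1_def w_def[symmetric] power2_eq_square algebra_simps)
  also have "\<dots> = s\<^sup>2 * k * (1 + w)"
    unfolding w(3) by (simp add: power2_eq_square)
  finally have "\<bar>s - wt1 R s\<bar> = s\<^sup>2 * \<bar>k\<bar> * \<bar>1 + w\<bar>"
    by (simp add: abs_mult)
  also have "\<dots> \<le> s\<^sup>2 * (1 / (2 * R)) * 2"
    using k w assms by (intro mult_mono mult_left_mono mult_nonneg_nonneg) auto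
  finally show "\<bar>s - wt1 R s\<bar> \<le> s\<^sup>2 / R"
    by simp
qed

lemma cut_limit: "(\<lambda>n. cut (real (Suc n)) s) \<longlonglongrightarrow> 1"
proof -
  have "(\<lambda>n. 1 / (1 + s\<^sup>2 * (inverse (real (Suc n)))\<^sup>2)) \<longlonglongrightarrow> 1 / (1 + s\<^sup>2 * 0\<^sup>2)"
    by (intro tendsto_intros LIMSEQ_inverse_real_of_nat) auto
  moreover have "1 / (1 + s\<^sup>2 * (inverse (real (Suc n)))\<^sup>2) = cut (real (Suc n)) s" for n
    by (simp add: cut_def field_simps)
  ultimately show ?thesis
    by simp
qed

lemma wt1_limit: "(\<lambda>n. wt1 (real (Suc n)) s) \<longlonglongrightarrow> s"
  using tendsto_mult_left[OF tendsto_power[OF cut_limit[of s], of 2], of s] by (simp add: wt1_def)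

lemma wt_measurable [measurable]:
  "R > 0 \<Longrightarrow> wt0 R \<in> borel_measurable borel" "R > 0 \<Longrightarrow> wt1 R \<in> borel_measurable borel"
  "R > 0 \<Longrightarrow> wt2 R \<in> borel_measurable borel" "wt3 R \<in> borel_measurable borel"
  unfolding wt0_def[abs_def] wt1_def[abs_def] wt2_def[abs_def] wt3_def[abs_def] cut_def[abs_def] by measurable

lemma multiplier_comp_inner:
  fixes b j x0 :: "'a::euclidean_space" and w w' :: "real \<Rightarrow> real"
  assumes w: "\<And>s. (w has_real_derivative w' s) (at s)"
    and m: "w \<in> borel_measurable borel" "w' \<in> borel_measurable borel"
    and B: "\<And>s. \<bar>w s\<bar> \<le> B" "\<And>s. \<bar>w' s\<bar> \<le> B'"
  shows "multiplier b (\<lambda>x. w ((x - x0) \<bullet> j)) (\<lambda>x. (b \<bullet> j) * w' ((x - x0) \<bullet> j))"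
  unfolding multiplier_def
proof (intro conjI allI)
  have [measurable]: "w \<in> borel_measurable borel" "w' \<in> borel_measurable borel"
    by (fact m)+
  show "(\<lambda>x. w ((x - x0) \<bullet> j)) \<in> borel_measurable borel"
    "(\<lambda>x. (b \<bullet> j) * w' ((x - x0) \<bullet> j)) \<in> borel_measurable borel"
    by measurable
  show "\<exists>B. \<forall>x. \<bar>w ((x - x0) \<bullet> j)\<bar> \<le> B"
    using B by blast
  show "\<exists>B. \<forall>x. \<bar>(b \<bullet> j) * w' ((x - x0) \<bullet> j)\<bar> \<le> B"
    using B by (intro exI[of _ "\<bar>b \<bullet> j\<bar> * B'"]) (auto simp: abs_mult intro!: mult_left_mono)
  fix x
  have "((\<lambda>h. (x + h *\<^sub>R b - x0) \<bullet> j) has_real_derivative b \<bullet> j) (at 0)"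
    by (auto intro!: derivative_eq_intros simp: inner_diff_left inner_add_left has_field_derivative_def)
  from DERIV_chain2[OF _ this, of w "w' ((x - x0) \<bullet> j)"] w[of "(x - x0) \<bullet> j"]
  show "((\<lambda>h. w ((x + h *\<^sub>R b - x0) \<bullet> j)) has_real_derivative (b \<bullet> j) * w' ((x - x0) \<bullet> j)) (at 0)"
    by (simp add: mult.commute)
qed

lemma multiplier_wt:
  assumes "R > 0"
  shows "multiplier b (\<lambda>x. wt0 R ((x - x0) \<bullet> j)) (\<lambda>x. (b \<bullet> j) * wt1 R ((x - x0) \<bullet> j))"
    "multiplier b (\<lambda>x. wt1 R ((x - x0) \<bullet> j)) (\<lambda>x. (b \<bullet> j) * wt2 R ((x - x0) \<bullet> j))"
    "multiplier b (\<lambda>x. wt2 R ((x - x0) \<bullet> j)) (\<lambda>x. (b \<bullet> j) * wt3 R ((x - x0) \<bullet> j))"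
proof -
  have "\<bar>wt0 R s\<bar> \<le> R\<^sup>2" for s
    using wt_bounds(1,3)[OF assms, of s] by simp
  then show "multiplier b (\<lambda>x. wt0 R ((x - x0) \<bullet> j)) (\<lambda>x. (b \<bullet> j) * wt1 R ((x - x0) \<bullet> j))"
    using wt_bounds(4)[OF assms] wt0_derivative[OF assms] wt_measurable(1-3)[OF assms] wt_measurable(4)
    by (intro multiplier_comp_inner) auto
  show "multiplier b (\<lambda>x. wt1 R ((x - x0) \<bullet> j)) (\<lambda>x. (b \<bullet> j) * wt2 R ((x - x0) \<bullet> j))"
    using wt_bounds(4,8)[OF assms] wt1_derivative[OF assms] wt_measurable(1-3)[OF assms] wt_measurable(4)
    by (intro multiplier_comp_inner) auto
  show "multiplier b (\<lambda>x. wt2 R ((x - x0) \<bullet> j)) (\<lambda>x. (b \<bullet> j) * wt3 R ((x - x0) \<bullet> j))"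
    using wt_bounds(8,9)[OF assms] wt2_derivative[OF assms] wt_measurable(1-3)[OF assms] wt_measurable(4)
    by (intro multiplier_comp_inner) auto
qed

section \<open>Convex Lipschitz potentials with a unique minimiser\<close>

locale convex_potential =
  fixes f :: "'a::euclidean_space \<Rightarrow> real" and L :: real and x0 :: 'a
  assumes lip: "\<bar>f x - f y\<bar> \<le> L * norm (x - y)"
    and conv: "convex_on UNIV f"
    and min: "f x0 \<le> f x"
    and uniq: "(\<And>x. f y \<le> f x) \<Longrightarrow> y = x0"
begin

abbreviation crd :: "'a \<Rightarrow> 'a \<Rightarrow> real" where
  "crd j x \<equiv> (x - x0) \<bullet> j"

lemma f_continuous: "continuous_on UNIV f"
proof -
  have "L \<ge> 0"
  proof -
    obtain b :: 'a where "b \<in> Basis"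
      using nonempty_Basis by blast
    then show ?thesis
      using lip[of b 0] by simp
  qed
  then have "L-lipschitz_on UNIV f"
    using lip by (auto simp: lipschitz_on_def dist_norm)
  then show ?thesis
    by (rule lipschitz_on_continuous_on)
qed

lemma f_measurable [measurable]: "f \<in> borel_measurable borel"
  using f_continuous by (rule borel_measurable_continuous_onI)

text \<open>On the unit sphere about \<open>x0\<close> the minimum of \<open>f\<close> exceeds
  \<open>f x0\<close> strictly, for otherwise it would be a second global minimiser. Convexity along
  rays spreads this gap linearly to the outside.\<close>

lemma coercive: "\<exists>c>0. \<forall>x. norm (x - x0) \<ge> 1 \<longrightarrow> f x - f x0 \<ge> c * norm (x - x0)"
proof -
  have "sphere x0 1 \<noteq> {}"
    by simp
  then obtain z where z: "z \<in> sphere x0 1" "\<And>y. y \<in> sphere x0 1 \<Longrightarrow> f z \<le> f y"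
    using continuous_attains_inf[of "sphere x0 1" f] continuous_on_subset[OF f_continuous] by auto
  have "f z > f x0"
  proof (rule ccontr)
    assume "\<not> ?thesis"
    then have "f z \<le> f x" for x
      using min[of x] by linarith
    then have "z = x0"
      by (rule uniq)
    then show False
      using z(1) by simp
  qed
  moreover have "(f z - f x0) * norm (x - x0) \<le> f x - f x0" if n: "norm (x - x0) \<ge> 1" for x
  proof -
    define r where "r = norm (x - x0)"
    have "r \<ge> 1"
      using n by (simp add: r_def)
    then have r: "r > 0" "1 / r \<le> 1"
      by simp_all
    define y where "y = (1 - 1 / r) *\<^sub>R x0 + (1 / r) *\<^sub>R x"
    have "y - x0 = (1 / r) *\<^sub>R (x - x0)"
      by (simp add: y_def algebra_simps)
    then have "norm (y - x0) = 1"
      using r by (simp add: r_def)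
    then have "f z \<le> f y"
      by (intro z) (simp add: dist_norm norm_minus_commute)
    also have "f y \<le> (1 - 1 / r) * f x0 + (1 / r) * f x"
      unfolding y_def using r by (intro convex_onD[OF conv]) auto
    finally have "r * f z \<le> r * ((1 - 1 / r) * f x0 + (1 / r) * f x)"
      using r by (intro mult_left_mono) auto
    also have "\<dots> = (r - 1) * f x0 + f x"
      using r by (simp add: field_simps)
    finally show ?thesis
      by (simp add: r_def[symmetric] algebra_simps)
  qed
  ultimately show ?thesis
    by (intro exI[of _ "f z - f x0"]) auto
qed

text \<open>By \<open>coercive\<close>, |x - x0| is at most 1 + (f x - f x0) / c, where the 1 takes
  care of the unit ball. Hence the domain of \<open>f\<close> lies in that of every
  coordinate.\<close>

lemma in_dom_coordinate:
  assumes "in_dom f U" "j \<in> Basis"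
  shows "in_dom (crd j) U"
proof -
  obtain c where c: "c > 0" "\<And>x. norm (x - x0) \<ge> 1 \<Longrightarrow> f x - f x0 \<ge> c * norm (x - x0)"
    using coercive by blast
  have const: "in_dom (\<lambda>_. k) U" for k
    by (rule in_dom_bounded[where B="\<bar>k\<bar>"]) auto
  have "in_dom (\<lambda>x. (1 / c) * f x + (1 - (1 / c) * f x0)) U"
    by (intro mul_add_fun mul_scale_fun const assms)
  moreover have "\<bar>crd j x\<bar> \<le> \<bar>(1 / c) * f x + (1 - (1 / c) * f x0)\<bar>" for x
  proof -
    have "norm (x - x0) \<le> 1 + (f x - f x0) / c"
    proof (cases "norm (x - x0) \<ge> 1")
      case True
      have "norm (x - x0) \<le> (f x - f x0) / c"
        using c(1) c(2)[OF True] by (simp add: field_simps)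
      then show ?thesis by linarith
    next
      case False
      have "(f x - f x0) / c \<ge> 0"
        using c(1) min[of x] by simp
      then show ?thesis
        using False by linarith
    qed
    moreover have "1 + (f x - f x0) / c = (1 / c) * f x + (1 - (1 / c) * f x0)"
      using c(1) by (simp add: field_simps)
    ultimately show ?thesis
      using Basis_le_norm[OF assms(2), of "x - x0"] by linarith
  qed
  moreover have "(crd j) \<in> borel_measurable borel"
    by measurable
  ultimately show ?thesis
    using in_dom_mono by blast
qed

definition quot :: "'a \<Rightarrow> real \<Rightarrow> 'a \<Rightarrow> real" where
  "quot b h x = (f (x + h *\<^sub>R b) - f x) / h"

lemma quot_measurable [measurable]: "quot b h \<in> borel_measurable borel"
  unfolding quot_def[abs_def] by measurable

lemma quot_bound: "\<bar>quot b h x\<bar> \<le> \<bar>L\<bar> * norm b"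
proof (cases "h = 0")
  case False
  have "\<bar>f (x + h *\<^sub>R b) - f x\<bar> \<le> L * (\<bar>h\<bar> * norm b)"
    using lip[of "x + h *\<^sub>R b" x] by simp
  also have "\<dots> \<le> \<bar>L\<bar> * (\<bar>h\<bar> * norm b)"
    by (intro mult_right_mono) auto
  finally show ?thesis
    using False by (simp add: quot_def field_simps)
qed (simp add: quot_def)

lemma quot_mono_pos:
  assumes "0 < h" "h \<le> k"
  shows "quot b h x \<le> quot b k x"
proof -
  have "x + h *\<^sub>R b = (1 - h / k) *\<^sub>R x + (h / k) *\<^sub>R (x + k *\<^sub>R b)"
    using assms by (simp add: algebra_simps)
  then have "f (x + h *\<^sub>R b) \<le> (1 - h / k) * f x + (h / k) * f (x + k *\<^sub>R b)"
    using convex_onD[OF conv, of "h / k" x "x + k *\<^sub>R b"] assms by simp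
  then have "f (x + h *\<^sub>R b) - f x \<le> h * quot b k x"
    using assms by (simp add: quot_def field_simps)
  then show ?thesis
    using assms by (simp add: quot_def pos_divide_le_eq mult.commute)
qed

lemma quot_neg: "quot b (- h) x = - quot (- b) h x"
  by (simp add: quot_def)

lemma quot_mono:
  assumes "h \<le> k" "h \<noteq> 0" "k \<noteq> 0"
  shows "quot b h x \<le> quot b k x"
proof -
  consider "0 < h" | "k < 0" | "h < 0" "0 < k"
    using assms by linarith
  then show ?thesis
  proof cases
    case 1
    then show ?thesis
      using assms quot_mono_pos by blast
  next
    case 2
    then show ?thesis
      using assms quot_mono_pos[of "- k" "- h" "- b" x] quot_neg[of b "- k" x] quot_neg[of b "- h" x] by simp
  next
    case 3
    \<comment> \<open>The weight that makes \<open>x\<close> the convex combination of x + h b and x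
      + k b, as 0 lies between h and k.\<close>
    define t where "t = - h / (k - h)"
    have t: "0 \<le> t" "t \<le> 1" "1 - t = k / (k - h)"
      using 3 by (auto simp: t_def field_simps)
    have "(1 - t) *\<^sub>R (x + h *\<^sub>R b) + t *\<^sub>R (x + k *\<^sub>R b) = x + ((1 - t) * h + t * k) *\<^sub>R b"
      by (simp add: algebra_simps)
    also have "(1 - t) * h + t * k = 0"
      using 3 unfolding t(3) by (simp add: t_def)
    finally have "f x \<le> (1 - t) * f (x + h *\<^sub>R b) + t * f (x + k *\<^sub>R b)"
      using convex_onD[OF conv t(1,2), of "x + h *\<^sub>R b" "x + k *\<^sub>R b"] by simp
    also have "\<dots> = (k * f (x + h *\<^sub>R b) - h * f (x + k *\<^sub>R b)) / (k - h)"
      unfolding t(3) by (simp add: t_def diff_divide_distrib)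
    finally have "f x * (k - h) \<le> k * f (x + h *\<^sub>R b) - h * f (x + k *\<^sub>R b)"
      using 3 by (simp add: pos_le_divide_eq)
    then show ?thesis
      using 3 by (simp add: quot_def divide_simps algebra_simps)
  qed
qed

text \<open>One-sided derivatives; the left one in direction \<open>b\<close> is \<open>- rderiv (- b)\<close>.\<close>

definition rderiv :: "'a \<Rightarrow> 'a \<Rightarrow> real" where
  "rderiv b x = lim (\<lambda>n. quot b (1 / real (Suc n)) x)"

text \<open>Monotone by convexity and bounded by the Lipschitz condition. Using one fixed sequence
  of increments also yields measurability of \<open>rderiv\<close>.\<close>

lemma rderiv_limit: "(\<lambda>n. quot b (1 / real (Suc n)) x) \<longlonglongrightarrow> rderiv b x"
proof -
  have "Bseq (\<lambda>n. quot b (1 / real (Suc n)) x)"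
    using quot_bound by (intro BseqI'[of _ "\<bar>L\<bar> * norm b"]) simp
  moreover have "monoseq (\<lambda>n. quot b (1 / real (Suc n)) x)"
    by (intro monoI2 allI impI quot_mono) (auto simp: field_simps)
  ultimately show ?thesis
    unfolding rderiv_def by (simp add: Bseq_monoseq_convergent convergent_LIMSEQ_iff[symmetric])
qed

lemma rderiv_measurable [measurable]: "rderiv b \<in> borel_measurable borel"
  by (rule borel_measurable_LIMSEQ_real[OF rderiv_limit]) measurable

lemma rderiv_bound: "\<bar>rderiv b x\<bar> \<le> \<bar>L\<bar> * norm b"
  by (rule LIMSEQ_le_const2[OF tendsto_rabs[OF rderiv_limit]]) (use quot_bound in auto)

lemma lderiv_limit: "(\<lambda>n. quot b (- 1 / real (Suc n)) x) \<longlonglongrightarrow> - rderiv (- b) x"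
  using tendsto_minus[OF rderiv_limit[of "- b" x]] by (simp add: quot_def)

lemma lderiv_le_rderiv: "- rderiv (- b) x \<le> rderiv b x"
  by (rule LIMSEQ_le[OF lderiv_limit rderiv_limit]) (auto intro!: exI quot_mono simp: divide_simps)

text \<open>As \<open>quot\<close> is monotone in the increment, all its values for small increments
  of either sign lie between those at -1/(N+1) and 1/(N+1).\<close>

lemma directional_derivative:
  assumes "rderiv b x = - rderiv (- b) x"
  shows "((\<lambda>h. f (x + h *\<^sub>R b)) has_real_derivative rderiv b x) (at 0)"
proof -
  have "((\<lambda>h. quot b h x) \<longlongrightarrow> rderiv b x) (at 0)"
  proof (rule LIM_I)
    fix e :: real assume e: "e > 0"
    obtain N where N: "\<bar>quot b (1 / real (Suc N)) x - rderiv b x\<bar> < e"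
      "\<bar>quot b (- 1 / real (Suc N)) x - rderiv b x\<bar> < e"
    proof -
      obtain M M' where M: "\<And>n. n \<ge> M \<Longrightarrow> norm (quot b (1 / real (Suc n)) x - rderiv b x) < e"
        "\<And>n. n \<ge> M' \<Longrightarrow> norm (quot b (- 1 / real (Suc n)) x - rderiv b x) < e"
        using LIMSEQ_D[OF rderiv_limit e, of b x] LIMSEQ_D[OF lderiv_limit e, of b x] assms by metis
      show ?thesis
        using M(1)[of "max M M'"] M(2)[of "max M M'"] by (intro that[of "max M M'"]) auto
    qed
    show "\<exists>s>0. \<forall>h. h \<noteq> 0 \<and> norm (h - 0) < s \<longrightarrow> norm (quot b h x - rderiv b x) < e"
    proof (intro exI[of _ "1 / real (Suc N)"] conjI allI impI)
      fix h :: real assume h: "h \<noteq> 0 \<and> norm (h - 0) < 1 / real (Suc N)"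
      have "quot b (- 1 / real (Suc N)) x \<le> quot b h x"
        using h by (intro quot_mono) auto
      moreover have "quot b h x \<le> quot b (1 / real (Suc N)) x"
        using h by (intro quot_mono) auto
      ultimately show "norm (quot b h x - rderiv b x) < e"
        using N unfolding real_norm_def by linarith
    qed simp
  qed
  then show ?thesis
    by (simp add: DERIV_def quot_def)
qed

text \<open>Only partial derivatives are available, so the derivative of \<open>f\<close> along y =
  x - x0 is bounded through Jensen's inequality: x + (s / N) y is the mean of the N points x + s y_j
  e_j, N being the dimension. Convexity along the ray from \<open>x0\<close> compares
  \<open>f x - f x0\<close> with the increment of \<open>f\<close> beyond \<open>x\<close>.\<close>

lemma gradient_inequality:
  assumes r: "\<And>j. j \<in> Basis \<Longrightarrow> rderiv j x = - rderiv (- j) x"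
  shows "f x - f x0 \<le> (\<Sum>j\<in>Basis. (crd j x) * rderiv j x)"
proof -
  define y where "y = x - x0"
  define N where "N = real DIM('a)"
  have N: "N > 0"
    by (simp add: N_def)
  define S where "S s = (\<Sum>j\<in>Basis. f (x + (s * (y \<bullet> j)) *\<^sub>R j))" for s
  have "((\<lambda>s. f (x + (s * (y \<bullet> j)) *\<^sub>R j)) has_real_derivative (y \<bullet> j) * rderiv j x) (at 0)"
    if "j \<in> Basis" for j
  proof -
    have "((\<lambda>s. s * (y \<bullet> j)) has_real_derivative y \<bullet> j) (at 0)"
      by (auto intro!: derivative_eq_intros)
    from DERIV_chain2[OF _ this, of "\<lambda>h. f (x + h *\<^sub>R j)" "rderiv j x"] directional_derivative[OF r[OF that]]
    show ?thesis
      by (simp add: mult.commute)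
  qed
  then have "(S has_real_derivative (\<Sum>j\<in>Basis. (y \<bullet> j) * rderiv j x)) (at 0)"
    unfolding S_def[abs_def] by (rule DERIV_sum)
  then have lim: "((\<lambda>s. (S s - S 0) / s) \<longlongrightarrow> (\<Sum>j\<in>Basis. (y \<bullet> j) * rderiv j x)) (at_right 0)"
    unfolding DERIV_def by (simp add: tendsto_within_subset[of _ _ _ UNIV])
  have ineq: "f x - f x0 \<le> (S s - S 0) / s" if s: "s > 0" for s
  proof -
    define k where "k = s / N"
    have k: "k > 0"
      using s N by (simp add: k_def)
    \<comment> \<open>With q = 1 / (1 + k) this exhibits \<open>x\<close> as a convex combination of
      \<open>x0\<close> and x + k y.\<close>
    have "(1 - q) *\<^sub>R x0 + q *\<^sub>R (x0 + (1 + k) *\<^sub>R y) = x0 + (q * (1 + k)) *\<^sub>R y" for q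
      by (simp add: scaleR_add_right scaleR_diff_left)
    moreover have "x + k *\<^sub>R y = x0 + (1 + k) *\<^sub>R y"
      by (simp add: y_def algebra_simps)
    ultimately have "(1 - 1 / (1 + k)) *\<^sub>R x0 + (1 / (1 + k)) *\<^sub>R (x + k *\<^sub>R y) =
        x0 + (1 / (1 + k) * (1 + k)) *\<^sub>R y"
      by metis
    also have "\<dots> = x"
      using k by (simp add: y_def)
    finally have "f x \<le> (1 - 1 / (1 + k)) * f x0 + (1 / (1 + k)) * f (x + k *\<^sub>R y)"
      using convex_onD[OF conv, of "1 / (1 + k)" x0 "x + k *\<^sub>R y"] k by simp
    then have "(1 + k) * f x \<le> (1 + k) * ((1 - 1 / (1 + k)) * f x0 + (1 / (1 + k)) * f (x + k *\<^sub>R y))"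
      using k by (intro mult_left_mono) auto
    also have "\<dots> = (1 + k) * f x0 + ((1 + k) * (1 / (1 + k))) * (f (x + k *\<^sub>R y) - f x0)"
      by (simp only: algebra_simps)
    also have "\<dots> = k * f x0 + f (x + k *\<^sub>R y)"
      using k by (simp add: algebra_simps)
    finally have 1: "k * (f x - f x0) \<le> f (x + k *\<^sub>R y) - f x"
      by (simp add: algebra_simps)
    have "(\<Sum>j\<in>Basis. (1 / N) *\<^sub>R (x + (s * (y \<bullet> j)) *\<^sub>R j)) =
        (1 / N) *\<^sub>R ((\<Sum>j\<in>(Basis::'a set). x) + s *\<^sub>R (\<Sum>j\<in>Basis. (y \<bullet> j) *\<^sub>R j))"
      by (simp add: sum.distrib scaleR_sum_right scaleR_add_right)
    also have "\<dots> = x + k *\<^sub>R y"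
      using N by (simp add: euclidean_representation k_def N_def[symmetric] sum_constant_scaleR scaleR_add_right)
    finally have "f (x + k *\<^sub>R y) = f (\<Sum>j\<in>Basis. (1 / N) *\<^sub>R (x + (s * (y \<bullet> j)) *\<^sub>R j))"
      by simp
    also have "\<dots> \<le> (\<Sum>j\<in>Basis. (1 / N) * f (x + (s * (y \<bullet> j)) *\<^sub>R j))"
      using N by (intro convex_on_sum[OF _ _ conv]) (auto simp: N_def)
    also have "\<dots> = (1 / N) * S s"
      by (simp add: S_def sum_distrib_left)
    finally have "k * (f x - f x0) \<le> (1 / N) * S s - f x"
      using 1 by linarith
    then have "N * (k * (f x - f x0)) \<le> N * ((1 / N) * S s - f x)"
      using N by (intro mult_left_mono) auto
    moreover have "N * (k * (f x - f x0)) = s * (f x - f x0)" "N * ((1 / N) * S s - f x) = S s - N * f x"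
      using N by (simp_all add: k_def right_diff_distrib)
    moreover have "S 0 = N * f x"
      by (simp add: S_def N_def)
    ultimately show ?thesis
      using s by (simp add: pos_le_divide_eq mult.commute)
  qed
  have "f x - f x0 \<le> (\<Sum>j\<in>Basis. (y \<bullet> j) * rderiv j x)"
    by (rule tendsto_lowerbound[OF lim]) (use ineq in \<open>auto simp: eventually_at_filter\<close>)
  then show ?thesis
    by (simp add: y_def)
qed

text \<open>The limit over all increments is already known, and each one-sided derivative is a
  bounded pointwise limit of \<open>quot\<close> along a null sequence; both expectations are
  therefore that same limit.\<close>

lemma inner_rderiv:
  assumes f: "in_dom f U" and m: "multiplier b m m'" and U: "has_partial b U P"
  shows "mul (rderiv b) (mul m U) \<bullet> U = - (2 * (mul f U \<bullet> mul m P) + mul f U \<bullet> mul m' U)"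
    "mul (\<lambda>x. - rderiv (- b) x) (mul m U) \<bullet> U = - (2 * (mul f U \<bullet> mul m P) + mul f U \<bullet> mul m' U)"
proof -
  have lim: "((\<lambda>h. mul (quot b h) (mul m U) \<bullet> U) \<longlongrightarrow>
      - (2 * (mul f U \<bullet> mul m P) + mul f U \<bullet> mul m' U)) (at 0)"
    using inner_mul_difference_quotient[OF lip f m U] by (simp add: quot_def[abs_def])
  have gen: "mul r (mul m U) \<bullet> U = - (2 * (mul f U \<bullet> mul m P) + mul f U \<bullet> mul m' U)"
    if X: "X \<longlonglongrightarrow> 0" "\<And>n. X n \<noteq> 0" and r: "\<And>x. (\<lambda>n. quot b (X n) x) \<longlonglongrightarrow> r x"
      and rm: "r \<in> borel_measurable borel" for X r
  proof (rule LIMSEQ_unique)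
    show "(\<lambda>n. mul (quot b (X n)) (mul m U) \<bullet> U) \<longlonglongrightarrow>
        - (2 * (mul f U \<bullet> mul m P) + mul f U \<bullet> mul m' U)"
      using lim X unfolding tendsto_at_iff_sequentially comp_def by simp
    have "(\<lambda>n. mul (quot b (X n)) (mul m U)) \<longlonglongrightarrow> mul r (mul m U)"
    proof (rule tendsto_mul_seq)
      show "in_dom (\<lambda>_. \<bar>L\<bar> * norm b) (mul m U)"
        by (rule in_dom_bounded[where B="\<bar>L\<bar> * norm b"]) auto
      show "\<bar>quot b (X i) x\<bar> \<le> \<bar>\<bar>L\<bar> * norm b\<bar>" for i x
        using quot_bound[of b "X i" x] by simp
    qed (use r rm in auto)
    then show "(\<lambda>n. mul (quot b (X n)) (mul m U) \<bullet> U) \<longlonglongrightarrow> mul r (mul m U) \<bullet> U"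
      by (rule tendsto_inner) simp
  qed
  have X: "(\<lambda>n. 1 / real (Suc n)) \<longlonglongrightarrow> 0"
    using LIMSEQ_inverse_real_of_nat by (simp add: divide_inverse)
  show "mul (rderiv b) (mul m U) \<bullet> U = - (2 * (mul f U \<bullet> mul m P) + mul f U \<bullet> mul m' U)"
    by (rule gen[OF X _ rderiv_limit]) auto
  have "(\<lambda>n. - 1 / real (Suc n)) \<longlonglongrightarrow> 0"
    using tendsto_minus[OF X] by simp
  then show "mul (\<lambda>x. - rderiv (- b) x) (mul m U) \<bullet> U = - (2 * (mul f U \<bullet> mul m P) + mul f U \<bullet> mul m' U)"
    by (rule gen[OF _ _ lderiv_limit]) auto
qed

text \<open>Rademacher's theorem is avoided: the two one-sided derivatives have the same integral against
  the density \<open>|u|\<^sup>2\<close> (the previous lemma with a constant multiplier) and are ordered.\<close>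

lemma rderiv_eq_lderiv_AE:
  assumes u: "u \<in> L2" and f: "in_dom f (abs_l2 u)" and U: "has_partial b (abs_l2 u) P"
  shows "AE x in lborel. u x \<noteq> 0 \<longrightarrow> rderiv b x = - rderiv (- b) x"
proof -
  define U where "U = abs_l2 u"
  have m: "multiplier b (\<lambda>_. 1) (\<lambda>_. 0)"
    by (auto simp: multiplier_def)
  have d: "in_dom (rderiv c) V" for V c
    by (rule in_dom_bounded[OF rderiv_measurable rderiv_bound])
  have d': "in_dom (\<lambda>x. - rderiv c x) V" for V c
    using mul_scale_fun(1)[OF d, of "- 1"] by simp
  have one: "mul (\<lambda>_. 1) V = V" "in_dom (\<lambda>_. 1) V" for V :: "'a l2"
    by (cases V, simp add: mul_abs_l2 in_dom_abs_l2)+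
  have "mul (rderiv b) U \<bullet> U = mul (\<lambda>x. - rderiv (- b) x) U \<bullet> U"
    using inner_rderiv[OF f m U] by (simp add: U_def one)
  then have "(mul (rderiv b) U + (-1) *\<^sub>R mul (\<lambda>x. - rderiv (- b) x) U) \<bullet> U = 0"
    by (simp add: inner_diff_left)
  also have "mul (rderiv b) U + (-1) *\<^sub>R mul (\<lambda>x. - rderiv (- b) x) U = mul (\<lambda>x. rderiv b x + (-1) * (- rderiv (- b) x)) U"
    by (simp only: mul_add_fun(2)[OF d mul_scale_fun(1)[OF d']] mul_scale_fun(2)[OF d'])
  finally have "mul (\<lambda>x. rderiv b x + rderiv (- b) x) U \<bullet> U = 0"
    by simp
  moreover have dd: "in_dom (\<lambda>x. rderiv b x + rderiv (- b) x) U"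
    by (intro mul_add_fun d)
  ultimately have int0: "(LINT x|lborel. (rderiv b x + rderiv (- b) x) * (u x \<bullet> u x)) = 0"
    using u by (simp add: U_def inner_mul_abs_l2)
  have nn: "(rderiv b x + rderiv (- b) x) * (u x \<bullet> u x) \<ge> 0" for x
    using lderiv_le_rderiv[of b x] by (intro mult_nonneg_nonneg) auto
  have "integrable lborel (\<lambda>x. ((rderiv b x + rderiv (- b) x) *\<^sub>R u x) \<bullet> u x)"
    using dd u by (intro L2_integrable_inner) (auto simp: U_def in_dom_abs_l2)
  then have "AE x in lborel. (rderiv b x + rderiv (- b) x) * (u x \<bullet> u x) = 0"
    using integral_nonneg_eq_0_iff_AE[of lborel "\<lambda>x. (rderiv b x + rderiv (- b) x) * (u x \<bullet> u x)"]
      int0 nn by simp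
  then show ?thesis
    by eventually_elim auto
qed

text \<open>The gradient inequality integrated against |u|^2. Replacing the coordinate y_j by
  \<open>wt1\<close> costs at most y_j^2 / R, multiplied by the bound |L| on the one-sided
  derivatives.\<close>

lemma virial_bound:
  assumes f: "in_dom f U" and P: "\<And>j. j \<in> Basis \<Longrightarrow> has_partial j U (P j)" and R: "R > 0"
  shows "mul f U \<bullet> U - f x0 * (U \<bullet> U) \<le>
    (\<Sum>j\<in>Basis. mul (rderiv j) (mul (\<lambda>x. wt1 R (crd j x)) U) \<bullet> U) +
    \<bar>L\<bar> / R * (\<Sum>j\<in>Basis. (norm (mul (crd j) U))\<^sup>2)"
proof -
  obtain u where u: "u \<in> L2" "U = abs_l2 u"
    by (cases U)
  define eta where "eta j x = wt1 R (crd j x)" for j x :: 'a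
  have eta_m: "eta j \<in> borel_measurable borel" for j
    unfolding eta_def[abs_def] using wt_measurable(2)[OF R] by measurable
  have rd: "in_dom (rderiv c) V" for V c
    by (rule in_dom_bounded[OF rderiv_measurable rderiv_bound])
  have ed: "in_dom (eta j) V" for V j
    using wt_bounds(4)[OF R] by (intro in_dom_bounded[OF eta_m, of _ R]) (simp add: eta_def)
  note re = mul_mul[OF ed rd]
  have yd: "in_dom (crd j) U" if "j \<in> Basis" for j
    using in_dom_coordinate[OF f that] .
  note int_mul = integrable_weight[OF u(1), folded u(2)]
  have inn: "mul m U \<bullet> U = (LINT x|lborel. m x * (u x \<bullet> u x))" if "in_dom m U" for m
    using that u by (simp add: inner_mul_abs_l2)
  have int_y: "integrable lborel (\<lambda>x. (crd j x)\<^sup>2 * (u x \<bullet> u x))"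
    and norm_y: "(norm (mul (crd j) U))\<^sup>2 = (LINT x|lborel. (crd j x)\<^sup>2 * (u x \<bullet> u x))"
    if "j \<in> Basis" for j
    using inner_mul_mul[OF u(1), folded u(2), OF yd[OF that] yd[OF that]]
    unfolding power2_norm_eq_inner unfolding power2_eq_square by simp_all
  have uu: "U \<bullet> U = (LINT x|lborel. u x \<bullet> u x)"
    using u by (simp add: inner_abs_l2)
  \<comment> \<open>Agreement of the one-sided derivatives is available where \<open>u x\<close> is
    nonzero; elsewhere both sides of the weighted inequality are 0.\<close>
  have "AE x in lborel. \<forall>j\<in>Basis. u x \<noteq> 0 \<longrightarrow> rderiv j x = - rderiv (- j) x"
    using rderiv_eq_lderiv_AE[OF u(1) f[unfolded u(2)] P[unfolded u(2)]] by (intro AE_finite_allI) auto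
  then have AE: "AE x in lborel. f x * (u x \<bullet> u x) - f x0 * (u x \<bullet> u x) \<le>
      (\<Sum>j\<in>Basis. (rderiv j x * eta j x) * (u x \<bullet> u x)) +
      \<bar>L\<bar> / R * (\<Sum>j\<in>Basis. (crd j x)\<^sup>2 * (u x \<bullet> u x))"
  proof eventually_elim
    case (elim x)
    show ?case
    proof (cases "u x = 0")
      case False
      have "f x - f x0 \<le> (\<Sum>j\<in>Basis. (crd j x) * rderiv j x)"
        using elim False by (intro gradient_inequality) auto
      also have "\<dots> = (\<Sum>j\<in>Basis. rderiv j x * eta j x) + (\<Sum>j\<in>Basis. rderiv j x * (crd j x - eta j x))"
        by (simp add: algebra_simps flip: sum.distrib)
      also have "(\<Sum>j\<in>Basis. rderiv j x * (crd j x - eta j x)) \<le>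
          (\<Sum>j\<in>Basis. \<bar>L\<bar> * ((crd j x)\<^sup>2 / R))"
      proof (rule sum_mono)
        fix j :: 'a assume j: "j \<in> Basis"
        have "rderiv j x * (crd j x - eta j x) \<le> \<bar>rderiv j x\<bar> * \<bar>crd j x - eta j x\<bar>"
          by (simp flip: abs_mult)
        also have "\<dots> \<le> \<bar>L\<bar> * ((crd j x)\<^sup>2 / R)"
          using rderiv_bound[of j x] j wt_bounds(10)[OF R, of "crd j x"]
          by (intro mult_mono) (auto simp: eta_def)
        finally show "rderiv j x * (crd j x - eta j x) \<le> \<bar>L\<bar> * ((crd j x)\<^sup>2 / R)" .
      qed
      finally have "f x - f x0 \<le> (\<Sum>j\<in>Basis. rderiv j x * eta j x) +
          \<bar>L\<bar> / R * (\<Sum>j\<in>Basis. (crd j x)\<^sup>2)"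
        by (simp add: sum_distrib_left)
      from mult_right_mono[OF this, of "u x \<bullet> u x"] show ?thesis
        unfolding sum_distrib_right[symmetric] by (simp add: algebra_simps)
    qed simp
  qed
  have "mul f U \<bullet> U - f x0 * (U \<bullet> U) = (LINT x|lborel. f x * (u x \<bullet> u x) - f x0 * (u x \<bullet> u x))"
    using int_mul[OF f] L2_integrable_inner[OF u(1,1)]
    by (simp add: inn[OF f] uu)
  also have "\<dots> \<le> (LINT x|lborel. (\<Sum>j\<in>Basis. (rderiv j x * eta j x) * (u x \<bullet> u x)) +
      \<bar>L\<bar> / R * (\<Sum>j\<in>Basis. (crd j x)\<^sup>2 * (u x \<bullet> u x)))"
    using int_mul[OF f] L2_integrable_inner[OF u(1,1)] int_mul[OF re(1)] int_y AE
    by (intro integral_mono_AE Bochner_Integration.integrable_add Bochner_Integration.integrable_sum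
        Bochner_Integration.integrable_diff integrable_mult_right) auto
  also have "\<dots> = (\<Sum>j\<in>Basis. mul (\<lambda>x. rderiv j x * eta j x) U \<bullet> U) +
      \<bar>L\<bar> / R * (\<Sum>j\<in>Basis. (norm (mul (crd j) U))\<^sup>2)"
    using int_mul[OF re(1)] int_y
    by (subst Bochner_Integration.integral_add)
      (auto simp: inn[OF re(1)] norm_y intro!: Bochner_Integration.integrable_sum)
  finally show ?thesis
    unfolding re(2) unfolding eta_def .
qed

end

section \<open>Expectations of multiplication operators, and an increment estimate\<close>

lemma inner_mul_imul_mul:
  assumes "in_dom m U" "in_dom n U"
  shows "mul m U \<bullet> imul (mul n U) = 0"
proof -
  obtain u where u: "u \<in> L2" "U = abs_l2 u"
    by (cases U)
  have L: "(\<lambda>x. m x *\<^sub>R u x) \<in> L2" "(\<lambda>x. n x *\<^sub>R u x) \<in> L2"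
    using assms u by (auto simp: in_dom_abs_l2)
  have Z: "(m x *\<^sub>R u x) \<bullet> (\<i> * (n x *\<^sub>R u x)) = 0" for x
    by (simp add: inner_complex_def)
  have "abs_l2 (\<lambda>x. m x *\<^sub>R u x) \<bullet> imul (abs_l2 (\<lambda>x. n x *\<^sub>R u x)) = 0"
    unfolding imul_abs_l2[OF L(2)] inner_abs_l2[OF L(1) L2_cmult[OF L(2)]] Z by simp
  then show ?thesis
    using u assms by (simp add: mul_abs_l2)
qed

lemma inner_mul_mono:
  assumes "in_dom m U" "in_dom n U" "\<And>x. m x \<le> n x"
  shows "mul m U \<bullet> U \<le> mul n U \<bullet> U"
proof -
  obtain u where u: "u \<in> L2" "U = abs_l2 u"
    by (cases U)
  have "(LINT x|lborel. m x * (u x \<bullet> u x)) \<le> (LINT x|lborel. n x * (u x \<bullet> u x))"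
    using assms u by (intro integral_mono integrable_weight mult_right_mono) auto
  then show ?thesis
    using u assms by (simp add: inner_mul_abs_l2)
qed

lemma inner_mul_le_norm:
  assumes "in_dom m U" "in_dom n U" "\<And>x. m x \<le> (n x)\<^sup>2"
  shows "mul m U \<bullet> U \<le> (norm (mul n U))\<^sup>2"
proof -
  obtain u where u: "u \<in> L2" "U = abs_l2 u"
    by (cases U)
  note n = inner_mul_mul[OF u(1) assms(2,2)[unfolded u(2)]]
  have "(LINT x|lborel. m x * (u x \<bullet> u x)) \<le> (LINT x|lborel. n x * n x * (u x \<bullet> u x))"
    using assms(3) by (intro integral_mono[OF integrable_weight[OF u(1) assms(1)[unfolded u(2)]] n(1)] mult_right_mono)
      (auto simp: power2_eq_square)
  then show ?thesis
    using u assms n(2) by (simp add: inner_mul_abs_l2 power2_norm_eq_inner)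
qed

lemma mul_const: "in_dom (\<lambda>_. c) U" "mul (\<lambda>_. c) U = c *\<^sub>R U"
  by (cases U, simp add: in_dom_abs_l2 L2_scaleR mul_abs_l2 scaleR_abs_l2)+

lemma increment_le:
  fixes \<phi> :: "real \<Rightarrow> real"
  assumes "\<And>s. s \<ge> T \<Longrightarrow> (\<phi> has_real_derivative \<phi>' s) (at s within {T..})"
    and "\<And>s. T \<le> s \<Longrightarrow> s \<le> t \<Longrightarrow> \<phi>' s \<le> C" and "T \<le> t"
  shows "\<phi> t - \<phi> T \<le> C * (t - T)"
proof -
  have "(\<phi> has_derivative (*) (\<phi>' s)) (at s within {T..t})" if "T \<le> s" "s \<le> t" for s
    using assms(1)[OF that(1)] unfolding has_field_derivative_def
    by (rule has_derivative_subset) auto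
  from mvt_very_simple[OF assms(3) this] obtain s where "s \<in> {T..t}" "\<phi> t - \<phi> T = \<phi>' s * (t - T)"
    by auto
  then show ?thesis
    using assms(2)[of s] assms(3) by (auto intro!: mult_right_mono)
qed

section \<open>The Lyapunov function along a solution\<close>

text \<open>A strong solution in terms of classes: \<open>D\<close> is the time derivative,
  \<open>P\<close> and \<open>Q\<close> are the first and second strong spatial derivatives, and
  \<open>W\<close> is the Laplacian of the state.\<close>

locale qhd = convex_potential f L x0 for f :: "'a::euclidean_space \<Rightarrow> real" and L x0 +
  fixes T :: real and \<Psi> D W :: "real \<Rightarrow> 'a l2" and P :: "'a \<Rightarrow> real \<Rightarrow> 'a l2"
    and Q :: "'a \<Rightarrow> 'a \<Rightarrow> real \<Rightarrow> 'a l2"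
  assumes T_pos: "T > 0"
    and norm_Psi: "t \<ge> T \<Longrightarrow> norm (\<Psi> t) = 1"
    and derivative: "t \<ge> T \<Longrightarrow> ((\<lambda>s. (\<Psi> s - \<Psi> t) /\<^sub>R (s - t)) \<longlongrightarrow> D t) (at t within {T..})"
    and D_continuous: "continuous_on {T..} D"
    and partial1: "t \<ge> T \<Longrightarrow> j \<in> Basis \<Longrightarrow> has_partial j (\<Psi> t) (P j t)"
    and partial2: "t \<ge> T \<Longrightarrow> j \<in> Basis \<Longrightarrow> k \<in> Basis \<Longrightarrow> has_partial k (P j t) (Q j k t)"
    and W_eq: "t \<ge> T \<Longrightarrow> W t = (\<Sum>j\<in>Basis. Q j j t)"
    and dom: "t \<ge> T \<Longrightarrow> in_dom f (\<Psi> t)"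
    and schroedinger: "t \<ge> T \<Longrightarrow> imul (D t) = (- (1 / (2 * t ^ 3))) *\<^sub>R W t + t ^ 3 *\<^sub>R mul f (\<Psi> t)"
begin

definition kin :: "real \<Rightarrow> real" where
  "kin t = (\<Sum>j\<in>Basis. (norm (P j t))\<^sup>2)"

definition pot :: "real \<Rightarrow> real" where
  "pot t = mul f (\<Psi> t) \<bullet> \<Psi> t"

text \<open>By the equation this is the expectation of the Hamiltonian. Written with
  \<open>D\<close> it is controlled by the norm of \<open>D\<close>, which is continuous in
  time.\<close>

definition energy :: "real \<Rightarrow> real" where
  "energy t = \<Psi> t \<bullet> imul (D t)"

lemma inner_W:
  assumes t: "t \<ge> T" and V: "\<And>j. j \<in> Basis \<Longrightarrow> has_partial j V (V' j)"
  shows "V \<bullet> W t = - (\<Sum>j\<in>Basis. P j t \<bullet> V' j)"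
proof -
  have "V \<bullet> Q j j t = - (P j t \<bullet> V' j)" if "j \<in> Basis" for j
    using has_partial_inner[OF partial2[OF t that that] V[OF that]] by (simp add: inner_commute)
  then show ?thesis
    using t by (simp add: W_eq inner_sum_right sum_negf)
qed

lemma Psi_limit: "t \<ge> T \<Longrightarrow> (\<Psi> \<longlongrightarrow> \<Psi> t) (at t within {T..})"
proof -
  assume t: "t \<ge> T"
  have "((\<lambda>s. (s - t) *\<^sub>R ((\<Psi> s - \<Psi> t) /\<^sub>R (s - t)) + \<Psi> t) \<longlongrightarrow> (t - t) *\<^sub>R D t + \<Psi> t) (at t within {T..})"
    by (intro tendsto_intros derivative t)
  then have "((\<lambda>s. (s - t) *\<^sub>R ((\<Psi> s - \<Psi> t) /\<^sub>R (s - t)) + \<Psi> t) \<longlongrightarrow> \<Psi> t) (at t within {T..})"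
    by simp
  then show ?thesis
    by (rule Lim_transform_eventually) (simp add: eventually_at_filter)
qed

lemma D_limit: "t \<ge> T \<Longrightarrow> (D \<longlongrightarrow> D t) (at t within {T..})"
  using D_continuous by (simp add: continuous_on_def)

lemma energy_eq:
  assumes t: "t \<ge> T"
  shows "energy t = kin t / (2 * t ^ 3) + t ^ 3 * pot t"
proof -
  have "\<Psi> t \<bullet> W t = - kin t"
    using inner_W[OF t partial1[OF t]] by (simp add: kin_def power2_norm_eq_inner)
  then show ?thesis
    using t by (simp add: energy_def schroedinger inner_diff_right inner_add_right pot_def inner_commute)
qed

lemma pot_ge:
  assumes t: "t \<ge> T"
  shows "f x0 \<le> pot t"
proof -
  have "f x0 = mul (\<lambda>_. f x0) (\<Psi> t) \<bullet> \<Psi> t"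
    using norm_Psi[OF t] by (simp add: mul_const dot_square_norm)
  also have "\<dots> \<le> pot t"
    unfolding pot_def by (intro inner_mul_mono mul_const dom t min)
  finally show ?thesis .
qed

text \<open>The state at time t lies in the domain of H(s) for every s, since that domain does not
  vary with time. Symmetry of H(s) then writes the increment of the energy with quotients of the
  state and of the coefficients of H only; \<open>D\<close> itself is merely continuous.\<close>

lemma energy_derivative:
  assumes t: "t \<ge> T"
  shows "(energy has_real_derivative (- (3 / (2 * t ^ 4)) * kin t + 3 * t\<^sup>2 * pot t)) (at t within {T..})"
proof -
  have t0: "t > 0"
    using t T_pos by linarith
  define q where "q s = (\<Psi> s - \<Psi> t) /\<^sub>R (s - t)" for s
  \<comment> \<open>Difference quotients of the coefficients -1 / (2 t^3) and t^3 of the Laplacian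
    and of the potential.\<close>
  define c1 c2 where "c1 s = (- (1 / (2 * s ^ 3)) - - (1 / (2 * t ^ 3))) / (s - t)"
    and "c2 s = (s ^ 3 - t ^ 3) / (s - t)" for s :: real
  have "((\<lambda>s. - (1 / (2 * s ^ 3))) has_real_derivative 3 / (2 * t ^ 4)) (at t within {T..})"
    using t0 by (auto intro!: derivative_eq_intros simp: field_simps power2_eq_square eval_nat_numeral)
  then have c1: "(c1 \<longlongrightarrow> 3 / (2 * t ^ 4)) (at t within {T..})"
    unfolding has_field_derivative_iff c1_def[abs_def] .
  have "((\<lambda>s. s ^ 3) has_real_derivative 3 * t\<^sup>2) (at t within {T..})"
    by (auto intro!: derivative_eq_intros)
  then have c2: "(c2 \<longlongrightarrow> 3 * t\<^sup>2) (at t within {T..})"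
    unfolding has_field_derivative_iff c2_def[abs_def] .
  have L: "((\<lambda>s. \<Psi> s \<bullet> (c1 s *\<^sub>R W t + c2 s *\<^sub>R mul f (\<Psi> t)) + q s \<bullet> imul (D t) + imul (D s) \<bullet> q s) \<longlongrightarrow>
      \<Psi> t \<bullet> ((3 / (2 * t ^ 4)) *\<^sub>R W t + (3 * t\<^sup>2) *\<^sub>R mul f (\<Psi> t)) + D t \<bullet> imul (D t) + imul (D t) \<bullet> D t)
      (at t within {T..})"
    unfolding q_def
    by (intro tendsto_intros derivative[OF t] Psi_limit[OF t] c1 c2
        bounded_linear.tendsto[OF bounded_linear_imul] D_limit[OF t])
  \<comment> \<open>The two terms with \<open>D\<close> drop out because \<open>imul\<close> is
    skew; what remains is the expectation of the explicit time derivative of the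
    Hamiltonian.\<close>
  have E: "\<Psi> t \<bullet> ((3 / (2 * t ^ 4)) *\<^sub>R W t + (3 * t\<^sup>2) *\<^sub>R mul f (\<Psi> t)) + D t \<bullet> imul (D t) + imul (D t) \<bullet> D t
      = - (3 / (2 * t ^ 4)) * kin t + 3 * t\<^sup>2 * pot t"
    using inner_W[OF t partial1[OF t]]
    by (simp add: inner_add_right kin_def power2_norm_eq_inner pot_def inner_commute[of "mul f (\<Psi> t)"])
  have Ev: "eventually (\<lambda>s. \<Psi> s \<bullet> (c1 s *\<^sub>R W t + c2 s *\<^sub>R mul f (\<Psi> t)) + q s \<bullet> imul (D t) + imul (D s) \<bullet> q s
      = (energy s - energy t) / (s - t)) (at t within {T..})"
    unfolding eventually_at_filter
  proof (intro always_eventually allI impI)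
    fix s assume s: "s \<noteq> t" "s \<in> {T..}"
    \<comment> \<open>The operator H(s) applied to the state at time t.\<close>
    define K where "K = (- (1 / (2 * s ^ 3))) *\<^sub>R W t + s ^ 3 *\<^sub>R mul f (\<Psi> t)"
    have sT: "s \<ge> T"
      using s by simp
    have "\<Psi> s \<bullet> W t = \<Psi> t \<bullet> W s"
      using inner_W[OF t partial1[OF sT]] inner_W[OF sT partial1[OF t]] by (simp add: inner_commute)
    then have K: "\<Psi> s \<bullet> K = imul (D s) \<bullet> \<Psi> t"
      using inner_mul_commute[OF dom[OF t] dom[OF sT]]
      by (simp add: K_def schroedinger[OF sT] inner_add_right inner_diff_right inner_diff_left inner_commute)
    have "c1 s *\<^sub>R W t + c2 s *\<^sub>R mul f (\<Psi> t) = (K - imul (D t)) /\<^sub>R (s - t)"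
    proof -
      have "((A - B) / d) *\<^sub>R w + ((A' - B') / d) *\<^sub>R g =
          (A *\<^sub>R w + A' *\<^sub>R g - (B *\<^sub>R w + B' *\<^sub>R g)) /\<^sub>R d" for A B A' B' d :: real and w g :: "'a l2"
        by (simp add: scaleR_right_diff_distrib scaleR_right_distrib scaleR_left_diff_distrib
            left_diff_distrib right_diff_distrib divide_inverse mult.commute)
      then show ?thesis
        unfolding c1_def c2_def K_def schroedinger[OF t] .
    qed
    then have "\<Psi> s \<bullet> (c1 s *\<^sub>R W t + c2 s *\<^sub>R mul f (\<Psi> t)) + q s \<bullet> imul (D t) + imul (D s) \<bullet> q s =
        inverse (s - t) * (\<Psi> s \<bullet> (K - imul (D t)) + (\<Psi> s - \<Psi> t) \<bullet> imul (D t) + imul (D s) \<bullet> (\<Psi> s - \<Psi> t))"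
      by (simp add: q_def distrib_left)
    also have "\<Psi> s \<bullet> (K - imul (D t)) + (\<Psi> s - \<Psi> t) \<bullet> imul (D t) + imul (D s) \<bullet> (\<Psi> s - \<Psi> t) = energy s - energy t"
      unfolding inner_diff_left inner_diff_right K energy_def by (simp add: inner_commute)
    finally show "\<Psi> s \<bullet> (c1 s *\<^sub>R W t + c2 s *\<^sub>R mul f (\<Psi> t)) + q s \<bullet> imul (D t) + imul (D s) \<bullet> q s
        = (energy s - energy t) / (s - t)"
      by (simp add: divide_inverse mult.commute)
  qed
  show ?thesis
    unfolding has_field_derivative_iff by (rule Lim_transform_eventually[OF L[unfolded E] Ev])
qed

text \<open>The energy is at most the norm of \<open>D\<close>, which is bounded on compact time
  intervals, and the potential part is bounded below by \<open>f x0\<close>; the rest is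
  kinetic.\<close>

lemma kin_bounded: "\<exists>K\<ge>0. \<forall>s. T \<le> s \<and> s \<le> t \<longrightarrow> kin s \<le> K"
proof -
  have "compact (D ` {T..t})"
    using D_continuous by (intro compact_continuous_image) (auto intro: continuous_on_subset)
  then obtain B where B: "\<And>s. T \<le> s \<Longrightarrow> s \<le> t \<Longrightarrow> norm (D s) \<le> B"
    using compact_imp_bounded[of "D ` {T..t}"] unfolding bounded_iff by (metis atLeastAtMost_iff imageI)
  have "kin s \<le> 2 * t ^ 3 * (\<bar>B\<bar> + t ^ 3 * \<bar>f x0\<bar>)" if s: "T \<le> s" "s \<le> t" for s
  proof -
    have s0: "s > 0"
      using s T_pos by linarith
    have st: "s ^ 3 \<le> t ^ 3"
      using s s0 by (intro power_mono) auto
    have "energy s \<le> norm (\<Psi> s) * norm (imul (D s))"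
      unfolding energy_def by (rule norm_cauchy_schwarz)
    also have "\<dots> = norm (D s)"
      using norm_Psi[OF s(1)] by (simp add: norm_eq_sqrt_inner)
    finally have "energy s \<le> \<bar>B\<bar>"
      using B[OF s] by linarith
    moreover have "s ^ 3 * (- \<bar>f x0\<bar>) \<le> s ^ 3 * pot s"
      using pot_ge[OF s(1)] s0 by (intro mult_left_mono) auto
    moreover have "s ^ 3 * \<bar>f x0\<bar> \<le> t ^ 3 * \<bar>f x0\<bar>"
      using st by (intro mult_right_mono) auto
    ultimately have "kin s / (2 * s ^ 3) \<le> \<bar>B\<bar> + t ^ 3 * \<bar>f x0\<bar>"
      using energy_eq[OF s(1)] by simp
    then have "kin s \<le> (\<bar>B\<bar> + t ^ 3 * \<bar>f x0\<bar>) * (2 * s ^ 3)"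
      using s0 by (simp add: pos_divide_le_eq)
    also have "\<dots> \<le> (\<bar>B\<bar> + t ^ 3 * \<bar>f x0\<bar>) * (2 * t ^ 3)"
      using st s s0 by (intro mult_left_mono add_nonneg_nonneg mult_nonneg_nonneg) auto
    finally show ?thesis
      by (simp add: mult.commute mult.left_commute)
  qed
  then have *: "\<forall>s. T \<le> s \<and> s \<le> t \<longrightarrow> kin s \<le> max 0 (2 * t ^ 3 * (\<bar>B\<bar> + t ^ 3 * \<bar>f x0\<bar>))"
    by (simp add: le_max_iff_disj)
  show ?thesis
    by (rule exI[of _ "max 0 (2 * t ^ 3 * (\<bar>B\<bar> + t ^ 3 * \<bar>f x0\<bar>))"]) (use * in simp)
qed

lemma norm_P_le: "j \<in> Basis \<Longrightarrow> (norm (P j t))\<^sup>2 \<le> kin t"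
  unfolding kin_def by (rule member_le_sum) auto

section \<open>Regularised position and dilation observables\<close>

definition M0 :: "real \<Rightarrow> 'a \<Rightarrow> 'a l2 \<Rightarrow> 'a l2" where
  "M0 R j = mul (\<lambda>x. wt0 R (crd j x))"
definition M1 :: "real \<Rightarrow> 'a \<Rightarrow> 'a l2 \<Rightarrow> 'a l2" where
  "M1 R j = mul (\<lambda>x. wt1 R (crd j x))"
definition M2 :: "real \<Rightarrow> 'a \<Rightarrow> 'a l2 \<Rightarrow> 'a l2" where
  "M2 R j = mul (\<lambda>x. wt2 R (crd j x))"
definition M3 :: "real \<Rightarrow> 'a \<Rightarrow> 'a l2 \<Rightarrow> 'a l2" where
  "M3 R j = mul (\<lambda>x. wt3 R (crd j x))"

lemma wt_comp_measurable:
  assumes "R > 0"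
  shows "(\<lambda>x. wt0 R (crd j x)) \<in> borel_measurable borel"
    "(\<lambda>x. wt1 R (crd j x)) \<in> borel_measurable borel"
    "(\<lambda>x. wt2 R (crd j x)) \<in> borel_measurable borel"
    "(\<lambda>x. wt3 R (crd j x)) \<in> borel_measurable borel"
  using wt_measurable(1-3)[OF assms] wt_measurable(4) by measurable

lemma wt_dom:
  assumes "R > 0"
  shows "in_dom (\<lambda>x. wt0 R (crd j x)) U" "in_dom (\<lambda>x. wt1 R (crd j x)) U"
    "in_dom (\<lambda>x. wt2 R (crd j x)) U" "in_dom (\<lambda>x. wt3 R (crd j x)) U"
proof -
  have "\<bar>wt0 R s\<bar> \<le> R\<^sup>2" for s
    using wt_bounds(1,3)[OF assms, of s] by simp
  then show "in_dom (\<lambda>x. wt0 R (crd j x)) U"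
    using in_dom_bounded[OF wt_comp_measurable(1)[OF assms]] by blast
  show "in_dom (\<lambda>x. wt1 R (crd j x)) U" "in_dom (\<lambda>x. wt2 R (crd j x)) U"
    "in_dom (\<lambda>x. wt3 R (crd j x)) U"
    using in_dom_bounded[OF wt_comp_measurable(2)[OF assms] wt_bounds(4)[OF assms]]
      in_dom_bounded[OF wt_comp_measurable(3)[OF assms] wt_bounds(8)[OF assms]]
      in_dom_bounded[OF wt_comp_measurable(4)[OF assms] wt_bounds(9)[OF assms]] by blast+
qed

lemma M_commute:
  assumes "R > 0"
  shows "M0 R j U \<bullet> V = U \<bullet> M0 R j V" "M1 R j U \<bullet> V = U \<bullet> M1 R j V"
    "M2 R j U \<bullet> V = U \<bullet> M2 R j V" "M3 R j U \<bullet> V = U \<bullet> M3 R j V"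
  unfolding M0_def M1_def M2_def M3_def using wt_dom[OF assms] by (auto intro!: inner_mul_commute)

lemma M_imul:
  assumes "R > 0"
  shows "M0 R j (imul U) = imul (M0 R j U)" "M1 R j (imul U) = imul (M1 R j U)"
    "M2 R j (imul U) = imul (M2 R j U)"
  unfolding M0_def M1_def M2_def using wt_dom[OF assms] by (auto intro!: mul_imul)

lemma M_bounded_linear:
  assumes "R > 0"
  shows "bounded_linear (M0 R j)" "bounded_linear (M1 R j)" "bounded_linear (M2 R j)"
  unfolding M0_def M1_def M2_def
  using multiplier_bounded_linear(1)[OF multiplier_wt(1)[OF assms]]
    multiplier_bounded_linear(1)[OF multiplier_wt(2)[OF assms]]
    multiplier_bounded_linear(1)[OF multiplier_wt(3)[OF assms]] by blast+

lemma M_has_partial: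
  assumes R: "R > 0" and U: "has_partial k U U'"
  shows "has_partial k (M0 R j U) (M0 R j U' + (k \<bullet> j) *\<^sub>R M1 R j U)"
    "has_partial k (M1 R j U) (M1 R j U' + (k \<bullet> j) *\<^sub>R M2 R j U)"
    "has_partial k (M2 R j U) (M2 R j U' + (k \<bullet> j) *\<^sub>R M3 R j U)"
  using has_partial_mul[OF multiplier_wt(1)[OF R] U, of x0 j] has_partial_mul[OF multiplier_wt(2)[OF R] U, of x0 j]
    has_partial_mul[OF multiplier_wt(3)[OF R] U, of x0 j]
  by (simp_all add: M0_def M1_def M2_def M3_def mul_scale_fun wt_dom[OF R])

lemma M_norms:
  assumes R: "R > 0"
  shows "norm (M1 R j U) \<le> R * norm U" "norm (M2 R j U) \<le> 3 * norm U" "norm (M3 R j U) \<le> 6 / R * norm U"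
    "M2 R j U \<bullet> U \<le> (norm U)\<^sup>2" "(norm (M1 R j U))\<^sup>2 \<le> 2 * (M0 R j U \<bullet> U)"
proof -
  show "norm (M1 R j U) \<le> R * norm U" "norm (M2 R j U) \<le> 3 * norm U" "norm (M3 R j U) \<le> 6 / R * norm U"
    unfolding M1_def M2_def M3_def
    by (intro norm_mul_le wt_comp_measurable wt_bounds R)+
  have "M2 R j U \<bullet> U \<le> mul (\<lambda>_. 1) U \<bullet> U"
    unfolding M2_def by (intro inner_mul_mono wt_dom mul_const wt_bounds R)
  then show "M2 R j U \<bullet> U \<le> (norm U)\<^sup>2"
    by (simp add: mul_const power2_norm_eq_inner)
  have "(norm (M1 R j U))\<^sup>2 = M1 R j (M1 R j U) \<bullet> U"
    by (simp add: power2_norm_eq_inner M_commute[OF R])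
  also have "\<dots> \<le> mul (\<lambda>x. 2 * wt0 R (crd j x)) U \<bullet> U"
    unfolding M1_def mul_mul(2)[OF wt_dom(2)[OF R] wt_dom(2)[OF R], symmetric]
    using wt_bounds(6)[OF R]
    by (intro inner_mul_mono mul_mul wt_dom mul_scale_fun R) (simp add: power2_eq_square)
  also have "\<dots> = 2 * (M0 R j U \<bullet> U)"
    unfolding M0_def by (simp add: mul_scale_fun wt_dom[OF R])
  finally show "(norm (M1 R j U))\<^sup>2 \<le> 2 * (M0 R j U \<bullet> U)" .
qed

definition pos2 :: "real \<Rightarrow> 'a \<Rightarrow> real \<Rightarrow> real" where
  "pos2 R j t = M0 R j (\<Psi> t) \<bullet> \<Psi> t"

text \<open>With p_j = -i d_j this is the real part of the pairing of
  \<open>M1 R j (\<Psi> t)\<close> with p_j applied to the state, a regularisation of the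
  expectation of (y_j p_j + p_j y_j) / 2.\<close>

definition dil :: "real \<Rightarrow> 'a \<Rightarrow> real \<Rightarrow> real" where
  "dil R j t = - (M1 R j (\<Psi> t) \<bullet> imul (P j t))"

text \<open>The weight is bounded and symmetric, so strong differentiability of the state suffices.
  The potential commutes with it and contributes 0; in the Laplacian term only the gradient of the
  weight, which points along \<open>j\<close>, survives.\<close>

lemma pos2_derivative:
  assumes t: "t \<ge> T" and j: "j \<in> Basis" and R: "R > 0"
  shows "(pos2 R j has_real_derivative dil R j t / t ^ 3) (at t within {T..})"
proof -
  define q where "q s = (\<Psi> s - \<Psi> t) /\<^sub>R (s - t)" for s
  have lim: "((\<lambda>s. q s \<bullet> M0 R j (\<Psi> s) + q s \<bullet> M0 R j (\<Psi> t)) \<longlongrightarrow>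
      D t \<bullet> M0 R j (\<Psi> t) + D t \<bullet> M0 R j (\<Psi> t)) (at t within {T..})"
    unfolding q_def by (intro tendsto_intros derivative[OF t] Psi_limit[OF t]
        bounded_linear.tendsto[OF M_bounded_linear(1)[OF R]])
  have "(pos2 R j s - pos2 R j t) / (s - t) = q s \<bullet> M0 R j (\<Psi> s) + q s \<bullet> M0 R j (\<Psi> t)" for s
  proof -
    have "q s \<bullet> M0 R j (\<Psi> s) + q s \<bullet> M0 R j (\<Psi> t) =
        inverse (s - t) * ((\<Psi> s - \<Psi> t) \<bullet> M0 R j (\<Psi> s) + (\<Psi> s - \<Psi> t) \<bullet> M0 R j (\<Psi> t))"
      by (simp add: q_def distrib_left)
    also have "(\<Psi> s - \<Psi> t) \<bullet> M0 R j (\<Psi> s) + (\<Psi> s - \<Psi> t) \<bullet> M0 R j (\<Psi> t) = pos2 R j s - pos2 R j t"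
      using M_commute(1)[OF R, of j "\<Psi> s" "\<Psi> t"]
      by (simp add: pos2_def inner_diff_left inner_commute)
    finally show ?thesis
      by (simp add: divide_inverse mult.commute)
  qed
  with lim have "(pos2 R j has_real_derivative 2 * (D t \<bullet> M0 R j (\<Psi> t))) (at t within {T..})"
    by (simp add: has_field_derivative_iff)
  moreover have "2 * (D t \<bullet> M0 R j (\<Psi> t)) = dil R j t / t ^ 3"
  proof -
    have "D t \<bullet> M0 R j (\<Psi> t) = imul (M0 R j (\<Psi> t)) \<bullet> imul (D t)"
      by (simp add: inner_commute)
    also have "\<dots> = - (1 / (2 * t ^ 3)) * (imul (M0 R j (\<Psi> t)) \<bullet> W t) + t ^ 3 * (imul (M0 R j (\<Psi> t)) \<bullet> mul f (\<Psi> t))"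
      by (simp add: schroedinger[OF t] inner_diff_right inner_add_right)
    also have "imul (M0 R j (\<Psi> t)) \<bullet> mul f (\<Psi> t) = 0"
      using inner_mul_imul_mul[OF dom[OF t] wt_dom(1)[OF R]] by (simp add: M0_def inner_commute)
    also have "imul (M0 R j (\<Psi> t)) \<bullet> W t =
        - (\<Sum>k\<in>Basis. P k t \<bullet> imul (M0 R j (P k t) + (k \<bullet> j) *\<^sub>R M1 R j (\<Psi> t)))"
      by (intro inner_W[OF t] has_partial_imul M_has_partial R partial1[OF t])
    also have "(\<Sum>k\<in>Basis. P k t \<bullet> imul (M0 R j (P k t) + (k \<bullet> j) *\<^sub>R M1 R j (\<Psi> t))) =
        (\<Sum>k\<in>Basis. if k = j then P j t \<bullet> imul (M1 R j (\<Psi> t)) else 0)"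
    proof (rule sum.cong)
      fix k :: 'a assume k: "k \<in> Basis"
      have "P k t \<bullet> imul (M0 R j (P k t)) = 0"
        using inner_mul_imul_mul[OF mul_const(1)[of 1] wt_dom(1)[OF R], of "P k t"]
        by (simp add: M0_def mul_const)
      then show "P k t \<bullet> imul (M0 R j (P k t) + (k \<bullet> j) *\<^sub>R M1 R j (\<Psi> t)) =
          (if k = j then P j t \<bullet> imul (M1 R j (\<Psi> t)) else 0)"
        using j k by (simp add: imul_add imul_scaleR inner_add_right inner_Basis)
    qed simp
    also have "\<dots> = dil R j t"
      using j by (simp add: dil_def inner_commute[of "P j t"] inner_imul_left)
    finally show ?thesis
      by simp
  qed
  ultimately show ?thesis
    by simp
qed

text \<open>The symmetric operator whose expectation is \<open>dil\<close> is \<open>- \<i> G\<close> with the skew-symmetric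
  \<open>G u = wt1 \<partial>\<^sub>j u + wt2 u / 2\<close>.\<close>

definition gen :: "real \<Rightarrow> 'a \<Rightarrow> 'a l2 \<Rightarrow> 'a l2 \<Rightarrow> 'a l2" where
  "gen R j U U' = M1 R j U' + (1 / 2) *\<^sub>R M2 R j U"

lemma gen_skew:
  assumes R: "R > 0" and j: "j \<in> Basis" and U: "has_partial j U U'" and V: "has_partial j V V'"
  shows "gen R j U U' \<bullet> V = - (U \<bullet> gen R j V V')"
proof -
  have "U' \<bullet> M1 R j V = - (U \<bullet> (M1 R j V' + M2 R j V))"
    using has_partial_inner[OF U M_has_partial(2)[OF R V, of j]] j by (simp add: inner_Basis)
  then show ?thesis
    by (simp add: gen_def inner_add_left inner_add_right M_commute[OF R])
qed

lemma gen_imul: "R > 0 \<Longrightarrow> gen R j (imul U) (imul U') = imul (gen R j U U')"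
  by (simp add: gen_def M_imul imul_add imul_scaleR)

lemma gen_skew_imul:
  assumes R: "R > 0" and j: "j \<in> Basis" and U: "has_partial j U U'" and V: "has_partial j V V'"
  shows "V \<bullet> imul (gen R j U U') = U \<bullet> imul (gen R j V V')"
  using gen_skew[OF R j U has_partial_imul[OF V]]
  by (simp add: gen_imul[OF R] inner_imul_left inner_commute)

text \<open>The half of \<open>M2\<close> that makes the generator skew is a real multiplier, so i
  times it has expectation with real part 0.\<close>

lemma dil_gen:
  assumes R: "R > 0"
  shows "dil R j t = - (\<Psi> t \<bullet> imul (gen R j (\<Psi> t) (P j t)))"
proof -
  have "\<Psi> t \<bullet> imul (M2 R j (\<Psi> t)) = 0"
    using inner_mul_imul_mul[OF mul_const(1)[of 1] wt_dom(3)[OF R], of "\<Psi> t"] by (simp add: M2_def mul_const)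
  then show ?thesis
    by (simp add: dil_def gen_def imul_add imul_scaleR inner_add_right M_commute(2)[OF R] M_imul(2)[OF R])
qed

text \<open>Weak continuity in time of a first-order operator on the state: on test elements
  skew-symmetry leaves only the norm-continuous state, and local boundedness of \<open>kin\<close>
  extends this to all \<open>U\<close>.\<close>

lemma gen_limit:
  assumes t: "t \<ge> T" and j: "j \<in> Basis" and R: "R > 0"
  shows "((\<lambda>s. U \<bullet> imul (gen R j (\<Psi> s) (P j s))) \<longlongrightarrow> U \<bullet> imul (gen R j (\<Psi> t) (P j t))) (at t within {T..})"
    and "\<exists>B. eventually (\<lambda>s. norm (imul (gen R j (\<Psi> s) (P j s))) \<le> B) (at t within {T..})"
proof -
  obtain K where K: "K \<ge> 0" "\<And>s. T \<le> s \<Longrightarrow> s \<le> t + 1 \<Longrightarrow> kin s \<le> K"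
    using kin_bounded[of "t + 1"] by blast
  define B where "B = R * sqrt K + (1 / 2) * 3"
  have ev: "eventually (\<lambda>s. T \<le> s \<and> s \<le> t + 1) (at t within {T..})"
    unfolding eventually_at_le by (intro exI[of _ 1]) (auto simp: dist_real_def)
  then have bd: "eventually (\<lambda>s. norm (imul (gen R j (\<Psi> s) (P j s))) \<le> B) (at t within {T..})"
  proof eventually_elim
    case (elim s)
    have "(norm (P j s))\<^sup>2 \<le> K"
      using norm_P_le[OF j, of s] K(2)[of s] elim by linarith
    then have Ps: "norm (P j s) \<le> sqrt K"
      by (rule real_le_rsqrt)
    have "norm (gen R j (\<Psi> s) (P j s)) \<le> norm (M1 R j (P j s)) + (1 / 2) * norm (M2 R j (\<Psi> s))"
      unfolding gen_def using norm_triangle_ineq[of "M1 R j (P j s)" "(1 / 2) *\<^sub>R M2 R j (\<Psi> s)"] by simp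
    also have "\<dots> \<le> R * norm (P j s) + (1 / 2) * (3 * norm (\<Psi> s))"
      by (intro add_mono mult_left_mono M_norms R) auto
    also have "\<dots> \<le> B"
      unfolding B_def using Ps R norm_Psi[of s] elim by (intro add_mono mult_left_mono) auto
    finally show ?case
      by (simp add: norm_eq_sqrt_inner)
  qed
  then show "\<exists>B. eventually (\<lambda>s. norm (imul (gen R j (\<Psi> s) (P j s))) \<le> B) (at t within {T..})"
    by blast
  show "((\<lambda>s. U \<bullet> imul (gen R j (\<Psi> s) (P j s))) \<longlongrightarrow> U \<bullet> imul (gen R j (\<Psi> t) (P j t))) (at t within {T..})"
  proof (rule tendsto_inner_dense[OF bd])
    fix V :: "'a l2" assume "V \<in> test_l2"
    then obtain V' where V: "has_partial j V V'"
      using test_l2_has_partial by blast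
    have eq: "V \<bullet> imul (gen R j (\<Psi> s) (P j s)) = \<Psi> s \<bullet> imul (gen R j V V')" if "s \<ge> T" for s
      by (rule gen_skew_imul[OF R j partial1[OF that j] V])
    have "((\<lambda>s. \<Psi> s \<bullet> imul (gen R j V V')) \<longlongrightarrow> \<Psi> t \<bullet> imul (gen R j V V')) (at t within {T..})"
      by (intro tendsto_intros Psi_limit[OF t])
    then have "((\<lambda>s. V \<bullet> imul (gen R j (\<Psi> s) (P j s))) \<longlongrightarrow> \<Psi> t \<bullet> imul (gen R j V V')) (at t within {T..})"
      by (rule Lim_transform_eventually) (simp add: eventually_at_filter eq)
    then show "((\<lambda>s. V \<bullet> imul (gen R j (\<Psi> s) (P j s))) \<longlongrightarrow> V \<bullet> imul (gen R j (\<Psi> t) (P j t))) (at t within {T..})"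
      by (simp add: eq[OF t])
  qed
qed

text \<open>Green's formula distributes the Laplacian over the directions k. For each k the second
  derivatives cancel against half of \<open>M2\<close>; what survives at k = j is the commutator,
  with \<open>wt2\<close> and \<open>wt3\<close>.\<close>

lemma inner_W_gen:
  assumes t: "t \<ge> T" and j: "j \<in> Basis" and R: "R > 0"
  shows "gen R j (\<Psi> t) (P j t) \<bullet> W t = - (P j t \<bullet> M2 R j (P j t) + (1 / 2) * (P j t \<bullet> M3 R j (\<Psi> t)))"
proof -
  define G' where "G' k = (M1 R j (Q j k t) + (k \<bullet> j) *\<^sub>R M2 R j (P j t)) +
      (1 / 2) *\<^sub>R (M2 R j (P k t) + (k \<bullet> j) *\<^sub>R M3 R j (\<Psi> t))" for k
  have "gen R j (\<Psi> t) (P j t) \<bullet> W t = - (\<Sum>k\<in>Basis. P k t \<bullet> G' k)"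
    unfolding gen_def G'_def
    by (intro inner_W[OF t] has_partial_add has_partial_scaleR M_has_partial R partial1[OF t] partial2[OF t] j)
  also have "(\<Sum>k\<in>Basis. P k t \<bullet> G' k) = (\<Sum>k\<in>Basis. if k = j then
      P j t \<bullet> M2 R j (P j t) + (1 / 2) * (P j t \<bullet> M3 R j (\<Psi> t)) else 0)"
  proof (rule sum.cong)
    fix k :: 'a assume k: "k \<in> Basis"
    \<comment> \<open>Read as the derivative of \<open>P k\<close> along \<open>j\<close>, the
      second derivative can be integrated by parts against \<open>P k\<close>, which produces
      exactly the term to be cancelled.\<close>
    have Q: "Q j k t = Q k j t"
      by (rule has_partial_commute[OF partial1[OF t j] partial1[OF t k] partial2[OF t j k] partial2[OF t k j]])
    have "2 * (P k t \<bullet> M1 R j (Q j k t)) = - (P k t \<bullet> M2 R j (P k t))"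
      using inner_mul_partial_self[OF multiplier_wt(2)[OF R] partial2[OF t k j], of x0 j] j
      by (simp add: Q M1_def M2_def inner_Basis)
    then have PQ: "P k t \<bullet> M1 R j (Q j k t) = - (P k t \<bullet> M2 R j (P k t)) / 2"
      by simp
    then show "P k t \<bullet> G' k = (if k = j then
        P j t \<bullet> M2 R j (P j t) + (1 / 2) * (P j t \<bullet> M3 R j (\<Psi> t)) else 0)"
      using j k by (cases "k = j") (simp_all add: G'_def inner_add_right PQ inner_Basis add_divide_distrib)
  qed simp
  also have "\<dots> = P j t \<bullet> M2 R j (P j t) + (1 / 2) * (P j t \<bullet> M3 R j (\<Psi> t))"
    using j by simp
  finally show ?thesis .
qed

text \<open>The regularised expectation of y_j d_j f, with the right derivative of
  \<open>f\<close>.\<close>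

definition force :: "real \<Rightarrow> 'a \<Rightarrow> real \<Rightarrow> real" where
  "force R j t = mul (rderiv j) (M1 R j (\<Psi> t)) \<bullet> \<Psi> t"

text \<open>Because the generator times i is symmetric, the increment of \<open>dil\<close> pairs
  the increment of the state with \<open>G s\<close> and \<open>G t\<close>; no increment of
  \<open>P\<close> appears.\<close>

lemma dil_derivative:
  assumes t: "t \<ge> T" and j: "j \<in> Basis" and R: "R > 0"
  shows "(dil R j has_real_derivative
    (P j t \<bullet> M2 R j (P j t) + (1 / 2) * (P j t \<bullet> M3 R j (\<Psi> t))) / t ^ 3 - t ^ 3 * force R j t) (at t within {T..})"
proof -
  define q where "q s = (\<Psi> s - \<Psi> t) /\<^sub>R (s - t)" for s
  define G where "G s = gen R j (\<Psi> s) (P j s)" for s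
  obtain B where B: "eventually (\<lambda>s. norm (imul (G s)) \<le> B) (at t within {T..})"
    using gen_limit(2)[OF t j R] unfolding G_def by blast
  have q: "(q \<longlongrightarrow> D t) (at t within {T..})"
    unfolding q_def by (rule derivative[OF t])
  \<comment> \<open>Strong convergence of the quotient \<open>q\<close> meets only weak convergence
    of \<open>G\<close>; the local bound \<open>B\<close> makes this product vanish.\<close>
  have "((\<lambda>s. (q s - D t) \<bullet> imul (G s)) \<longlongrightarrow> 0) (at t within {T..})"
  proof (rule Lim_null_comparison)
    have "((\<lambda>s. norm (q s - D t)) \<longlongrightarrow> 0) (at t within {T..})"
      using q by (simp add: tendsto_norm_zero_iff LIM_zero_iff)
    then show "((\<lambda>s. norm (q s - D t) * B) \<longlongrightarrow> 0) (at t within {T..})"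
      by (rule tendsto_mult_left_zero)
    show "eventually (\<lambda>s. norm ((q s - D t) \<bullet> imul (G s)) \<le> norm (q s - D t) * B) (at t within {T..})"
      using B
    proof eventually_elim
      case (elim s)
      have "norm ((q s - D t) \<bullet> imul (G s)) \<le> norm (q s - D t) * norm (imul (G s))"
        using Cauchy_Schwarz_ineq2[of "q s - D t" "imul (G s)"] by simp
      also have "\<dots> \<le> norm (q s - D t) * B"
        using elim by (intro mult_left_mono) auto
      finally show ?case .
    qed
  qed
  from tendsto_add[OF this gen_limit(1)[OF t j R, of "D t"]]
  have "((\<lambda>s. q s \<bullet> imul (G s)) \<longlongrightarrow> D t \<bullet> imul (G t)) (at t within {T..})"
    by (simp add: G_def inner_diff_left)
  note tendsto_minus[OF tendsto_add[OF this tendsto_inner[OF q tendsto_const]]]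
  from this[of "imul (G t)"] have lim: "((\<lambda>s. - (q s \<bullet> imul (G s) + q s \<bullet> imul (G t))) \<longlongrightarrow> - (D t \<bullet> imul (G t) + D t \<bullet> imul (G t)))
      (at t within {T..})" .
  have "- (q s \<bullet> imul (G s) + q s \<bullet> imul (G t)) = (dil R j s - dil R j t) / (s - t)" if s: "s \<ge> T" for s
  proof -
    have "\<Psi> t \<bullet> imul (G s) = \<Psi> s \<bullet> imul (G t)"
      unfolding G_def by (rule gen_skew_imul[OF R j partial1[OF s j] partial1[OF t j]])
    then have "- ((\<Psi> s - \<Psi> t) \<bullet> imul (G s) + (\<Psi> s - \<Psi> t) \<bullet> imul (G t)) = dil R j s - dil R j t"
      by (simp add: dil_gen[OF R] G_def inner_diff_left)
    then have "(dil R j s - dil R j t) / (s - t) =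
        inverse (s - t) * (- ((\<Psi> s - \<Psi> t) \<bullet> imul (G s) + (\<Psi> s - \<Psi> t) \<bullet> imul (G t)))"
      by (simp add: divide_inverse mult.commute)
    also have "\<dots> = - (q s \<bullet> imul (G s) + q s \<bullet> imul (G t))"
      by (simp add: q_def right_diff_distrib)
    finally show ?thesis ..
  qed
  then have "eventually (\<lambda>s. - (q s \<bullet> imul (G s) + q s \<bullet> imul (G t)) = (dil R j s - dil R j t) / (s - t)) (at t within {T..})"
    by (simp add: eventually_at_filter)
  from Lim_transform_eventually[OF lim this]
  have "(dil R j has_real_derivative - 2 * (D t \<bullet> imul (G t))) (at t within {T..})"
    by (simp add: has_field_derivative_iff)
  moreover have "- 2 * (D t \<bullet> imul (G t)) =
      (P j t \<bullet> M2 R j (P j t) + (1 / 2) * (P j t \<bullet> M3 R j (\<Psi> t))) / t ^ 3 - t ^ 3 * force R j t"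
  proof -
    have f: "2 * (mul f (\<Psi> t) \<bullet> G t) = - force R j t"
      using inner_rderiv(1)[OF dom[OF t] multiplier_wt(2)[OF R] partial1[OF t j], of x0 j] j
      by (simp add: G_def gen_def force_def M1_def M2_def inner_add_right inner_Basis)
    have "- 2 * (D t \<bullet> imul (G t)) = 2 * (G t \<bullet> imul (D t))"
      using inner_imul_left[of "D t" "G t"] by (simp add: inner_commute)
    also have "\<dots> = - (1 / t ^ 3) * (G t \<bullet> W t) + t ^ 3 * (2 * (mul f (\<Psi> t) \<bullet> G t))"
      by (simp add: schroedinger[OF t] inner_diff_right inner_add_right inner_commute algebra_simps)
    also have "\<dots> = (P j t \<bullet> M2 R j (P j t) + (1 / 2) * (P j t \<bullet> M3 R j (\<Psi> t))) / t ^ 3 - t ^ 3 * force R j t"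
      unfolding f using inner_W_gen[OF t j R] by (simp add: G_def add_divide_distrib diff_divide_distrib)
    finally show ?thesis .
  qed
  ultimately show ?thesis
    by simp
qed

section \<open>Second moments of the position\<close>

definition spread :: "real \<Rightarrow> real" where
  "spread t = (\<Sum>j\<in>Basis. (norm (mul (crd j) (\<Psi> t)))\<^sup>2)"

lemma M_limits:
  assumes t: "t \<ge> T" and j: "j \<in> Basis"
  shows "(\<lambda>n. M1 (real (Suc n)) j (\<Psi> t)) \<longlonglongrightarrow> mul (crd j) (\<Psi> t)"
    "(\<lambda>n. pos2 (real (Suc n)) j t) \<longlonglongrightarrow> (norm (mul (crd j) (\<Psi> t)))\<^sup>2 / 2"
proof -
  note d = in_dom_coordinate[OF dom[OF t] j]
  show "(\<lambda>n. M1 (real (Suc n)) j (\<Psi> t)) \<longlonglongrightarrow> mul (crd j) (\<Psi> t)"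
    unfolding M1_def
  proof (rule tendsto_mul_seq[OF d])
    show "(\<lambda>x. wt1 (real (Suc i)) (crd j x)) \<in> borel_measurable borel" for i
      by (rule wt_comp_measurable) simp
    show "\<bar>wt1 (real (Suc i)) (crd j x)\<bar> \<le> \<bar>crd j x\<bar>" for i x
      by (rule wt_bounds) simp
  qed (use wt1_limit in auto)
  \<comment> \<open>The square of a coordinate times the state need not be in \<open>L2\<close>.
    Since \<open>2 * wt0\<close> is the coordinate times \<open>c n\<close>, \<open>pos2\<close> is
    half the inner product of \<open>mul (c n)\<close> and \<open>mul (crd j)\<close> of the state,
    and the first factor converges in norm.\<close>
  define c where "c n x = (crd j x) * cut (real (Suc n)) (crd j x)" for n x
  have cm: "c n \<in> borel_measurable borel" for n
    unfolding c_def[abs_def] cut_def by measurable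
  have cb: "\<bar>c n x\<bar> \<le> \<bar>crd j x\<bar>" for n x
    using cut_bounds(1,2)[of "real (Suc n)" "crd j x"] by (simp add: c_def abs_mult mult_left_le)
  have cl: "(\<lambda>n. c n x) \<longlonglongrightarrow> crd j x" for x
    unfolding c_def using tendsto_mult_left[OF cut_limit, of "crd j x" "crd j x"] by simp
  have "(\<lambda>n. mul (c n) (\<Psi> t)) \<longlonglongrightarrow> mul (crd j) (\<Psi> t)"
    by (rule tendsto_mul_seq[OF d cm cb _ cl]) measurable
  then have lim: "(\<lambda>n. mul (c n) (\<Psi> t) \<bullet> mul (crd j) (\<Psi> t) / 2) \<longlonglongrightarrow>
      mul (crd j) (\<Psi> t) \<bullet> mul (crd j) (\<Psi> t) / 2"
    by (intro tendsto_intros) auto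
  have "mul (c n) (\<Psi> t) \<bullet> mul (crd j) (\<Psi> t) / 2 = pos2 (real (Suc n)) j t" for n
  proof -
    have dc: "in_dom (c n) (\<Psi> t)"
      by (rule in_dom_mono[OF d cm cb])
    have dw: "in_dom (\<lambda>x. wt0 (real (Suc n)) (crd j x)) (\<Psi> t)"
      by (rule wt_dom) simp
    obtain u where u: "u \<in> L2" "\<Psi> t = abs_l2 u"
      by (cases "\<Psi> t")
    have "mul (c n) (\<Psi> t) \<bullet> mul (crd j) (\<Psi> t) =
        (LINT x|lborel. 2 * (wt0 (real (Suc n)) (crd j x) * (u x \<bullet> u x)))"
      unfolding u(2) inner_mul_mul(2)[OF u(1) dc[unfolded u(2)] d[unfolded u(2)]]
      by (intro Bochner_Integration.integral_cong)
        (simp_all add: c_def wt0_def power2_eq_square algebra_simps)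
    also have "\<dots> = 2 * pos2 (real (Suc n)) j t"
      using u dw by (simp add: pos2_def M0_def inner_mul_abs_l2)
    finally show ?thesis
      by simp
  qed
  with lim show "(\<lambda>n. pos2 (real (Suc n)) j t) \<longlonglongrightarrow> (norm (mul (crd j) (\<Psi> t)))\<^sup>2 / 2"
    by (simp add: power2_norm_eq_inner)
qed

lemma pos2_le:
  assumes t: "t \<ge> T" and j: "j \<in> Basis" and R: "R > 0"
  shows "2 * pos2 R j t \<le> (norm (mul (crd j) (\<Psi> t)))\<^sup>2"
proof -
  have "2 * pos2 R j t = mul (\<lambda>x. 2 * wt0 R (crd j x)) (\<Psi> t) \<bullet> \<Psi> t"
    unfolding pos2_def M0_def by (simp add: mul_scale_fun wt_dom[OF R])
  also have "\<dots> \<le> (norm (mul (crd j) (\<Psi> t)))\<^sup>2"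
    using wt_bounds(2)[OF R]
    by (intro inner_mul_le_norm mul_scale_fun wt_dom[OF R] in_dom_coordinate[OF dom[OF t] j])
      (simp add: mult.commute)
  finally show ?thesis .
qed

text \<open>Gronwall's inequality for the sum of the \<open>pos2\<close>, shifted by a bound
  \<open>K\<close> of the kinetic part. The resulting bound does not involve R, so it passes to the
  limit.\<close>

lemma spread_bounded: "\<exists>Y\<ge>0. \<forall>s. T \<le> s \<and> s \<le> t \<longrightarrow> spread s \<le> Y"
proof -
  obtain K where K: "K \<ge> 0" "\<And>s. T \<le> s \<Longrightarrow> s \<le> t \<Longrightarrow> kin s \<le> K"
    using kin_bounded[of t] by blast
  \<comment> \<open>The Gronwall rate: \<open>pos2\<close> has derivative
    \<open>dil R j r / r ^ 3\<close>, and r is at least T.\<close>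
  define C where "C = 1 / T ^ 3"
  have C: "C > 0"
    using T_pos by (simp add: C_def)
  \<comment> \<open>The factor 2 appears because \<open>pos2\<close> regularises half a second
    moment.\<close>
  define Y where "Y = 2 * (spread T + K) * exp (C * (t - T))"
  have spread_nn: "spread s \<ge> 0" for s
    by (simp add: spread_def sum_nonneg)
  have bd: "(\<Sum>j\<in>Basis. pos2 R j s) \<le> Y / 2" if s: "T \<le> s" "s \<le> t" and R: "R > 0" for s R
  proof -
    define m where "m r = (\<Sum>j\<in>Basis. pos2 R j r)" for r
    \<comment> \<open>The integrating factor is included, so the differential inequality becomes
      monotonicity of this function.\<close>
    define \<phi> where "\<phi> r = (m r + K) * exp (- (C * (r - T)))" for r
    define \<phi>' where "\<phi>' r = ((\<Sum>j\<in>Basis. dil R j r / r ^ 3) - C * (m r + K)) * exp (- (C * (r - T)))" for r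
    have d: "(\<phi> has_real_derivative \<phi>' r) (at r within {T..})" if "r \<ge> T" for r
    proof -
      have "(m has_real_derivative (\<Sum>j\<in>Basis. dil R j r / r ^ 3)) (at r within {T..})"
        unfolding m_def[abs_def] by (intro DERIV_sum pos2_derivative that R)
      then show ?thesis
        unfolding \<phi>_def[abs_def] \<phi>'_def
        by (auto intro!: derivative_eq_intros simp: algebra_simps)
    qed
    have "\<phi> s - \<phi> T \<le> 0 * (s - T)"
    proof (rule increment_le[OF d])
      fix r assume r: "T \<le> r" "r \<le> s"
      have half_le: "(a + b) / 2 \<le> c + b" if "a \<le> 2 * c" "0 \<le> b" for a b c :: real
        using add_mono[of "a / 2" c "b / 2" b] that by (simp add: add_divide_distrib)
      have r0: "r > 0"
        using r T_pos by linarith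
      have "\<bar>dil R j r\<bar> \<le> pos2 R j r + (norm (P j r))\<^sup>2" if j: "j \<in> Basis" for j
      proof -
        have "\<bar>dil R j r\<bar> \<le> norm (M1 R j (\<Psi> r)) * norm (P j r)"
          using Cauchy_Schwarz_ineq2[of "M1 R j (\<Psi> r)" "imul (P j r)"]
          by (simp add: dil_def norm_eq_sqrt_inner[of "imul _"] flip: norm_eq_sqrt_inner)
        also have "\<dots> \<le> ((norm (M1 R j (\<Psi> r)))\<^sup>2 + (norm (P j r))\<^sup>2) / 2"
          using sum_squares_bound[of "norm (M1 R j (\<Psi> r))" "norm (P j r)"] by simp
        also have "\<dots> \<le> pos2 R j r + (norm (P j r))\<^sup>2"
          unfolding pos2_def by (rule half_le[OF M_norms(5)[OF R] zero_le_power2])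
        finally show ?thesis .
      qed
      then have "(\<Sum>j\<in>Basis. \<bar>dil R j r\<bar>) \<le> m r + kin r"
        unfolding m_def kin_def sum.distrib[symmetric] by (rule sum_mono)
      also have "\<dots> \<le> m r + K"
        using K(2)[of r] r s by simp
      finally have le: "(\<Sum>j\<in>Basis. \<bar>dil R j r\<bar>) \<le> m r + K" .
      have "(\<Sum>j\<in>Basis. dil R j r / r ^ 3) \<le> (\<Sum>j\<in>Basis. \<bar>dil R j r\<bar>) * (1 / r ^ 3)"
        unfolding sum_distrib_right using r0 by (intro sum_mono) (auto simp: divide_right_mono)
      also have "\<dots> \<le> (m r + K) * C"
      proof (rule mult_mono[OF le])
        show "1 / r ^ 3 \<le> C"
          unfolding C_def using r T_pos by (intro divide_left_mono power_mono) auto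
        show "0 \<le> m r + K"
          using le by (rule order_trans[rotated]) (simp add: sum_nonneg)
      qed (use r0 in auto)
      finally show "\<phi>' r \<le> 0"
        unfolding \<phi>'_def by (intro mult_nonpos_nonneg) (auto simp: mult.commute)
    qed (use s in auto)
    then have "\<phi> s \<le> m T + K"
      by (simp add: \<phi>_def)
    also have "m T \<le> spread T"
    proof -
      have "2 * m T \<le> spread T"
        unfolding m_def spread_def sum_distrib_left by (intro sum_mono pos2_le R) auto
      then show ?thesis
        using spread_nn[of T] by linarith
    qed
    finally have "(m s + K) * exp (- (C * (s - T))) * exp (C * (s - T)) \<le> (spread T + K) * exp (C * (s - T))"
      unfolding \<phi>_def by (intro mult_right_mono) auto
    then have "m s + K \<le> (spread T + K) * exp (C * (s - T))"
      by (simp add: mult.assoc flip: exp_add)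
    also have "\<dots> \<le> (spread T + K) * exp (C * (t - T))"
      using spread_nn[of T] K(1) C s by (intro mult_left_mono) auto
    finally show ?thesis
      using K(1) unfolding Y_def m_def by linarith
  qed
  have "spread s \<le> Y" if s: "T \<le> s" "s \<le> t" for s
  proof -
    have "(\<lambda>n. \<Sum>j\<in>Basis. pos2 (real (Suc n)) j s) \<longlonglongrightarrow>
        (\<Sum>j\<in>Basis. (norm (mul (crd j) (\<Psi> s)))\<^sup>2 / 2)"
      by (intro tendsto_sum M_limits s)
    from LIMSEQ_le_const2[OF this, of "Y / 2"] bd[OF s] show ?thesis
      by (simp add: spread_def flip: sum_divide_distrib)
  qed
  moreover have "Y \<ge> 0"
    using spread_nn[of T] K(1) by (simp add: Y_def)
  ultimately show ?thesis
    by blast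
qed

text \<open>The regularisation of the function \<open>E\<close> of the introduction; \<open>lyap_lim\<close> below is \<open>E\<close> itself.\<close>

definition lyap :: "real \<Rightarrow> real \<Rightarrow> real" where
  "lyap R t = (\<Sum>j\<in>Basis. pos2 R j t + dil R j t / (2 * t\<^sup>2)) + energy t / (4 * t) - t\<^sup>2 * f x0 / 4"

text \<open>The first term is nonpositive since \<open>wt2\<close> is at most 1, the second is of
  order 1 / R through \<open>wt3\<close>, and the third is the formal derivative, which
  \<open>virial_bound\<close> controls up to order 1 / R.\<close>

definition lyap' :: "real \<Rightarrow> real \<Rightarrow> real" where
  "lyap' R t = (\<Sum>j\<in>Basis. P j t \<bullet> M2 R j (P j t) - (norm (P j t))\<^sup>2) / (2 * t ^ 5) +
    (\<Sum>j\<in>Basis. P j t \<bullet> M3 R j (\<Psi> t)) / (4 * t ^ 5) +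
    t / 2 * (pot t - f x0 - (\<Sum>j\<in>Basis. force R j t))"

text \<open>The coefficient 1 / (2 t^2) has derivative -1 / t^3, which cancels
  \<open>dil R j t / t ^ 3\<close> coming from \<open>pos2\<close>.\<close>

lemma lyap_derivative:
  assumes t: "t \<ge> T" and R: "R > 0"
  shows "(lyap R has_real_derivative lyap' R t) (at t within {T..})"
proof -
  have t0: "t > 0"
    using t T_pos by linarith
  define e' where "e' = - (3 / (2 * t ^ 4)) * kin t + 3 * t\<^sup>2 * pot t"
  define a' where "a' j = (P j t \<bullet> M2 R j (P j t) + (1 / 2) * (P j t \<bullet> M3 R j (\<Psi> t))) / t ^ 3 - t ^ 3 * force R j t" for j
  have deriv: "(lyap R has_real_derivative
      (\<Sum>j\<in>Basis. dil R j t / t ^ 3 + (a' j / (2 * t\<^sup>2) - dil R j t / t ^ 3)) +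
      (e' / (4 * t) - energy t / (4 * t\<^sup>2)) - t * f x0 / 2) (at t within {T..})"
  proof -
    have "((\<lambda>t. dil R j t / (2 * t\<^sup>2)) has_real_derivative a' j / (2 * t\<^sup>2) - dil R j t / t ^ 3) (at t within {T..})"
      if j: "j \<in> Basis" for j
    proof -
      have "(dil R j has_real_derivative a' j) (at t within {T..})"
        unfolding a'_def by (rule dil_derivative[OF t j R])
      moreover have "((\<lambda>t. 1 / (2 * t\<^sup>2)) has_real_derivative - (1 / t ^ 3)) (at t within {T..})"
        using t0 by (auto intro!: derivative_eq_intros simp: field_simps eval_nat_numeral)
      ultimately have "((\<lambda>t. dil R j t * (1 / (2 * t\<^sup>2))) has_real_derivative
          a' j * (1 / (2 * t\<^sup>2)) + - (1 / t ^ 3) * dil R j t) (at t within {T..})"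
        by (rule DERIV_mult)
      then show ?thesis
        by simp
    qed
    moreover have "((\<lambda>t. energy t / (4 * t)) has_real_derivative e' / (4 * t) - energy t / (4 * t\<^sup>2)) (at t within {T..})"
    proof -
      have "(energy has_real_derivative e') (at t within {T..})"
        unfolding e'_def by (rule energy_derivative[OF t])
      moreover have "((\<lambda>t. 1 / (4 * t)) has_real_derivative - (1 / (4 * t\<^sup>2))) (at t within {T..})"
        using t0 by (auto intro!: derivative_eq_intros simp: field_simps eval_nat_numeral)
      ultimately have "((\<lambda>t. energy t * (1 / (4 * t))) has_real_derivative
          e' * (1 / (4 * t)) + - (1 / (4 * t\<^sup>2)) * energy t) (at t within {T..})"
        by (rule DERIV_mult)
      then show ?thesis
        by simp
    qed
    moreover have "((\<lambda>t. t\<^sup>2 * f x0 / 4) has_real_derivative t * f x0 / 2) (at t within {T..})"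
      by (auto intro!: derivative_eq_intros)
    ultimately show ?thesis
      unfolding lyap_def[abs_def]
      by (intro DERIV_diff DERIV_add DERIV_sum pos2_derivative[OF t _ R])
  qed
  have B: "(\<Sum>j\<in>Basis. dil R j t / t ^ 3 + (a' j / (2 * t\<^sup>2) - dil R j t / t ^ 3)) =
      (\<Sum>j\<in>Basis. P j t \<bullet> M2 R j (P j t)) / (2 * t ^ 5) + (\<Sum>j\<in>Basis. P j t \<bullet> M3 R j (\<Psi> t)) / (4 * t ^ 5) -
      t / 2 * (\<Sum>j\<in>Basis. force R j t)"
  proof -
    have "dil R j t / t ^ 3 + (a' j / (2 * t\<^sup>2) - dil R j t / t ^ 3) =
        P j t \<bullet> M2 R j (P j t) / (2 * t ^ 5) + P j t \<bullet> M3 R j (\<Psi> t) / (4 * t ^ 5) - t / 2 * force R j t" for j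
      unfolding a'_def using t0 by (simp add: field_simps eval_nat_numeral)
    then show ?thesis
      by (simp add: sum.distrib sum_subtractf sum_divide_distrib sum_distrib_left)
  qed
  \<comment> \<open>The kinetic part combines to -3/8 - 1/8 = -1/2 over t^5, matching the
    coefficient of the \<open>M2\<close> term; the potential part to 3/4 - 1/4 = 1/2 times
    t.\<close>
  have C: "(e' / (4 * t) - energy t / (4 * t\<^sup>2)) - t * f x0 / 2 =
      - kin t / (2 * t ^ 5) + t / 2 * (pot t - f x0)"
    unfolding e'_def energy_eq[OF t] using t0 by (simp add: field_simps eval_nat_numeral)
  have D: "(\<Sum>j\<in>Basis. P j t \<bullet> M2 R j (P j t) - (norm (P j t))\<^sup>2) / (2 * t ^ 5) =
      (\<Sum>j\<in>Basis. P j t \<bullet> M2 R j (P j t)) / (2 * t ^ 5) - kin t / (2 * t ^ 5)"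
    by (simp add: sum_subtractf kin_def diff_divide_distrib)
  have E: "t / 2 * (pot t - f x0 - F) = t / 2 * (pot t - f x0) - t / 2 * F" for F
    by (rule right_diff_distrib)
  have "(\<Sum>j\<in>Basis. dil R j t / t ^ 3 + (a' j / (2 * t\<^sup>2) - dil R j t / t ^ 3)) +
      (e' / (4 * t) - energy t / (4 * t\<^sup>2)) - t * f x0 / 2 = lyap' R t"
    unfolding lyap'_def B D E using C by linarith
  then show ?thesis
    using deriv by (simp only:)
qed

text \<open>\<open>C\<close> depends on \<open>t\<close> through the bounds of \<open>kin\<close>
  and \<open>spread\<close> on the interval from T to t, but not on \<open>n\<close>; at fixed
  \<open>t\<close> the right side tends to 0.\<close>

lemma lyap_increment: "\<exists>C. \<forall>n. t \<ge> T \<longrightarrow> lyap (real (Suc n)) t - lyap (real (Suc n)) T \<le> C / real (Suc n) * (t - T)"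
proof -
  obtain K where K: "K \<ge> 0" "\<And>s. T \<le> s \<Longrightarrow> s \<le> t \<Longrightarrow> kin s \<le> K"
    using kin_bounded[of t] by blast
  obtain Y where Y: "Y \<ge> 0" "\<And>s. T \<le> s \<Longrightarrow> s \<le> t \<Longrightarrow> spread s \<le> Y"
    using spread_bounded[of t] by blast
  define N where "N = real DIM('a)"
  \<comment> \<open>The factor 6 comes from the bound 6 / R on \<open>wt3\<close>, and
    \<open>sqrt K\<close> from Cauchy-Schwarz with a state of norm 1; the second summand is the
    virial error.\<close>
  define C where "C = N * (6 * sqrt K) / (4 * T ^ 5) + t / 2 * (\<bar>L\<bar> * Y)"
  have "lyap (real (Suc n)) t - lyap (real (Suc n)) T \<le> C / real (Suc n) * (t - T)" if tT: "t \<ge> T" for n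
  proof (rule increment_le[OF lyap_derivative _ tT])
    define R where "R = real (Suc n)"
    show R: "real (Suc n) > 0"
      by simp
    then have R': "R > 0"
      by (simp add: R_def)
    fix s assume s: "T \<le> s" "s \<le> t"
    have s0: "s > 0"
      using s T_pos by linarith
    have 1: "(\<Sum>j\<in>Basis. P j s \<bullet> M2 R j (P j s) - (norm (P j s))\<^sup>2) / (2 * s ^ 5) \<le> 0"
      using M_norms(4)[OF R'] s0
      by (intro divide_nonpos_pos sum_nonpos) (auto simp: inner_commute)
    have "(\<Sum>j\<in>Basis. P j s \<bullet> M3 R j (\<Psi> s)) \<le> (\<Sum>j\<in>(Basis::'a set). sqrt K * (6 / R))"
    proof (rule sum_mono)
      fix j :: 'a assume j: "j \<in> Basis"
      have "(norm (P j s))\<^sup>2 \<le> K"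
        using norm_P_le[OF j, of s] K(2)[OF s] by linarith
      then have Ps: "norm (P j s) \<le> sqrt K"
        by (rule real_le_rsqrt)
      have "P j s \<bullet> M3 R j (\<Psi> s) \<le> norm (P j s) * norm (M3 R j (\<Psi> s))"
        by (rule norm_cauchy_schwarz)
      also have "\<dots> \<le> sqrt K * (6 / R)"
        using Ps M_norms(3)[OF R', of j "\<Psi> s"] norm_Psi[OF s(1)] K(1) by (intro mult_mono) auto
      finally show "P j s \<bullet> M3 R j (\<Psi> s) \<le> sqrt K * (6 / R)" .
    qed
    also have "\<dots> = N * (6 * sqrt K) / R"
      by (simp add: N_def)
    finally have "(\<Sum>j\<in>Basis. P j s \<bullet> M3 R j (\<Psi> s)) / (4 * s ^ 5) \<le> N * (6 * sqrt K) / R / (4 * s ^ 5)"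
      using s0 by (intro divide_right_mono) auto
    also have "\<dots> \<le> N * (6 * sqrt K) / R / (4 * T ^ 5)"
      using s T_pos K(1) R' by (intro divide_left_mono mult_left_mono power_mono) (auto simp: N_def)
    finally have 2: "(\<Sum>j\<in>Basis. P j s \<bullet> M3 R j (\<Psi> s)) / (4 * s ^ 5) \<le> N * (6 * sqrt K) / (4 * T ^ 5) / R"
      by (simp add: field_simps)
    have "pot s - f x0 - (\<Sum>j\<in>Basis. force R j s) \<le> \<bar>L\<bar> / R * spread s"
      using virial_bound[OF dom[OF s(1)] partial1[OF s(1)] R'] norm_Psi[OF s(1)]
      by (simp add: pot_def force_def M1_def spread_def dot_square_norm)
    also have "\<dots> \<le> \<bar>L\<bar> / R * Y"
      using Y(2)[OF s] R' by (intro mult_left_mono) auto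
    finally have "s / 2 * (pot s - f x0 - (\<Sum>j\<in>Basis. force R j s)) \<le> s / 2 * (\<bar>L\<bar> / R * Y)"
      using s0 by (intro mult_left_mono) auto
    also have "\<dots> \<le> t / 2 * (\<bar>L\<bar> / R * Y)"
      using s R' Y(1) by (intro mult_right_mono) auto
    also have "\<dots> = t / 2 * (\<bar>L\<bar> * Y) / R"
      by simp
    finally have 3: "s / 2 * (pot s - f x0 - (\<Sum>j\<in>Basis. force R j s)) \<le> t / 2 * (\<bar>L\<bar> * Y) / R" .
    show "lyap' (real (Suc n)) s \<le> C / real (Suc n)"
      using 1 2 3 unfolding lyap'_def C_def R_def[symmetric] add_divide_distrib by linarith
  qed
  then show ?thesis
    by blast
qed

definition lyap_lim :: "real \<Rightarrow> real" where
  "lyap_lim t = (\<Sum>j\<in>Basis. (norm (mul (crd j) (\<Psi> t)))\<^sup>2 / 2 +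
     - (mul (crd j) (\<Psi> t) \<bullet> imul (P j t)) / (2 * t\<^sup>2)) + energy t / (4 * t) - t\<^sup>2 * f x0 / 4"

lemma lyap_limit:
  assumes t: "t \<ge> T"
  shows "(\<lambda>n. lyap (real (Suc n)) t) \<longlonglongrightarrow> lyap_lim t"
  unfolding lyap_def lyap_lim_def dil_def using t T_pos
  by (intro tendsto_diff tendsto_add tendsto_sum tendsto_divide tendsto_minus tendsto_inner tendsto_const M_limits) auto

lemma lyap_lim_mono:
  assumes t: "t \<ge> T"
  shows "lyap_lim t \<le> lyap_lim T"
proof -
  obtain C where C: "\<And>n. lyap (real (Suc n)) t - lyap (real (Suc n)) T \<le> C / real (Suc n) * (t - T)"
    using lyap_increment[of t] t by blast
  have "(\<lambda>n. C * inverse (real (Suc n)) * (t - T)) \<longlonglongrightarrow> C * 0 * (t - T)"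
    by (intro tendsto_intros LIMSEQ_inverse_real_of_nat)
  moreover have "(\<lambda>n. lyap (real (Suc n)) t - lyap (real (Suc n)) T) \<longlonglongrightarrow> lyap_lim t - lyap_lim T"
    by (intro tendsto_diff lyap_limit t order_refl)
  ultimately have "lyap_lim t - lyap_lim T \<le> C * 0 * (t - T)"
    using C by (intro LIMSEQ_le[of _ "lyap_lim t - lyap_lim T" "\<lambda>n. C * inverse (real (Suc n)) * (t - T)"])
      (auto simp: divide_inverse)
  then show ?thesis
    by simp
qed

text \<open>Completing the square: the remaining terms are \<open>\<parallel>(y\<^sub>j - \<i> \<partial>\<^sub>j / (2 t\<^sup>2)) \<Psi>\<parallel>\<^sup>2 / 2\<close>.\<close>

lemma pot_le_lyap_lim:
  assumes t: "t \<ge> T"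
  shows "t\<^sup>2 / 4 * (pot t - f x0) \<le> lyap_lim t"
proof -
  have t0: "t > 0"
    using t T_pos by linarith
  define V where "V j = mul (crd j) (\<Psi> t)" for j
  have sq: "0 \<le> (norm (V j))\<^sup>2 / 2 + - (V j \<bullet> imul (P j t)) / (2 * t\<^sup>2) + (norm (P j t))\<^sup>2 / (8 * t ^ 4)" for j
  proof -
    have "0 \<le> (norm (V j - (1 / (2 * t\<^sup>2)) *\<^sub>R imul (P j t)))\<^sup>2 / 2"
      by simp
    also have "(norm (V j - c *\<^sub>R imul (P j t)))\<^sup>2 =
        (norm (V j))\<^sup>2 - 2 * c * (V j \<bullet> imul (P j t)) + c\<^sup>2 * (norm (P j t))\<^sup>2" for c
      unfolding power2_norm_eq_inner
      by (simp add: inner_diff_left inner_diff_right inner_commute[of "imul _" "V j"] power2_eq_square algebra_simps)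
    finally show ?thesis
      using t0 by (simp add: field_simps eval_nat_numeral)
  qed
  have "0 \<le> (\<Sum>j\<in>Basis. (norm (V j))\<^sup>2 / 2 + - (V j \<bullet> imul (P j t)) / (2 * t\<^sup>2) + (norm (P j t))\<^sup>2 / (8 * t ^ 4))"
    by (intro sum_nonneg sq)
  also have "\<dots> = (\<Sum>j\<in>Basis. (norm (V j))\<^sup>2 / 2 + - (V j \<bullet> imul (P j t)) / (2 * t\<^sup>2)) + kin t / (8 * t ^ 4)"
    by (simp add: sum.distrib kin_def sum_divide_distrib)
  finally have "0 \<le> lyap_lim t + kin t / (8 * t ^ 4) - energy t / (4 * t) + t\<^sup>2 * f x0 / 4"
    by (simp add: lyap_lim_def V_def)
  \<comment> \<open>The kinetic share of this term is precisely what completes the squares; the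
    potential share is the quantity to be bounded.\<close>
  moreover have "energy t / (4 * t) = kin t / (8 * t ^ 4) + t\<^sup>2 / 4 * pot t"
    unfolding energy_eq[OF t] using t0 by (simp add: field_simps eval_nat_numeral)
  ultimately show ?thesis
    by (simp add: right_diff_distrib)
qed

lemma pot_decay:
  assumes t: "t \<ge> T"
  shows "pot t - f x0 \<le> 4 * lyap_lim T / t\<^sup>2"
proof -
  have t0: "t > 0"
    using t T_pos by linarith
  have "t\<^sup>2 / 4 * (pot t - f x0) \<le> lyap_lim T"
    using pot_le_lyap_lim[OF t] lyap_lim_mono[OF t] by linarith
  then show ?thesis
    using t0 by (simp add: field_simps)
qed

end

section \<open>From solutions given by functions to the abstract setting\<close>

lemma hamiltonian_l2:
  fixes u v :: "'a::euclidean_space \<Rightarrow> complex"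
  assumes H: "hamiltonian f t u (\<lambda>x. \<i> * v x)" and v: "v \<in> L2" and f: "f \<in> borel_measurable borel"
  obtains p q w where "\<And>i. i \<in> Basis \<Longrightarrow> has_partial i (abs_l2 u) (p i)"
    "\<And>i j. i \<in> Basis \<Longrightarrow> j \<in> Basis \<Longrightarrow> has_partial j (p i) (q i j)"
    "w = (\<Sum>i\<in>Basis. q i i)" "in_dom f (abs_l2 u)"
    "imul (abs_l2 v) = (- (1 / (2 * t ^ 3))) *\<^sub>R w + t ^ 3 *\<^sub>R mul f (abs_l2 u)"
proof -
  obtain w where w: "laplacian u w" "(\<lambda>x. f x *\<^sub>R u x) \<in> L2"
    "AE x in lborel. \<i> * v x = (1 / t ^ 3) *\<^sub>R (- (1 / 2) *\<^sub>R w x) + t ^ 3 *\<^sub>R (f x *\<^sub>R u x)"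
    using H by (auto simp: hamiltonian_def)
  then have L: "u \<in> L2" "w \<in> L2"
    by (auto simp: laplacian_def)
  obtain p q where pq: "\<And>i. i \<in> Basis \<Longrightarrow> p i \<in> L2 \<and> weak_partial i u (p i)"
    "\<And>i j. i \<in> Basis \<Longrightarrow> j \<in> Basis \<Longrightarrow> q i j \<in> L2 \<and> weak_partial j (p i) (q i j)"
    "AE x in lborel. w x = (\<Sum>i\<in>Basis. q i i x)"
    using w(1) unfolding laplacian_def by blast
  have d: "in_dom f (abs_l2 u)"
    using L w(2) f by (simp add: in_dom_abs_l2)
  have sum: "(\<lambda>x. \<Sum>i\<in>Basis. q i i x) \<in> L2" "abs_l2 (\<lambda>x. \<Sum>i\<in>Basis. q i i x) = (\<Sum>i\<in>Basis. abs_l2 (q i i))"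
    using pq(2) by (auto intro!: abs_l2_sum)
  have "abs_l2 w = (\<Sum>i\<in>Basis. abs_l2 (q i i))"
    unfolding sum(2)[symmetric] by (rule abs_l2_cong_AE[OF L(2) sum(1) pq(3)])
  moreover have "imul (abs_l2 v) = (- (1 / (2 * t ^ 3))) *\<^sub>R abs_l2 w + t ^ 3 *\<^sub>R mul f (abs_l2 u)"
  proof -
    have L': "(\<lambda>x. (- (1 / (2 * t ^ 3))) *\<^sub>R w x) \<in> L2" "(\<lambda>x. t ^ 3 *\<^sub>R (f x *\<^sub>R u x)) \<in> L2"
      using L2_scaleR[OF L(2)] L2_scaleR[OF w(2)] by blast+
    have "(- (1 / (2 * t ^ 3))) *\<^sub>R abs_l2 w + t ^ 3 *\<^sub>R mul f (abs_l2 u) =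
        abs_l2 (\<lambda>x. (- (1 / (2 * t ^ 3))) *\<^sub>R w x + t ^ 3 *\<^sub>R (f x *\<^sub>R u x))"
      unfolding mul_abs_l2[OF L(1) d] scaleR_abs_l2[OF L(2)] scaleR_abs_l2[OF w(2)] add_abs_l2[OF L'] ..
    also have "\<dots> = abs_l2 (\<lambda>x. \<i> * v x)"
    proof (rule abs_l2_cong_AE[OF L2_add[OF L'] L2_cmult[OF v]])
      show "AE x in lborel. (- (1 / (2 * t ^ 3))) *\<^sub>R w x + t ^ 3 *\<^sub>R (f x *\<^sub>R u x) = \<i> * v x"
        using w(3)
      proof eventually_elim
        case (elim x)
        have "(1 / t ^ 3) *\<^sub>R (- (1 / 2) *\<^sub>R w x) = (- (1 / (2 * t ^ 3))) *\<^sub>R w x"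
          unfolding scaleR_scaleR by simp
        then show ?case
          unfolding elim by simp
      qed
    qed
    finally show ?thesis
      using v by (simp add: imul_abs_l2)
  qed
  moreover have "has_partial i (abs_l2 u) (abs_l2 (p i))" if "i \<in> Basis" for i
    using pq(1)[OF that] by (intro weak_partial_has_partial L) auto
  moreover have "has_partial j (abs_l2 (p i)) (abs_l2 (q i j))" if "i \<in> Basis" "j \<in> Basis" for i j
    using pq(1)[OF that(1)] pq(2)[OF that] by (intro weak_partial_has_partial) auto
  ultimately show ?thesis
    using d by (intro that[of "\<lambda>i. abs_l2 (p i)" "\<lambda>i j. abs_l2 (q i j)" "abs_l2 w"])
qed

theorem theorem9:
  fixes f :: "real ^ 'n \<Rightarrow> real"
    and x_star :: "real ^ 'n"
    and T\<^sub>0 :: real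
    and \<Psi> :: "real \<Rightarrow> real ^ 'n \<Rightarrow> complex"
    and \<Psi>\<^sub>0 :: "real ^ 'n \<Rightarrow> complex"
    and M :: "'w measure"
    and X :: "real \<Rightarrow> 'w \<Rightarrow> real ^ 'n"
  assumes "locally_integrable f"
    and "\<exists>L. L-lipschitz_on UNIV f"
    and "convex_on UNIV f"
    and "\<forall>x. f x_star \<le> f x"
    and "\<forall>y. (\<forall>x. f y \<le> f x) \<longrightarrow> y = x_star"
    and "T\<^sub>0 > 0"
    and "smooth \<Psi>\<^sub>0"
    and "L2_norm \<Psi>\<^sub>0 = 1"
    and "schroedinger_solution f T\<^sub>0 \<Psi>"
    and "\<forall>x. \<Psi> T\<^sub>0 x = \<Psi>\<^sub>0 x"
    and "prob_space M"
    and "\<forall>t\<ge>T\<^sub>0. distributed M lborel (X t) (\<lambda>x. ennreal ((cmod (\<Psi> t x))\<^sup>2))"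
  shows "\<exists>C. \<forall>t\<ge>T\<^sub>0. integrable M (\<lambda>\<omega>. f (X t \<omega>)) \<and>
           prob_space.expectation M (\<lambda>\<omega>. f (X t \<omega>)) - f x_star \<le> C * t powr (-2)"
proof -
  obtain L where L: "L-lipschitz_on UNIV f"
    using assms(2) by blast
  interpret convex_potential f L x_star
  proof
    show "\<bar>f x - f y\<bar> \<le> L * norm (x - y)" for x y
      using lipschitz_onD[OF L, of x y] by (simp add: dist_norm)
    show "y = x_star" if "\<And>x. f y \<le> f x" for y
      using assms(5) that by blast
    show "f x_star \<le> f x" for x
      using assms(4) by blast
  qed (rule assms(3))
  obtain D where D: "\<And>t. t \<ge> T\<^sub>0 \<Longrightarrow> \<Psi> t \<in> L2" "\<And>t. t \<ge> T\<^sub>0 \<Longrightarrow> D t \<in> L2"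
    "\<And>t. t \<ge> T\<^sub>0 \<Longrightarrow> has_L2_derivative \<Psi> (D t) t {T\<^sub>0..}" "L2_continuous_on {T\<^sub>0..} D"
    "\<And>t. t \<ge> T\<^sub>0 \<Longrightarrow> hamiltonian f t (\<Psi> t) (\<lambda>x. \<i> * D t x)"
    using assms(9) unfolding schroedinger_solution_def by blast
  \<comment> \<open>Bundled into one predicate so that a single use of choice yields the witnesses
    as functions of time.\<close>
  define dom_data where "dom_data t p q w \<longleftrightarrow> (\<forall>i\<in>Basis. has_partial i (abs_l2 (\<Psi> t)) (p i)) \<and>
      (\<forall>i\<in>Basis. \<forall>j\<in>Basis. has_partial j (p i) (q i j)) \<and> w = (\<Sum>i\<in>Basis. q i i) \<and>
      in_dom f (abs_l2 (\<Psi> t)) \<and>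
      imul (abs_l2 (D t)) = (- (1 / (2 * t ^ 3))) *\<^sub>R w + t ^ 3 *\<^sub>R mul f (abs_l2 (\<Psi> t))" for t p q w
  have "\<exists>p q w. t \<ge> T\<^sub>0 \<longrightarrow> dom_data t p q w" for t
  proof (cases "t \<ge> T\<^sub>0")
    case True
    obtain p q w where "\<And>i. i \<in> Basis \<Longrightarrow> has_partial i (abs_l2 (\<Psi> t)) (p i)"
      "\<And>i j. i \<in> Basis \<Longrightarrow> j \<in> Basis \<Longrightarrow> has_partial j (p i) (q i j)"
      "w = (\<Sum>i\<in>Basis. q i i)" "in_dom f (abs_l2 (\<Psi> t))"
      "imul (abs_l2 (D t)) = (- (1 / (2 * t ^ 3))) *\<^sub>R w + t ^ 3 *\<^sub>R mul f (abs_l2 (\<Psi> t))"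
      using hamiltonian_l2[OF D(5)[OF True] D(2)[OF True] f_measurable] by blast
    then have "dom_data t p q w"
      unfolding dom_data_def by blast
    then show ?thesis
      by blast
  qed simp
  then have "\<forall>t. \<exists>p q w. t \<ge> T\<^sub>0 \<longrightarrow> dom_data t p q w"
    by blast
  then obtain p q w where pqw: "\<And>t. t \<ge> T\<^sub>0 \<Longrightarrow> dom_data t (p t) (q t) (w t)"
    unfolding choice_iff by blast
  have data: "\<forall>i\<in>Basis. has_partial i (abs_l2 (\<Psi> t)) (p t i)"
      "\<forall>i\<in>Basis. \<forall>j\<in>Basis. has_partial j (p t i) (q t i j)" "w t = (\<Sum>i\<in>Basis. q t i i)"
      "in_dom f (abs_l2 (\<Psi> t))"
      "imul (abs_l2 (D t)) = (- (1 / (2 * t ^ 3))) *\<^sub>R w t + t ^ 3 *\<^sub>R mul f (abs_l2 (\<Psi> t))"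
    if "t \<ge> T\<^sub>0" for t
    using pqw[OF that] unfolding dom_data_def by blast+
  interpret M: prob_space M
    by fact
  have Psi_L2: "integrable lborel (\<lambda>x. (cmod (\<Psi> t x))\<^sup>2 * g x) = integrable M (\<lambda>\<omega>. g (X t \<omega>))"
    "(LINT x|lborel. (cmod (\<Psi> t x))\<^sup>2 * g x) = (LINT \<omega>|M. g (X t \<omega>))"
    if "t \<ge> T\<^sub>0" "g \<in> borel_measurable borel" for t and g :: "real ^ 'n \<Rightarrow> real"
    using distributed_integrable[of M lborel "X t" "\<lambda>x. (cmod (\<Psi> t x))\<^sup>2" g]
      distributed_integral[of M lborel "X t" "\<lambda>x. (cmod (\<Psi> t x))\<^sup>2" g] assms(12) that
    by auto
  interpret qhd f L x_star T\<^sub>0 "\<lambda>t. abs_l2 (\<Psi> t)" "\<lambda>t. abs_l2 (D t)" w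
    "\<lambda>j t. p t j" "\<lambda>i j t. q t i j"
  proof
    \<comment> \<open>Taking the constant function 1 in the transfer to \<open>M\<close>: the
      density of \<open>X t\<close> has total mass 1.\<close>
    show "norm (abs_l2 (\<Psi> t)) = 1" if "t \<ge> T\<^sub>0" for t
      using Psi_L2(2)[OF that, of "\<lambda>_. 1"] D(1)[OF that] by (simp add: norm_abs_l2 L2_norm_def M.prob_space)
    show "((\<lambda>s. (abs_l2 (\<Psi> s) - abs_l2 (\<Psi> t)) /\<^sub>R (s - t)) \<longlongrightarrow> abs_l2 (D t)) (at t within {T\<^sub>0..})"
      if t: "t \<ge> T\<^sub>0" for t
    proof -
      \<comment> \<open>Restricted to \<open>s \<ge> T\<^sub>0\<close>, where the values of the
        solution are in \<open>L2\<close> and hence represent classes.\<close>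
      have eq: "L2_norm (\<lambda>x. (1 / (s - t)) *\<^sub>R (\<Psi> s x - \<Psi> t x) - D t x) =
          norm ((abs_l2 (\<Psi> s) - abs_l2 (\<Psi> t)) /\<^sub>R (s - t) - abs_l2 (D t))" if s: "s \<ge> T\<^sub>0" for s
      proof -
        have 1: "(\<lambda>x. \<Psi> s x - \<Psi> t x) \<in> L2"
          using D(1) s t by (intro L2_diff) auto
        have 2: "(\<lambda>x. inverse (s - t) *\<^sub>R (\<Psi> s x - \<Psi> t x)) \<in> L2"
          by (rule L2_scaleR[OF 1])
        show ?thesis
          unfolding diff_abs_l2[OF D(1)[OF s] D(1)[OF t]] scaleR_abs_l2[OF 1] diff_abs_l2[OF 2 D(2)[OF t]]
            norm_abs_l2[OF L2_diff[OF 2 D(2)[OF t]]] by (simp add: inverse_eq_divide)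
      qed
      have "((\<lambda>s. norm ((abs_l2 (\<Psi> s) - abs_l2 (\<Psi> t)) /\<^sub>R (s - t) - abs_l2 (D t))) \<longlongrightarrow> 0) (at t within {T\<^sub>0..})"
        using D(3)[OF t] unfolding has_L2_derivative_def
        by (rule Lim_transform_eventually) (simp add: eventually_at_filter eq)
      then show ?thesis
        by (simp add: tendsto_norm_zero_iff LIM_zero_iff)
    qed
    show "continuous_on {T\<^sub>0..} (\<lambda>t. abs_l2 (D t))"
      unfolding continuous_on_def
    proof
      fix t assume t: "t \<in> {T\<^sub>0..}"
      have eq: "L2_norm (\<lambda>x. D s x - D t x) = norm (abs_l2 (D s) - abs_l2 (D t))" if "s \<ge> T\<^sub>0" for s
        using D(2) t that by (simp add: diff_abs_l2 norm_abs_l2 L2_diff)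
      have "((\<lambda>s. L2_norm (\<lambda>x. D s x - D t x)) \<longlongrightarrow> 0) (at t within {T\<^sub>0..})"
        using D(4) t by (simp add: L2_continuous_on_def)
      then have "((\<lambda>s. norm (abs_l2 (D s) - abs_l2 (D t))) \<longlongrightarrow> 0) (at t within {T\<^sub>0..})"
        by (rule Lim_transform_eventually) (simp add: eventually_at_filter eq)
      then show "((\<lambda>t. abs_l2 (D t)) \<longlongrightarrow> abs_l2 (D t)) (at t within {T\<^sub>0..})"
        by (simp add: tendsto_norm_zero_iff LIM_zero_iff)
    qed
    show "in_dom f (abs_l2 (\<Psi> t))" "w t = (\<Sum>j\<in>Basis. q t j j)"
      "imul (abs_l2 (D t)) = - (1 / (2 * t ^ 3)) *\<^sub>R w t + t ^ 3 *\<^sub>R mul f (abs_l2 (\<Psi> t))"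
      if "t \<ge> T\<^sub>0" for t
      by (fact data(4)[OF that] data(3)[OF that] data(5)[OF that])+
    show "has_partial j (abs_l2 (\<Psi> t)) (p t j)" if "t \<ge> T\<^sub>0" "j \<in> Basis" for t j
      using data(1)[OF that(1)] that(2) by blast
    show "has_partial k (p t j) (q t j k)" if "t \<ge> T\<^sub>0" "j \<in> Basis" "k \<in> Basis" for t j k
      using data(2)[OF that(1)] that(2,3) by blast
  qed (rule assms(6))
  show ?thesis
  proof (intro exI[of _ "4 * lyap_lim T\<^sub>0"] allI impI conjI)
    fix t assume t: "t \<ge> T\<^sub>0"
    have fL: "(\<lambda>x. f x *\<^sub>R \<Psi> t x) \<in> L2"
      using dom[OF t] D(1)[OF t] by (simp add: in_dom_abs_l2)
    have eq: "(f x *\<^sub>R \<Psi> t x) \<bullet> \<Psi> t x = (cmod (\<Psi> t x))\<^sup>2 * f x" for x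
      by (simp add: power2_norm_eq_inner mult.commute)
    have "integrable lborel (\<lambda>x. (cmod (\<Psi> t x))\<^sup>2 * f x)"
      using L2_integrable_inner[OF fL D(1)[OF t]] unfolding eq .
    then show "integrable M (\<lambda>\<omega>. f (X t \<omega>))"
      using Psi_L2(1)[OF t f_measurable] by simp
    have "pot t = (LINT x|lborel. (cmod (\<Psi> t x))\<^sup>2 * f x)"
      unfolding pot_def mul_abs_l2[OF D(1)[OF t] dom[OF t]] inner_abs_l2[OF fL D(1)[OF t]] eq ..
    then have "M.expectation (\<lambda>\<omega>. f (X t \<omega>)) = pot t"
      using Psi_L2(2)[OF t f_measurable] by simp
    moreover have "t powr (- 2) = 1 / t\<^sup>2"
      using t assms(6) by (simp add: powr_minus_divide)
    ultimately show "M.expectation (\<lambda>\<omega>. f (X t \<omega>)) - f x_star \<le> 4 * lyap_lim T\<^sub>0 * t powr (- 2)"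
      using pot_decay[OF t] by simp
  qed
qed

end
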